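(* Let $a:\mathbb{R}\to\mathbb{R}$ be a measurable function (not necessarily continuous) for which there are constants $A_0\ge a_0>0$ with $A_0\ge a(x)\ge a_0$ for a.e. $x\in\mathbb{R}$. For $m=(m_1,m_2,m_3):\mathbb{R}\to\mathbb{S}^2$ let $$F(m)=\int_{\mathbb{R}}\Big(a(x)|\partial_x m|^2+a(x)(m_2^2+m_3^2)\Big)\,dx .$$ Then there exists a unique minimizer $m:\mathbb{R}\to\mathbb{S}^2$ of $F$ under the constraints $$m(0)=e_2\quad\text{and}\quad m(\pm\infty)=\pm e_1 .$$ This minimizer has the form $m=(\sin\varphi,\cos\varphi,0)$, where $\varphi:\mathbb{R}\to\mathbb{R}$ is an increasing Lipschitz function with $\varphi(0)=0$ and $\varphi(\pm\infty)=\pm\frac{\pi}{2}$, and $\varphi$ solves the weighted pendulum equation $$\partial_x(a(x)\partial_x\varphi)+a(x)\sin\varphi\cos\varphi=0\quad\text{in }\mathbb{R}\setminus\{0\}.$$ If in addition $a$ is even in $\mathbb{R}$ and non-decreasing in $\mathbb{R}_+=(0,+\infty)$, then $\varphi$ is odd in $\mathbb{R}$, the weighted pendulum equation $\partial_x(a(x)\partial_x\varphi)+a(x)\sin\varphi\cos\varphi=0$ holds in the entire $\mathbb{R}$, and $m$ is a stable critical point of $F$, i.e., for every $v=(v_1,v_2,v_3)\in H^1(\mathbb{R},\mathbb{R}^3)$ with $v\cdot m=0$ in $\mathbb{R}$, $$T(v)=\frac12\frac{d^2}{dt^2}\bigg|_{t=0}F\bigg(\frac{m+tv}{|m+tv|}\bigg)=\int_{\mathbb{R}}\Big(a(x)|\partial_x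 v|^2+a(x)(v_2^2+v_3^2)-\lambda(x)|v|^2\Big)\,dx\ge 0,$$ where $\lambda(x)=a(x)|\partial_x m|^2+a(x)m_2^2$ is the Lagrange multiplier for the constraint $|m|=1$.
   Context: $e_1=(1,0,0)$, $e_2=(0,1,0)$, and $\mathbb{S}^2$ is the unit sphere in $\mathbb{R}^3$. Competitors for $F$ are maps $m\in H^1_{loc}(\mathbb{R},\mathbb{R}^3)$ with values in $\mathbb{S}^2$, identified with their continuous representatives, and $F(m)\in[0,+\infty]$. The notation $m(\pm\infty)=\pm e_1$ means $\lim_{x\to+\infty}m(x)=e_1$ and $\lim_{x\to-\infty}m(x)=-e_1$; similarly $\varphi(\pm\infty)=\pm\frac\pi2$ means $\lim_{x\to+\infty}\varphi(x)=\frac\pi2$ and $\lim_{x\to-\infty}\varphi(x)=-\frac\pi2$. The differential equations are understood in the sense of distributions on the indicated open set. That $m=(\sin\varphi,\cos\varphi,0)$ is a critical point of $F$ means that it satisfies the Euler-Lagrange equation $-\partial_x(a(x)\partial_x m)+a(x)m_2e_2=\lambda(x)m$ in the sense of distributions in $\mathbb{R}$. *)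

theory Defs
  imports "HOL-Analysis.Analysis"
begin

definition test_function :: "real set \<Rightarrow> (real \<Rightarrow> real) \<Rightarrow> bool" where
  "test_function U \<zeta> \<longleftrightarrow>
     (\<forall>n x. (deriv ^^ n) \<zeta> differentiable (at x)) \<and>
     compact (closure {x. \<zeta> x \<noteq> 0}) \<and> closure {x. \<zeta> x \<noteq> 0} \<subseteq> U"

definition locally_integrable_on :: "(real \<Rightarrow> 'a::euclidean_space) \<Rightarrow> real set \<Rightarrow> bool" where
  "locally_integrable_on f U \<longleftrightarrow> (\<forall>K. compact K \<and> K \<subseteq> U \<longrightarrow> set_integrable lebesgue K f)"

text \<open>
  \<open>has_weak_deriv U f g\<close>: the identity \<open>f' = g\<close> between locally integrable functions holds in the
  sense of distributions on the open set \<open>U\<close>. Values outside \<open>U\<close> are irrelevant.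
\<close>

definition has_weak_deriv ::
    "real set \<Rightarrow> (real \<Rightarrow> 'a::euclidean_space) \<Rightarrow> (real \<Rightarrow> 'a) \<Rightarrow> bool" where
  "has_weak_deriv U f g \<longleftrightarrow>
     locally_integrable_on f U \<and> locally_integrable_on g U \<and>
     (\<forall>\<zeta>. test_function U \<zeta> \<longrightarrow>
        (LINT x|lebesgue. deriv \<zeta> x *\<^sub>R f x) = - (LINT x|lebesgue. \<zeta> x *\<^sub>R g x))"

text \<open>
  A weak derivative on the whole line is unique up to null sets; we choose a representative.
  The value is unspecified if there is none, so this is only used for weakly differentiable maps.
\<close>

definition weak_deriv :: "(real \<Rightarrow> 'a::euclidean_space) \<Rightarrow> real \<Rightarrow> 'a" where
  "weak_deriv f = (SOME g. has_weak_deriv UNIV f g)"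

definition L2 :: "(real \<Rightarrow> 'a::euclidean_space) set" where
  "L2 = {f. f \<in> borel_measurable lebesgue \<and> integrable lebesgue (\<lambda>x. (norm (f x))\<^sup>2)}"

definition L2_loc :: "(real \<Rightarrow> 'a::euclidean_space) set" where
  "L2_loc = {f. f \<in> borel_measurable lebesgue \<and>
     (\<forall>K. compact K \<longrightarrow> set_integrable lebesgue K (\<lambda>x. (norm (f x))\<^sup>2))}"

text \<open>
  Every Sobolev class on the line has exactly one continuous representative. The sets below
  consist of these representatives, so that point values, limits and uniqueness of functions
  have their literal meaning.
\<close>

definition H1_loc :: "(real \<Rightarrow> 'a::euclidean_space) set" where
  "H1_loc = {f. continuous_on UNIV f \<and> f \<in> L2_loc \<and> (\<exists>g\<in>L2_loc. has_weak_deriv UNIV f g)}"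

definition H1 :: "(real \<Rightarrow> 'a::euclidean_space) set" where
  "H1 = {f. continuous_on UNIV f \<and> f \<in> L2 \<and> (\<exists>g\<in>L2. has_weak_deriv UNIV f g)}"

definition e1 :: "real^3" where "e1 = vector [1, 0, 0]"

definition e2 :: "real^3" where "e2 = vector [0, 1, 0]"

definition energy :: "(real \<Rightarrow> real) \<Rightarrow> (real \<Rightarrow> real^3) \<Rightarrow> ennreal" where
  "energy a m = (\<integral>\<^sup>+ x. ennreal (a x * (norm (weak_deriv m x))\<^sup>2
                               + a x * ((m x $ 2)\<^sup>2 + (m x $ 3)\<^sup>2)) \<partial>lebesgue)"

definition admissible :: "(real \<Rightarrow> real^3) set" where
  "admissible = {m \<in> H1_loc. (\<forall>x. m x \<in> sphere 0 1) \<and> m 0 = e2 \<and>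
     (m \<longlongrightarrow> e1) at_top \<and> (m \<longlongrightarrow> - e1) at_bot}"

definition minimizer :: "(real \<Rightarrow> real) \<Rightarrow> (real \<Rightarrow> real^3) \<Rightarrow> bool" where
  "minimizer a m \<longleftrightarrow> m \<in> admissible \<and> (\<forall>n\<in>admissible. energy a m \<le> energy a n)"

definition pendulum_on :: "real set \<Rightarrow> (real \<Rightarrow> real) \<Rightarrow> (real \<Rightarrow> real) \<Rightarrow> bool" where
  "pendulum_on U a \<phi> \<longleftrightarrow>
     (\<exists>\<psi>. has_weak_deriv U \<phi> \<psi> \<and>
          has_weak_deriv U (\<lambda>x. a x * \<psi> x) (\<lambda>x. - (a x * sin (\<phi> x) * cos (\<phi> x))))"

definition lagrange_multiplier :: "(real \<Rightarrow> real) \<Rightarrow> (real \<Rightarrow> real^3) \<Rightarrow> real \<Rightarrow> real" where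
  "lagrange_multiplier a m x = a x * (norm (weak_deriv m x))\<^sup>2 + a x * (m x $ 2)\<^sup>2"

text \<open>
  The Euler--Lagrange equation \<open>- (a m')' + a m\<^sub>2 e\<^sub>2 = \<lambda> m\<close> in the sense of distributions on the
  line. The term \<open>a m\<^sub>3 e\<^sub>3\<close> is absent both here and in \<open>\<lambda>\<close>, because this is only used for maps
  \<open>m = (sin \<phi>, cos \<phi>, 0)\<close>.
\<close>

definition critical_point :: "(real \<Rightarrow> real) \<Rightarrow> (real \<Rightarrow> real^3) \<Rightarrow> bool" where
  "critical_point a m \<longleftrightarrow>
     has_weak_deriv UNIV (\<lambda>x. a x *\<^sub>R weak_deriv m x)
       (\<lambda>x. (a x * m x $ 2) *\<^sub>R e2 - lagrange_multiplier a m x *\<^sub>R m x)"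

definition perturbation ::
    "(real \<Rightarrow> real^3) \<Rightarrow> (real \<Rightarrow> real^3) \<Rightarrow> real \<Rightarrow> real \<Rightarrow> real^3" where
  "perturbation m v t x = (1 / norm (m x + t *\<^sub>R v x)) *\<^sub>R (m x + t *\<^sub>R v x)"

definition has_second_deriv :: "(real \<Rightarrow> real) \<Rightarrow> real \<Rightarrow> real \<Rightarrow> bool" where
  "has_second_deriv G D t\<^sub>0 \<longleftrightarrow>
     (\<exists>G'. (\<forall>\<^sub>F t in nhds t\<^sub>0. (G has_real_derivative G' t) (at t)) \<and>
           (G' has_real_derivative D) (at t\<^sub>0))"

text \<open>
  \<open>T\<close> is one half of the second derivative of the energy along the perturbation at \<open>t = 0\<close>. The
  energy is required to be finite for small \<open>t\<close>, since \<open>enn2real \<infinity> = 0\<close>.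
\<close>

definition has_second_variation ::
    "(real \<Rightarrow> real) \<Rightarrow> (real \<Rightarrow> real^3) \<Rightarrow> (real \<Rightarrow> real^3) \<Rightarrow> real \<Rightarrow> bool" where
  "has_second_variation a m v T \<longleftrightarrow>
     (\<forall>\<^sub>F t in nhds 0. energy a (perturbation m v t) < \<infinity>) \<and>
     (\<exists>D. has_second_deriv (\<lambda>t. enn2real (energy a (perturbation m v t))) D 0 \<and> T = 1 / 2 * D)"

definition second_variation_integrand ::
    "(real \<Rightarrow> real) \<Rightarrow> (real \<Rightarrow> real^3) \<Rightarrow> (real \<Rightarrow> real^3) \<Rightarrow> real \<Rightarrow> real" where
  "second_variation_integrand a m v x =
     a x * (norm (weak_deriv v x))\<^sup>2 + a x * ((v x $ 2)\<^sup>2 + (v x $ 3)\<^sup>2)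
     - lagrange_multiplier a m x * (norm (v x))\<^sup>2"

end

theory Submission
  imports Defs "HOL-Computational_Algebra.Polynomial"
begin

text \<open>
  On each half-line the wall profile is found by shooting, after the pendulum equation has been
  rewritten as a first-order system whose bounded solutions are trapped in \<open>[a\<^sub>0, A\<^sub>0]\<close>. For any competitor
  \<open>n\<close>, completing squares against the profile \<open>m\<close> gives, with \<open>r = \<phi>'/sin \<phi>\<close> and \<open>n \<cdot> n' = 0\<close>,
  \<open>a\<bar>n'\<bar>\<^sup>2 + a(n\<^sub>2\<^sup>2 + n\<^sub>3\<^sup>2) = a(\<phi>'\<^sup>2 + cos\<^sup>2 \<phi>) + a\<bar>n' + r(e\<^sub>2 - n\<^sub>2 n)\<bar>\<^sup>2 + a(1 + r\<^sup>2)(n\<^sub>2 - cos \<phi>)\<^sup>2 + a n\<^sub>3\<^sup>2 - 2(a r (n\<^sub>2 - cos \<phi>))'\<close>;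
  the boundary terms vanish at \<open>0\<close> and at infinity, so \<open>m\<close> is minimizing and every other minimizer has
  \<open>n\<^sub>2 = cos \<phi>\<close>, \<open>n\<^sub>3 = 0\<close>. If \<open>a\<close> is even, both half-profiles coincide and the flux \<open>a \<phi>'\<close> is continuous at
  \<open>0\<close>; if \<open>a\<close> is moreover non-decreasing, then \<open>\<phi>' \<ge> cos \<phi>\<close>. The integrand of the second variation is
  \<open>a(\<bar>v' + \<phi>' tan \<phi> v\<bar>\<^sup>2 - v\<^sub>1\<^sup>2)\<close> plus an exact derivative, and the component of \<open>v' + \<phi>' tan \<phi> v\<close> along
  \<open>m\<close> is \<open>- (\<phi>' / cos \<phi>) v\<^sub>1\<close>, so the integrand has non-negative integral.
\<close>

text \<open>Since \<open>a\<close> is only measurable, \<open>\<phi>'\<close> may jump wherever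
  \<open>a\<close> does and no differential equation holds at every point; derivatives are therefore
  handled as integral identities for absolutely continuous functions. The unknowns are chosen
  accordingly: \<open>q\<close> is the flux \<open>a \<phi>'\<close> divided by
  \<open>cos \<phi>\<close>, which does not see the jumps of \<open>a\<close>, and
  \<open>\<tau>\<close> unrolls the bounded angle to the whole line. For constant \<open>a\<close>
  the solution is \<open>\<tau> = x\<close>, \<open>q = a\<close>. The minimizer is thus
  constructed, not extracted from a minimizing sequence. Both completions of squares rest on
  Riccati-type equations: for \<open>a \<phi>' / sin \<phi>\<close> in the minimality argument, for
  \<open>a \<phi>' tan \<phi>\<close> in the stability argument. The first of these functions is
  singular at \<open>0\<close>, and the constraint \<open>n(0) = e\<^sub>2\<close> is what
  compensates the singularity: \<open>1 - n\<^sub>2\<close> is quadratic in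
  \<open>n - e\<^sub>2\<close>. Monotonicity of \<open>a\<close> enters only as
  \<open>q \<ge> a\<close>, which pays for the term \<open>- v\<^sub>1\<^sup>2\<close>.\<close>

lemma abs_integrable_subinterval:
  fixes g :: "real \<Rightarrow> 'a::euclidean_space"
  assumes "g absolutely_integrable_on {u..v}" "u \<le> x" "y \<le> v"
  shows "g absolutely_integrable_on {x..y}" "g integrable_on {x..y}"
proof -
  show *: "g absolutely_integrable_on {x..y}"
    by (rule absolutely_integrable_on_subinterval[OF assms(1)]) (use assms in auto)
  show "g integrable_on {x..y}" by (rule set_lebesgue_integral_eq_integral(1)[OF *])
qed

lemma abs_integrable_integral_diff:
  fixes g :: "real \<Rightarrow> 'a::euclidean_space"
  assumes "g absolutely_integrable_on {u..v}" "u \<le> x" "x \<le> y" "y \<le> v"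
  shows "integral {u..y} g - integral {u..x} g = integral {x..y} g"
proof -
  have "integral {u..x} g + integral {x..y} g = integral {u..y} g"
    by (rule Henstock_Kurzweil_Integration.integral_combine)
      (use assms in \<open>auto intro: abs_integrable_subinterval(2)[OF assms(1)]\<close>)
  then show ?thesis by (metis add_diff_cancel_left')
qed

subsection \<open>Primitives of integrable functions\<close>

text \<open>
  \<open>primitive_on u v f g\<close> says that \<open>f\<close> is absolutely continuous on \<open>[u, v]\<close> with derivative \<open>g\<close>.
\<close>

definition primitive_on :: "real \<Rightarrow> real \<Rightarrow> (real \<Rightarrow> 'a::euclidean_space) \<Rightarrow> (real \<Rightarrow> 'a) \<Rightarrow> bool" where
  "primitive_on u v f g \<longleftrightarrow> g absolutely_integrable_on {u..v} \<and>
     (\<forall>x y. u \<le> x \<longrightarrow> x \<le> y \<longrightarrow> y \<le> v \<longrightarrow> (g has_integral (f y - f x)) {x..y})"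

lemma primitive_onD:
  assumes "primitive_on u v f g" "u \<le> x" "x \<le> y" "y \<le> v"
  shows "(g has_integral (f y - f x)) {x..y}"
  using assms unfolding primitive_on_def by blast

lemma primitive_on_abs_integrable: "primitive_on u v f g \<Longrightarrow> g absolutely_integrable_on {u..v}"
  unfolding primitive_on_def by blast

lemma primitive_on_subset:
  assumes "primitive_on u v f g" "u \<le> u'" "v' \<le> v"
  shows "primitive_on u' v' f g"
  unfolding primitive_on_def
proof (intro conjI allI impI)
  show "g absolutely_integrable_on {u'..v'}"
    by (rule abs_integrable_subinterval(1)[OF primitive_on_abs_integrable[OF assms(1)] assms(2,3)])
next
  fix x y assume "u' \<le> x" "x \<le> y" "y \<le> v'"
  then show "(g has_integral f y - f x) {x..y}" using assms by (intro primitive_onD[OF assms(1)]) auto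
qed

text \<open>Conditions such as \<open>0 \<notin> {u..v}\<close> also hold for reversed endpoints;
  this case keeps later statements free of the assumption \<open>u \<le> v\<close>.\<close>

lemma primitive_on_empty:
  assumes "v \<le> u"
  shows "primitive_on u v f g"
  unfolding primitive_on_def
proof (intro conjI allI impI)
  show "g absolutely_integrable_on {u..v}"
    using assms by (intro absolutely_integrable_negligible) (cases "u = v", auto)
next
  fix x y assume "u \<le> x" "x \<le> y" "y \<le> v"
  then have "x = y" using assms by linarith
  then show "(g has_integral f y - f x) {x..y}" using has_integral_refl(2)[of g y] by simp
qed

text \<open>
  Replaces almost everywhere differentiability in the product and chain rules below: the defect of
  the rule is an interval function that is negligible against \<open>\<integral>\<bar>g\<bar>\<close> on short intervals.
\<close>

lemma interval_function_const:
  fixes E :: "real \<Rightarrow> 'a::real_normed_vector" and M :: "real \<Rightarrow> real"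
  assumes uv: "u \<le> v"
    and small: "\<And>e. e > 0 \<Longrightarrow> \<exists>d>0. \<forall>x y. u \<le> x \<longrightarrow> x \<le> y \<longrightarrow> y \<le> v \<longrightarrow> y - x < d \<longrightarrow>
                  norm (E y - E x) \<le> e * (M y - M x)"
  shows "E v = E u"
proof -
  have bound: "norm (E v - E u) \<le> e * (M v - M u)" if e: "e > 0" for e
  proof -
    obtain d where d: "d > 0"
      "\<And>x y. u \<le> x \<Longrightarrow> x \<le> y \<Longrightarrow> y \<le> v \<Longrightarrow> y - x < d \<Longrightarrow> norm (E y - E x) \<le> e * (M y - M x)"
      using small[OF e] by metis
    obtain N :: nat where N: "N > 0" "(v - u) / N < d"
    proof -
      obtain n :: nat where "(v - u) / d < n" using reals_Archimedean2 by blast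
      then have "v - u < d * real n" using d(1) by (simp add: field_simps)
      also have "\<dots> \<le> d * real (Suc n)" using d(1) by simp
      finally have "(v - u) / real (Suc n) < d" by (simp add: field_simps)
      then show thesis using that[of "Suc n"] by simp
    qed
    define s where "s i = u + real i * ((v - u) / N)" for i
    have sN: "s N = v" using N by (simp add: s_def)
    have step: "s (Suc i) - s i = (v - u) / N" for i by (simp add: s_def distrib_right add_divide_distrib)
    have h0: "(v - u) / N \<ge> 0" using uv by simp
    have smono: "s i \<le> s j" if "i \<le> j" for i j
      unfolding s_def using that h0 by (intro add_left_mono mult_right_mono) auto
    have "i \<le> N \<Longrightarrow> norm (E (s i) - E u) \<le> e * (M (s i) - M u)" for i
    proof (induction i)
      case 0 then show ?case by (simp add: s_def)
    next
      case (Suc i)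
      have "norm (E (s (Suc i)) - E (s i)) \<le> e * (M (s (Suc i)) - M (s i))"
      proof (rule d(2))
        show "u \<le> s i" using smono[of 0 i] by (simp add: s_def)
        show "s (Suc i) \<le> v" using smono[of "Suc i" N] Suc.prems sN by simp
        show "s (Suc i) - s i < d" using step N by simp
      qed (use smono in auto)
      moreover have "norm (E (s i) - E u) \<le> e * (M (s i) - M u)" using Suc by simp
      moreover have "norm (E (s (Suc i)) - E u) \<le> norm (E (s (Suc i)) - E (s i)) + norm (E (s i) - E u)"
        using norm_triangle_ineq[of "E (s (Suc i)) - E (s i)" "E (s i) - E u"] by simp
      ultimately show ?case by (simp add: algebra_simps)
    qed
    from this[of N] show ?thesis using sN by simp
  qed
  have "norm (E v - E u) \<le> 0"
  proof (rule field_le_epsilon)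
    fix e :: real assume "e > 0"
    \<comment> \<open>The summand \<open>1\<close> keeps \<open>c\<close> positive even if
      \<open>M u = M v\<close>, so that \<open>e / c\<close> is an admissible tolerance.\<close>
    define c where "c = \<bar>M v - M u\<bar> + 1"
    have c: "c > 0" unfolding c_def by simp
    have "norm (E v - E u) \<le> e / c * (M v - M u)" using bound[of "e/c"] \<open>e > 0\<close> c by simp
    also have "\<dots> \<le> e / c * c" unfolding c_def using \<open>e > 0\<close> by (intro mult_left_mono) auto
    finally show "norm (E v - E u) \<le> 0 + e" using c by simp
  qed
  then show ?thesis by simp
qed

lemma primitive_on_integral:
  assumes "primitive_on u v f g" "u \<le> x" "x \<le> y" "y \<le> v"
  shows "integral {x..y} g = f y - f x"
  using primitive_onD[OF assms] by (rule integral_unique)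

lemma primitive_on_continuous:
  assumes "primitive_on u v f g"
  shows "continuous_on {u..v} f"
proof (cases "u \<le> v")
  case True
  have "continuous_on {u..v} (\<lambda>x. integral {u..x} g)"
    using primitive_on_abs_integrable[OF assms] set_lebesgue_integral_eq_integral(1)
    by (intro indefinite_integral_continuous_1) blast
  then have "continuous_on {u..v} (\<lambda>x. f u + integral {u..x} g)" by (intro continuous_intros)
  then show ?thesis
    by (rule continuous_on_eq) (use assms True in \<open>auto simp: primitive_on_integral\<close>)
qed auto

lemma primitive_continuous:
  assumes "\<And>u v. primitive_on u v f g"
  shows "continuous_on A f"
proof (rule continuous_at_imp_continuous_on, rule ballI)
  fix x :: real
  have "continuous_on {x - 1..x + 1} f" by (rule primitive_on_continuous[OF assms])
  then show "isCont f x" by (rule continuous_on_interior) auto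
qed

lemma primitive_onI:
  assumes "g absolutely_integrable_on {u..v}"
    and "\<And>x. u \<le> x \<Longrightarrow> x \<le> v \<Longrightarrow> f x = c + integral {u..x} g"
  shows "primitive_on u v f g"
  unfolding primitive_on_def
proof (intro conjI allI impI)
  fix x y assume xy: "u \<le> x" "x \<le> y" "y \<le> v"
  have "g integrable_on {x..y}" using xy by (intro abs_integrable_subinterval(2)[OF assms(1)]) auto
  moreover have "integral {x..y} g = f y - f x"
    using assms(2)[of x] assms(2)[of y] xy abs_integrable_integral_diff[OF assms(1) xy] by simp
  ultimately show "(g has_integral f y - f x) {x..y}" by (simp add: has_integral_iff)
qed fact

lemma primitive_on_cong:
  assumes "primitive_on u v f g"
    and "\<And>x. u \<le> x \<Longrightarrow> x \<le> v \<Longrightarrow> f x = f' x"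
    and "AE x in lebesgue. u \<le> x \<and> x \<le> v \<longrightarrow> g x = g' x"
  shows "primitive_on u v f' g'"
proof -
  obtain N where N: "negligible N" "\<And>x. x \<notin> N \<Longrightarrow> u \<le> x \<and> x \<le> v \<longrightarrow> g x = g' x"
    using assms(3) unfolding eventually_ae_filter_negligible by auto
  show ?thesis
    unfolding primitive_on_def
  proof (intro conjI allI impI)
    show "g' absolutely_integrable_on {u..v}"
      using absolutely_integrable_spike[OF primitive_on_abs_integrable[OF assms(1)] N(1)] N(2) by force
  next
    fix x y assume xy: "u \<le> x" "x \<le> y" "y \<le> v"
    have "(g has_integral f' y - f' x) {x..y}"
      using primitive_onD[OF assms(1) xy] assms(2) xy by auto
    then show "(g' has_integral f' y - f' x) {x..y}"
      by (rule has_integral_spike[OF N(1), rotated]) (use N(2) xy in auto)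
  qed
qed

lemma primitive_on_linear:
  assumes "primitive_on u v f g" "bounded_linear T"
  shows "primitive_on u v (\<lambda>x. T (f x)) (\<lambda>x. T (g x))"
  unfolding primitive_on_def
proof (intro conjI allI impI)
  show "(\<lambda>x. T (g x)) absolutely_integrable_on {u..v}"
    using absolutely_integrable_linear[OF primitive_on_abs_integrable[OF assms(1)] assms(2)]
    by (simp add: o_def)
next
  fix x y assume xy: "u \<le> x" "x \<le> y" "y \<le> v"
  have "((T \<circ> g) has_integral T (f y - f x)) {x..y}"
    by (rule has_integral_linear[OF primitive_onD[OF assms(1) xy] assms(2)])
  then show "((\<lambda>x. T (g x)) has_integral T (f y) - T (f x)) {x..y}"
    using assms(2) by (simp add: o_def bounded_linear.linear linear_diff)
qed

lemma primitive_on_add: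
  assumes "primitive_on u v f g" "primitive_on u v f' g'"
  shows "primitive_on u v (\<lambda>x. f x + f' x) (\<lambda>x. g x + g' x)"
  unfolding primitive_on_def
proof (intro conjI allI impI)
  show "(\<lambda>x. g x + g' x) absolutely_integrable_on {u..v}"
    by (intro set_integral_add primitive_on_abs_integrable[OF assms(1)] primitive_on_abs_integrable[OF assms(2)])
next
  fix x y assume xy: "u \<le> x" "x \<le> y" "y \<le> v"
  show "((\<lambda>x. g x + g' x) has_integral f y + f' y - (f x + f' x)) {x..y}"
    using has_integral_add[OF primitive_onD[OF assms(1) xy] primitive_onD[OF assms(2) xy]]
    by (simp add: algebra_simps)
qed

lemma primitive_on_minus:
  "primitive_on u v f g \<Longrightarrow> primitive_on u v (\<lambda>x. - f x) (\<lambda>x. - g x)"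
  by (drule primitive_on_linear[of _ _ _ _ uminus]) (auto intro: bounded_linear_minus bounded_linear_ident)

lemma primitive_on_diff:
  assumes "primitive_on u v f g" "primitive_on u v f' g'"
  shows "primitive_on u v (\<lambda>x. f x - f' x) (\<lambda>x. g x - g' x)"
  using primitive_on_add[OF assms(1) primitive_on_minus[OF assms(2)]] by simp

lemma primitive_on_const: "primitive_on u v (\<lambda>x. c) (\<lambda>x. 0)"
  unfolding primitive_on_def by simp

lemma primitive_on_combine:
  assumes "primitive_on u w f g" "primitive_on w v f g" "u \<le> w" "w \<le> v"
  shows "primitive_on u v f g"
  unfolding primitive_on_def
proof (intro conjI allI impI)
  show "g absolutely_integrable_on {u..v}"
    by (rule absolutely_integrable_on_combine[OF primitive_on_abs_integrable[OF assms(1)]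
          primitive_on_abs_integrable[OF assms(2)] assms(3,4)])
next
  fix x y assume xy: "u \<le> x" "x \<le> y" "y \<le> v"
  consider "y \<le> w" | "w \<le> x" | "x \<le> w" "w \<le> y" by linarith
  then show "(g has_integral f y - f x) {x..y}"
  proof cases
    case 1 then show ?thesis using primitive_onD[OF assms(1)] xy by auto
  next
    case 2 then show ?thesis using primitive_onD[OF assms(2)] xy by auto
  next
    case 3
    have "(g has_integral (f w - f x) + (f y - f w)) {x..y}"
      by (rule has_integral_combine[OF 3])
        (use primitive_onD[OF assms(1)] primitive_onD[OF assms(2)] xy 3 assms in auto)
    then show ?thesis by simp
  qed
qed

lemma primitive_on_reflect:
  assumes "primitive_on u v f g"
  shows "primitive_on (-v) (-u) (\<lambda>x. f (- x)) (\<lambda>x. - g (- x))"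
  unfolding primitive_on_def
proof (intro conjI allI impI)
  have "(\<lambda>x. g (- x)) absolutely_integrable_on {-v..-u}"
    using primitive_on_abs_integrable[OF assms] by simp
  then show "(\<lambda>x. - g (- x)) absolutely_integrable_on {-v..-u}"
    using absolutely_integrable_linear[OF _ bounded_linear_minus[OF bounded_linear_ident], where f="\<lambda>x. g (-x)" and s="{-v..-u}"]
    by (simp add: o_def)
next
  fix x y assume xy: "- v \<le> x" "x \<le> y" "y \<le> - u"
  have "(g has_integral (f (-x) - f (-y))) {-y..-x}" by (rule primitive_onD[OF assms]) (use xy in auto)
  then have "((\<lambda>x. g (- x)) has_integral (f (-x) - f (-y))) {x..y}"
    using has_integral_reflect_real[where f=g and i="f (-x) - f (-y)" and b="-x" and a="-y"] by simp
  then show "((\<lambda>x. - g (- x)) has_integral f (- y) - f (- x)) {x..y}"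
    using has_integral_neg[of "\<lambda>x. g (- x)" "f (-x) - f (-y)" "{x..y}"] by simp
qed

text \<open>The difference of the two derivatives integrates to zero over every subinterval; by
  Lebesgue differentiation its averages over shrinking right neighbourhoods converge to its value at
  almost every point.\<close>

lemma primitive_on_unique_AE:
  assumes "primitive_on u v f g" "primitive_on u v f h"
  shows "AE x in lebesgue. u \<le> x \<and> x \<le> v \<longrightarrow> g x = h x"
proof -
  \<comment> \<open>Extension by zero gives a function integrable on every interval, as the
    differentiation theorem requires.\<close>
  define d where "d x = (if x \<in> {u..v} then g x - h x else 0)" for x
  have P: "primitive_on u v (\<lambda>x. 0::'a) (\<lambda>x. g x - h x)"
    using primitive_on_diff[OF assms] by simp
  have dint: "d integrable_on {a..b}" for a b
  proof -
    have "(\<lambda>x. g x - h x) integrable_on {u..v}"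
      using primitive_on_abs_integrable[OF P] set_lebesgue_integral_eq_integral(1) by blast
    then have "d integrable_on UNIV" unfolding d_def by (subst integrable_restrict_UNIV)
    then show ?thesis by (rule integrable_on_subinterval) auto
  qed
  obtain N where N: "negligible N" 
    "\<And>x e. \<lbrakk>x \<notin> N; 0 < e\<rbrakk> \<Longrightarrow> \<exists>\<delta>>0. \<forall>h. 0 < h \<and> h < \<delta> \<longrightarrow>
        norm (integral (cbox x (x + h *\<^sub>R One)) d /\<^sub>R h ^ DIM(real) - d x) < e"
    using integrable_ccontinuous_explicit[of d] dint by (auto simp: cbox_interval)
  have "d x = 0" if x: "x \<notin> N \<union> {u, v}" for x
  proof (cases "u < x \<and> x < v")
    case True
    have "norm (d x) \<le> 0"
    proof (rule field_le_epsilon)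
      fix e :: real assume "e > 0"
      then obtain \<delta> where \<delta>: "\<delta> > 0" "\<And>h. 0 < h \<Longrightarrow> h < \<delta> \<Longrightarrow> 
        norm (integral (cbox x (x + h *\<^sub>R One)) d /\<^sub>R h ^ DIM(real) - d x) < e" using N(2)[of x e] x by auto
      define r where "r = min (\<delta>/2) (v - x)"
      have r: "0 < r" "r < \<delta>" "x + r \<le> v" using True \<delta>(1) by (auto simp: r_def)
      have "integral {x..x+r} d = integral {x..x+r} (\<lambda>x. g x - h x)"
        by (rule Henstock_Kurzweil_Integration.integral_cong) (use True r in \<open>auto simp: d_def\<close>)
      also have "\<dots> = 0" using primitive_on_integral[OF P, of x "x+r"] True r by simp
      finally show "norm (d x) \<le> 0 + e" using \<delta>(2)[OF r(1,2)] by simp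
    qed
    then show ?thesis by simp
  next
    case False then show ?thesis using x by (auto simp: d_def)
  qed
  then have "\<forall>x. x \<notin> N \<union> {u,v} \<longrightarrow> u \<le> x \<and> x \<le> v \<longrightarrow> g x = h x"
    unfolding d_def by (metis atLeastAtMost_iff right_minus_eq)
  moreover have "negligible (N \<union> {u,v})" using N(1) by auto
  ultimately show ?thesis unfolding eventually_ae_filter_negligible by blast
qed

lemma continuous_on_Icc_modulus:
  fixes f :: "real \<Rightarrow> 'a::metric_space"
  assumes "continuous_on {u..v} f" "0 < e"
  shows "\<exists>d>0. \<forall>x y. x \<in> {u..v} \<longrightarrow> y \<in> {u..v} \<longrightarrow> dist y x < d \<longrightarrow> dist (f y) (f x) < e"
proof -
  have "uniformly_continuous_on {u..v} f" using assms(1) by (simp add: compact_uniformly_continuous)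
  then show ?thesis using assms(2) unfolding uniformly_continuous_on_def by meson
qed

lemma abs_integrable_bilinear:
  fixes prod :: "'a::euclidean_space \<Rightarrow> 'b::euclidean_space \<Rightarrow> 'c::euclidean_space"
  assumes "bounded_bilinear prod" "continuous_on {u..v::real} f" "g absolutely_integrable_on {u..v}"
  shows "(\<lambda>x. prod (f x) (g x)) absolutely_integrable_on {u..v}"
proof (rule absolutely_integrable_bounded_measurable_product[where h = prod and f = f and g = g])
  show "bilinear prod" using assms(1) by (simp add: bilinear_conv_bounded_bilinear)
  show "f \<in> borel_measurable (lebesgue_on {u..v})"
    by (rule continuous_imp_measurable_on_sets_lebesgue[OF assms(2)], simp)
  show "bounded (f ` {u..v})" by (rule compact_imp_bounded[OF compact_continuous_image[OF assms(2)]]) simp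
qed (use assms in auto)

text \<open>Freezing \<open>f\<close> at the left end and \<open>g\<close> at the right end makes
  the increment exact: on \<open>[x, y]\<close> it is the integral of
  \<open>prod (f x) (g' t) + prod (f' t) (g y)\<close>. By uniform continuity, unfreezing costs at
  most \<open>e (\<bar>g'\<bar> + \<bar>f'\<bar>)\<close>, so the defect of the rule is
  constant.\<close>

lemma primitive_on_bilinear:
  fixes prod :: "'a::euclidean_space \<Rightarrow> 'b::euclidean_space \<Rightarrow> 'c::euclidean_space"
  assumes bl: "bounded_bilinear prod" and f: "primitive_on u v f f'" and g: "primitive_on u v g g'"
  shows "primitive_on u v (\<lambda>x. prod (f x) (g x)) (\<lambda>x. prod (f x) (g' x) + prod (f' x) (g x))"
proof (cases "u \<le> v")
  case False then show ?thesis by (simp add: primitive_on_empty)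
next
  case uv: True
  interpret bounded_bilinear prod by fact
  define h where "h x = prod (f x) (g' x) + prod (f' x) (g x)" for x
  define n where "n x = norm (g' x) + norm (f' x)" for x
  have cf: "continuous_on {u..v} f" and cg: "continuous_on {u..v} g"
    using f g by (auto intro: primitive_on_continuous)
  have af: "f' absolutely_integrable_on {u..v}" and ag: "g' absolutely_integrable_on {u..v}"
    using f g by (auto intro: primitive_on_abs_integrable)
  have ah: "h absolutely_integrable_on {u..v}"
    unfolding h_def
    by (intro set_integral_add abs_integrable_bilinear[OF bl cf ag] abs_integrable_bilinear[OF flip cg af])
  have an: "n absolutely_integrable_on {u..v}"
    unfolding n_def by (intro set_integral_add absolutely_integrable_norm[unfolded o_def] af ag)
  note hi = abs_integrable_subinterval(2)[OF ah] and ni = abs_integrable_subinterval(2)[OF an]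
  note hcomb = abs_integrable_integral_diff[OF ah] abs_integrable_integral_diff[OF an]
  obtain K where K: "K > 0" "\<And>a b. norm (prod a b) \<le> norm a * norm b * K"
    using pos_bounded by blast
  have key: "prod (f w) (g w) - integral {u..w} h = prod (f u) (g u) - integral {u..u} h"
    if w: "u \<le> w" "w \<le> v" for w
  proof (rule interval_function_const[where E = "\<lambda>x. prod (f x) (g x) - integral {u..x} h" and M = "\<lambda>x. integral {u..x} n"])
    fix e :: real assume e: "e > 0"
    have eK: "e / K > 0" using e K(1) by simp
    obtain d1 where d1: "d1 > 0" "\<forall>x y. x \<in> {u..v} \<longrightarrow> y \<in> {u..v} \<longrightarrow> dist y x < d1 \<longrightarrow> dist (f y) (f x) < e / K"
      using continuous_on_Icc_modulus[OF cf eK] by (elim exE conjE) (rule that)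
    obtain d2 where d2: "d2 > 0" "\<forall>x y. x \<in> {u..v} \<longrightarrow> y \<in> {u..v} \<longrightarrow> dist y x < d2 \<longrightarrow> dist (g y) (g x) < e / K"
      using continuous_on_Icc_modulus[OF cg eK] by (elim exE conjE) (rule that)
    show "\<exists>d>0. \<forall>x y. u \<le> x \<longrightarrow> x \<le> y \<longrightarrow> y \<le> w \<longrightarrow> y - x < d \<longrightarrow>
          norm (prod (f y) (g y) - integral {u..y} h - (prod (f x) (g x) - integral {u..x} h))
            \<le> e * (integral {u..y} n - integral {u..x} n)"
    proof (intro exI[of _ "min d1 d2"] conjI allI impI)
      fix x y assume xy: "u \<le> x" "x \<le> y" "y \<le> w" "y - x < min d1 d2"
      have "((\<lambda>t. prod (f x) (g' t) + prod (f' t) (g y) - h t) has_integral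
             (prod (f x) (g y - g x) + prod (f y - f x) (g y) - integral {x..y} h)) {x..y}"
        using has_integral_linear[OF primitive_onD[OF g, of x y] bounded_linear_right, of "f x"]
          has_integral_linear[OF primitive_onD[OF f, of x y] bounded_linear_left, of "g y"] xy w hi[of x y]
        by (intro has_integral_diff has_integral_add integrable_integral) (auto simp: o_def)
      moreover have "prod (f x) (g y - g x) + prod (f y - f x) (g y) - integral {x..y} h 
        = prod (f y) (g y) - integral {u..y} h - (prod (f x) (g x) - integral {u..x} h)"
        using hcomb(1)[of x y] xy w by (simp add: diff_left diff_right algebra_simps)
      ultimately have hint: "((\<lambda>t. prod (f x) (g' t) + prod (f' t) (g y) - h t) has_integral
           (prod (f y) (g y) - integral {u..y} h - (prod (f x) (g x) - integral {u..x} h))) {x..y}" by simp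
      have "norm (integral {x..y} (\<lambda>t. prod (f x) (g' t) + prod (f' t) (g y) - h t))
          \<le> integral {x..y} (\<lambda>t. e * n t)"
      proof (rule integral_norm_bound_integral)
        fix t assume t: "t \<in> {x..y}"
        have tx: "t \<in> {u..v}" "x \<in> {u..v}" "y \<in> {u..v}" "dist x t < d1" "dist y t < d2"
          using t xy w by (auto simp: dist_real_def)
        have "norm (f x - f t) \<le> e / K"
          using d1(2)[rule_format, OF tx(1,2,4)] unfolding dist_norm by (rule less_imp_le)
        moreover have "norm (g y - g t) \<le> e / K"
          using d2(2)[rule_format, OF tx(1,3,5)] unfolding dist_norm by (rule less_imp_le)
        ultimately have "norm (f x - f t) * norm (g' t) * K \<le> e / K * norm (g' t) * K"
          "norm (f' t) * norm (g y - g t) * K \<le> norm (f' t) * (e / K) * K"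
          using K(1) by (intro mult_right_mono mult_left_mono; simp)+
        then have "norm (prod (f x - f t) (g' t)) \<le> e * norm (g' t)"
          "norm (prod (f' t) (g y - g t)) \<le> e * norm (f' t)"
          using K(1) K(2)[of "f x - f t" "g' t"] K(2)[of "f' t" "g y - g t"] by (simp_all add: mult.commute)
        then have "norm (prod (f x - f t) (g' t) + prod (f' t) (g y - g t)) \<le> e * n t"
          unfolding n_def distrib_left by (intro order_trans[OF norm_triangle_ineq]) linarith
        then show "norm (prod (f x) (g' t) + prod (f' t) (g y) - h t) \<le> e * n t"
          unfolding h_def by (simp add: diff_left diff_right algebra_simps)
      next
        show "(\<lambda>t. e * n t) integrable_on {x..y}"
          using ni[of x y] xy w by (intro integrable_on_mult_right) auto
      qed (use hint in blast)
      then show "norm (prod (f y) (g y) - integral {u..y} h - (prod (f x) (g x) - integral {u..x} h))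
            \<le> e * (integral {u..y} n - integral {u..x} n)"
        using hcomb(2)[of x y] xy w integral_unique[OF hint] by simp
    qed (use d1(1) d2(1) in auto)
  qed (use w in auto)
  have "primitive_on u v (\<lambda>x. prod (f x) (g x)) h"
  proof (rule primitive_onI[OF ah])
    fix x assume "u \<le> x" "x \<le> v"
    from key[OF this] show "prod (f x) (g x) = prod (f u) (g u) - integral {u..u} h + integral {u..x} h"
      by (simp add: diff_eq_eq)
  qed
  then show ?thesis unfolding h_def .
qed

text \<open>\<open>H'\<close> is frozen at a mean value point, after which the increment of
  \<open>H \<circ> f\<close> is a multiple of the increment of \<open>f\<close>; uniform continuity
  of \<open>H' \<circ> f\<close> controls the rest. Differentiability of \<open>H\<close> is asked
  only on the range of \<open>f\<close>, which later admits functions such as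
  \<open>1 / sinh\<close>.\<close>

lemma primitive_on_chain:
  fixes f f' H H' :: "real \<Rightarrow> real"
  assumes f: "primitive_on u v f f'"
    and H: "\<And>x. u \<le> x \<Longrightarrow> x \<le> v \<Longrightarrow> (H has_real_derivative H' (f x)) (at (f x))"
    and H': "continuous_on (f ` {u..v}) H'"
  shows "primitive_on u v (\<lambda>x. H (f x)) (\<lambda>x. H' (f x) * f' x)"
proof (cases "u \<le> v")
  case False then show ?thesis by (simp add: primitive_on_empty)
next
  case uv: True
  define h where "h x = H' (f x) * f' x" for x
  define n where "n x = \<bar>f' x\<bar>" for x
  have cf: "continuous_on {u..v} f" using f by (auto intro: primitive_on_continuous)
  have af: "f' absolutely_integrable_on {u..v}" using f by (auto intro: primitive_on_abs_integrable)
  have cH: "continuous_on {u..v} (\<lambda>x. H' (f x))"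
    using continuous_on_compose[OF cf H'] by (simp add: o_def)
  have ah: "h absolutely_integrable_on {u..v}"
    unfolding h_def by (rule abs_integrable_bilinear[OF bounded_bilinear_mult cH af])
  have an: "n absolutely_integrable_on {u..v}"
    unfolding n_def using set_integrable_abs[OF af] .
  note hi = abs_integrable_subinterval(2)[OF ah] and ni = abs_integrable_subinterval(2)[OF an]
  note hcomb = abs_integrable_integral_diff[OF ah] abs_integrable_integral_diff[OF an]
  have mvt: "\<exists>\<xi>\<in>{x..y}. H (f y) - H (f x) = H' (f \<xi>) * (f y - f x)" if "u \<le> x" "x \<le> y" "y \<le> v" for x y
  proof -
    \<comment> \<open>The image of an interval is connected, so a mean value point between
      \<open>f x\<close> and \<open>f y\<close> is attained by \<open>f\<close> inside
      \<open>[x, y]\<close>.\<close>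
    have sub: "closed_segment (f x) (f y) \<subseteq> f ` {x..y}"
    proof -
      have "connected (f ` {x..y})" 
        by (rule connected_continuous_image) (use cf that in \<open>auto intro: continuous_on_subset\<close>)
      moreover have "f x \<in> f ` {x..y}" "f y \<in> f ` {x..y}" using that by auto
      ultimately show ?thesis
        by (metis convex_contains_segment is_interval_connected_1 is_interval_convex_1)
    qed
    have D: "(H has_real_derivative H' z) (at z)" if "z \<in> closed_segment (f x) (f y)" for z
      using sub that H \<open>u \<le> x\<close> \<open>y \<le> v\<close> by fastforce
    have "\<exists>z\<in>closed_segment (f x) (f y). H (f y) - H (f x) = H' z * (f y - f x)"
    proof (cases "f x" "f y" rule: linorder_cases)
      case less
      obtain z where "f x < z" "z < f y" "H (f y) - H (f x) = (f y - f x) * H' z"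
        using MVT2[OF less, of H H'] D by (auto simp: closed_segment_eq_real_ivl)
      then show ?thesis by (intro bexI[of _ z]) (auto simp: closed_segment_eq_real_ivl mult.commute)
    next
      case greater
      obtain z where "f y < z" "z < f x" "H (f x) - H (f y) = (f x - f y) * H' z"
        using MVT2[OF greater, of H H'] D by (auto simp: closed_segment_eq_real_ivl)
      then show ?thesis by (intro bexI[of _ z]) (auto simp: closed_segment_eq_real_ivl algebra_simps)
    qed auto
    then show ?thesis using sub by blast
  qed
  have key: "H (f w) - integral {u..w} h = H (f u) - integral {u..u} h"
    if w: "u \<le> w" "w \<le> v" for w
  proof (rule interval_function_const[where E = "\<lambda>x. H (f x) - integral {u..x} h" and M = "\<lambda>x. integral {u..x} n"])
    fix e :: real assume e: "e > 0"
    obtain d where d: "d > 0" "\<forall>x y. x \<in> {u..v} \<longrightarrow> y \<in> {u..v} \<longrightarrow> dist y x < d \<longrightarrow> dist (H' (f y)) (H' (f x)) < e"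
      using continuous_on_Icc_modulus[OF cH e] by (elim exE conjE) (rule that)
    show "\<exists>d>0. \<forall>x y. u \<le> x \<longrightarrow> x \<le> y \<longrightarrow> y \<le> w \<longrightarrow> y - x < d \<longrightarrow>
          norm (H (f y) - integral {u..y} h - (H (f x) - integral {u..x} h))
            \<le> e * (integral {u..y} n - integral {u..x} n)"
    proof (intro exI[of _ d] conjI allI impI)
      fix x y assume xy: "u \<le> x" "x \<le> y" "y \<le> w" "y - x < d"
      obtain \<xi> where \<xi>: "\<xi> \<in> {x..y}" "H (f y) - H (f x) = H' (f \<xi>) * (f y - f x)"
        using mvt[of x y] xy w by auto
      have "((\<lambda>t. H' (f \<xi>) * f' t - h t) has_integral
             (H' (f \<xi>) * (f y - f x) - integral {x..y} h)) {x..y}"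
        using primitive_onD[OF f, of x y] xy w hi[of x y]
        by (intro has_integral_diff has_integral_mult_right integrable_integral) auto
      moreover have "H' (f \<xi>) * (f y - f x) - integral {x..y} h
         = H (f y) - integral {u..y} h - (H (f x) - integral {u..x} h)"
        using hcomb(1)[of x y] xy w \<xi>(2) by simp
      ultimately have hint: "((\<lambda>t. H' (f \<xi>) * f' t - h t) has_integral
           (H (f y) - integral {u..y} h - (H (f x) - integral {u..x} h))) {x..y}" by simp
      have "norm (integral {x..y} (\<lambda>t. H' (f \<xi>) * f' t - h t)) \<le> integral {x..y} (\<lambda>t. e * n t)"
      proof (rule integral_norm_bound_integral)
        fix t assume t: "t \<in> {x..y}"
        have "dist (H' (f \<xi>)) (H' (f t)) < e" by (rule d(2)[rule_format]) (use t \<xi>(1) xy w in \<open>auto simp: dist_real_def\<close>)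
        then have "\<bar>H' (f \<xi>) - H' (f t)\<bar> * \<bar>f' t\<bar> \<le> e * \<bar>f' t\<bar>"
          by (intro mult_right_mono) (auto simp: dist_real_def)
        then show "norm (H' (f \<xi>) * f' t - h t) \<le> e * n t"
          unfolding h_def n_def by (simp add: abs_mult[symmetric] algebra_simps)
      next
        show "(\<lambda>t. e * n t) integrable_on {x..y}"
          using ni[of x y] xy w by (intro integrable_on_mult_right) auto
      qed (use hint in blast)
      then show "norm (H (f y) - integral {u..y} h - (H (f x) - integral {u..x} h))
            \<le> e * (integral {u..y} n - integral {u..x} n)"
        using hcomb(2)[of x y] xy w integral_unique[OF hint] by simp
    qed (use d(1) in auto)
  qed (use w in auto)
  have "primitive_on u v (\<lambda>x. H (f x)) h"
  proof (rule primitive_onI[OF ah])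
    fix x assume "u \<le> x" "x \<le> v"
    from key[OF this] show "H (f x) = H (f u) - integral {u..u} h + integral {u..x} h"
      by (simp add: diff_eq_eq)
  qed
  then show ?thesis unfolding h_def .
qed

subsection \<open>Smooth cut-off functions\<close>

text \<open>A class closed under differentiation contains every iterated derivative of its members,
  which replaces formulas for the higher derivatives.\<close>

lemma deriv_iterate_differentiable:
  fixes f :: "real \<Rightarrow> real"
  assumes "f \<in> S" and S: "\<And>f. f \<in> S \<Longrightarrow> \<exists>f'\<in>S. \<forall>x. (f has_real_derivative f' x) (at x)"
  shows "(deriv ^^ n) f differentiable (at x)"
proof -
  have "(deriv ^^ n) f \<in> S"
  proof (induction n)
    case (Suc n)
    obtain f' where f': "f' \<in> S" "\<And>x. ((deriv ^^ n) f has_real_derivative f' x) (at x)"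
      using S[OF Suc.IH] by blast
    then have "deriv ((deriv ^^ n) f) = f'" by (intro ext DERIV_imp_deriv) auto
    then show ?case using f'(1) by simp
  qed (use assms in simp)
  then show ?thesis using S real_differentiable_def by blast
qed

text \<open>Starting from \<open>exp (-1/x)\<close>, this family is closed under differentiation.\<close>

definition flat :: "real poly \<Rightarrow> real \<Rightarrow> real" where
  "flat P x = (if x > 0 then poly P (1 / x) * exp (- (1 / x)) else 0)"

lemma poly_exp_tendsto_0: "((\<lambda>y. poly P y * exp (- y)) \<longlongrightarrow> (0::real)) at_top"
proof -
  have "((\<lambda>y. \<Sum>i\<le>degree P. coeff P i * (y ^ i / exp y)) \<longlongrightarrow> (\<Sum>i\<le>degree P. coeff P i * 0)) at_top"
    by (intro tendsto_sum tendsto_mult tendsto_const tendsto_power_div_exp_0)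
  moreover have "(\<lambda>y. \<Sum>i\<le>degree P. coeff P i * (y ^ i / exp y)) = (\<lambda>y. poly P y * exp (- y))"
    by (rule ext) (simp add: poly_altdef sum_distrib_right exp_minus divide_inverse mult.assoc)
  ultimately show ?thesis by simp
qed

lemma flat_tendsto_0: "(flat P \<longlongrightarrow> 0) (at_right 0)"
proof -
  have "((\<lambda>x. poly P (inverse x) * exp (- inverse x)) \<longlongrightarrow> 0) (at_right (0::real))"
    by (rule filterlim_compose[OF poly_exp_tendsto_0 filterlim_inverse_at_top_right])
  moreover have "eventually (\<lambda>x. poly P (inverse x) * exp (- inverse x) = flat P x) (at_right 0)"
    by (rule eventually_at_rightI[of 0 1]) (auto simp: flat_def inverse_eq_divide)
  ultimately show ?thesis by (rule Lim_transform_eventually)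
qed

text \<open>With \<open>y = 1/x\<close> one has \<open>dy/dx = - y\<^sup>2\<close>, so
  \<open>P(y) exp (- y)\<close> has derivative \<open>y\<^sup>2 (P - P')(y) exp (- y)\<close>; the
  polynomial \<open>[:0, 0, 1:]\<close> is this \<open>y\<^sup>2\<close>. At \<open>0\<close> both
  one-sided difference quotients tend to \<open>0\<close>.\<close>

lemma flat_has_derivative:
  "(flat P has_real_derivative flat ([:0, 0, 1:] * (P - pderiv P)) x) (at x)"
proof (cases x "0::real" rule: linorder_cases)
  case greater
  have D1: "((\<lambda>x. 1 / x) has_real_derivative - (1 / x\<^sup>2)) (at x)"
    using greater by (auto intro!: derivative_eq_intros simp: power2_eq_square)
  have "((\<lambda>x. poly P (1 / x) * exp (- (1 / x))) has_real_derivative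
     poly (pderiv P) (1 / x) * - (1 / x\<^sup>2) * exp (- (1 / x)) +
     exp (- (1 / x)) * - (- (1 / x\<^sup>2)) * poly P (1 / x)) (at x)"
    by (intro DERIV_mult DERIV_chain2[where f = "poly P", OF poly_DERIV D1]
        DERIV_chain2[where f = exp, OF DERIV_exp DERIV_minus[OF D1]])
  then have "((\<lambda>x. poly P (1 / x) * exp (- (1 / x))) has_real_derivative
     flat ([:0, 0, 1:] * (P - pderiv P)) x) (at x)"
  proof (rule DERIV_cong)
    have ring: "\<And>a b y E::real. a * - y * E + E * - (- y) * b = y * (b - a) * E" by (simp add: algebra_simps)
    show "poly (pderiv P) (1 / x) * - (1 / x\<^sup>2) * exp (- (1 / x)) +
     exp (- (1 / x)) * - (- (1 / x\<^sup>2)) * poly P (1 / x) = flat ([:0, 0, 1:] * (P - pderiv P)) x"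
      unfolding ring using greater by (simp add: flat_def power2_eq_square)
  qed
  note D = this
  have "eventually (\<lambda>y. y \<in> {0<..}) (nhds x)" using greater by (intro eventually_nhds_in_open) auto
  then have ev: "eventually (\<lambda>y. flat P y = poly P (1 / y) * exp (- (1 / y))) (nhds x)"
    by eventually_elim (simp add: flat_def)
  show ?thesis by (rule iffD2[OF DERIV_cong_ev[OF refl ev refl] D])
next
  case less
  have "((\<lambda>x. 0) has_real_derivative flat ([:0, 0, 1:] * (P - pderiv P)) x) (at x)"
    using less by (simp add: flat_def)
  note D = this
  have "eventually (\<lambda>y. y \<in> {..<0}) (nhds x)" using less by (intro eventually_nhds_in_open) auto
  then have ev: "eventually (\<lambda>y. flat P y = 0) (nhds x)"
    by eventually_elim (simp add: flat_def)
  show ?thesis by (rule iffD2[OF DERIV_cong_ev[OF refl ev refl] D])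
next
  case equal
  \<comment> \<open>Dividing by \<open>h\<close> multiplies the polynomial by its variable, so the
    quotient is again a function of the family.\<close>
  have "((\<lambda>h. (flat P (0 + h) - flat P 0) / h) \<longlongrightarrow> 0) (at_right 0)"
    using flat_tendsto_0[of "[:0,1:] * P"]
    by (rule Lim_transform_eventually) (rule eventually_at_rightI[of 0 1], auto simp: flat_def)
  moreover have "((\<lambda>h. (flat P (0 + h) - flat P 0) / h) \<longlongrightarrow> 0) (at_left 0)"
    by (rule Lim_transform_eventually[OF tendsto_const])
      (rule eventually_at_leftI[of "-1"], auto simp: flat_def)
  ultimately have "((\<lambda>h. (flat P (0 + h) - flat P 0) / h) \<longlongrightarrow> 0) (at 0)"
    by (simp add: filterlim_at_split)
  then show ?thesis using equal by (simp add: DERIV_def flat_def)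
qed

text \<open>Membership is a syntactic certificate of smoothness. The clauses are those used in
  building a cut-off: sums and products, reciprocals for normalisation, affine substitutions for
  scaling and translation.\<close>

inductive_set smooth :: "(real \<Rightarrow> real) set" where
  flat: "flat P \<in> smooth"
| const: "(\<lambda>x. c) \<in> smooth"
| add: "f \<in> smooth \<Longrightarrow> g \<in> smooth \<Longrightarrow> (\<lambda>x. f x + g x) \<in> smooth"
| mult: "f \<in> smooth \<Longrightarrow> g \<in> smooth \<Longrightarrow> (\<lambda>x. f x * g x) \<in> smooth"
| inverse: "f \<in> smooth \<Longrightarrow> (\<And>x. f x \<noteq> 0) \<Longrightarrow> (\<lambda>x. inverse (f x)) \<in> smooth"
| affine: "f \<in> smooth \<Longrightarrow> (\<lambda>x. f (c * x + d)) \<in> smooth"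

lemma smooth_derivative: "f \<in> smooth \<Longrightarrow> \<exists>f'\<in>smooth. \<forall>x. (f has_real_derivative f' x) (at x)"
proof (induction rule: smooth.induct)
  case (flat P) then show ?case using flat_has_derivative smooth.flat by blast
next
  case (const c) then show ?case using smooth.const[of 0] by (intro bexI[of _ "\<lambda>x. 0"]) auto
next
  case (add f g)
  then obtain f' g' where "f' \<in> smooth" "g' \<in> smooth"
    "\<And>x. (f has_real_derivative f' x) (at x)" "\<And>x. (g has_real_derivative g' x) (at x)" by blast
  then show ?case by (intro bexI[of _ "\<lambda>x. f' x + g' x"] allI DERIV_add smooth.add)
next
  case (mult f g)
  then obtain f' g' where "f' \<in> smooth" "g' \<in> smooth"
    "\<And>x. (f has_real_derivative f' x) (at x)" "\<And>x. (g has_real_derivative g' x) (at x)" by blast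
  then show ?case using mult
    by (intro bexI[of _ "\<lambda>x. f' x * g x + g' x * f x"] allI DERIV_mult smooth.add smooth.mult)
next
  case (inverse f)
  then obtain f' where f': "f' \<in> smooth" "\<And>x. (f has_real_derivative f' x) (at x)" by blast
  have "((\<lambda>x. inverse (f x)) has_real_derivative - 1 * (f' x * (inverse (f x) * inverse (f x)))) (at x)" for x
    using DERIV_inverse'[OF f'(2) inverse.hyps(2)] by (simp add: algebra_simps)
  then show ?case using f' inverse.hyps
    by (intro bexI[of _ "\<lambda>x. - 1 * (f' x * (inverse (f x) * inverse (f x)))"] allI smooth.mult smooth.const smooth.inverse)
next
  case (affine f c d)
  then obtain f' where f': "f' \<in> smooth" "\<And>x. (f has_real_derivative f' x) (at x)" by blast
  have "((\<lambda>x. f (c * x + d)) has_real_derivative f' (c * x + d) * c) (at x)" for x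
    by (rule DERIV_chain2[where f = f and g = "\<lambda>x. c * x + d", OF f'(2)]) (auto intro!: derivative_eq_intros)
  then show ?case using f'
    by (intro bexI[of _ "\<lambda>x. f' (c * x + d) * c"] allI smooth.mult smooth.const smooth.affine)
qed

lemma smooth_iterate_differentiable: "f \<in> smooth \<Longrightarrow> (deriv ^^ n) f differentiable (at x)"
  by (rule deriv_iterate_differentiable[where S = smooth]) (auto dest: smooth_derivative)

text \<open>The standard smooth transition from \<open>0\<close> to \<open>1\<close> on
  \<open>[0, 1]\<close>; \<open>flat 1\<close> is \<open>exp (- 1/x)\<close> on the positive axis.
  The forms \<open>inverse\<close> and \<open>- 1 * x + 1\<close> match the clauses of
  \<open>smooth\<close>.\<close>

definition smooth_step :: "real \<Rightarrow> real" where
  "smooth_step x = flat 1 x * inverse (flat 1 x + flat 1 (- 1 * x + 1))"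

lemma flat_1_pos: "flat 1 x > 0 \<longleftrightarrow> x > 0" "flat 1 x \<ge> 0"
  by (auto simp: flat_def)

lemma flat_1_denominator: "flat 1 x + flat 1 (- 1 * x + 1) > 0"
proof (cases "x > 0")
  case True then show ?thesis using flat_1_pos(1)[of x] flat_1_pos(2)[of "- 1 * x + 1"] by linarith
next
  case False then show ?thesis using flat_1_pos(1)[of "- 1 * x + 1"] flat_1_pos(2)[of x] by linarith
qed

lemma smooth_step_smooth: "smooth_step \<in> smooth"
proof -
  have "(\<lambda>x. flat 1 x + flat 1 (- 1 * x + 1)) \<in> smooth" by (intro smooth.intros)
  then have "(\<lambda>x. inverse (flat 1 x + flat 1 (- 1 * x + 1))) \<in> smooth"
    by (rule smooth.inverse) (use flat_1_denominator in \<open>metis less_irrefl\<close>)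
  then show ?thesis unfolding smooth_step_def[abs_def] by (intro smooth.intros(4) smooth.flat)
qed

lemma smooth_step_le_0: "x \<le> 0 \<Longrightarrow> smooth_step x = 0"
  by (simp add: smooth_step_def flat_def)

lemma smooth_step_ge_1: "x \<ge> 1 \<Longrightarrow> smooth_step x = 1"
  by (simp add: smooth_step_def flat_def)

text \<open>After clearing denominators only one product remains on each side, and
  \<open>flat 1\<close> is non-decreasing.\<close>

lemma smooth_step_mono:
  assumes "x \<le> y"
  shows "smooth_step x \<le> smooth_step y"
proof -
  have fm: "flat 1 a \<le> flat 1 b" if "a \<le> b" for a b
    using that by (auto simp: flat_def frac_le)
  have "flat 1 x * flat 1 (- 1 * y + 1) \<le> flat 1 y * flat 1 (- 1 * x + 1)"
    using assms by (intro mult_mono fm flat_1_pos(2)) auto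
  then have "flat 1 x / (flat 1 x + flat 1 (- 1 * x + 1)) \<le> flat 1 y / (flat 1 y + flat 1 (- 1 * y + 1))"
    by (simp only: pos_divide_le_eq[OF flat_1_denominator] pos_le_divide_eq[OF flat_1_denominator]
        times_divide_eq_left) (simp add: algebra_simps)
  then show ?thesis by (simp add: smooth_step_def divide_inverse)
qed

lemma smooth_step_bounds: "0 \<le> smooth_step x" "smooth_step x \<le> 1"
  using smooth_step_mono[of "min x 0" x] smooth_step_mono[of x "max x 1"]
    smooth_step_le_0[of "min x 0"] smooth_step_ge_1[of "max x 1"] by auto

text \<open>A smoothed indicator of \<open>[x, y]\<close> with ramps on \<open>[x, x + e]\<close>
  and \<open>[y, y + e]\<close>. Its derivative is a difference of two approximate point masses, at
  \<open>x\<close> and at \<open>y\<close>.\<close>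

definition plateau :: "real \<Rightarrow> real \<Rightarrow> real \<Rightarrow> real \<Rightarrow> real" where
  "plateau e x y t = smooth_step (1 / e * t + - (x / e)) + - 1 * smooth_step (1 / e * t + - (y / e))"

lemma plateau_test_function:
  assumes "e > 0" "x \<le> y"
  shows "test_function UNIV (plateau e x y)"
  unfolding test_function_def
proof (intro conjI allI)
  have "plateau e x y \<in> smooth" unfolding plateau_def[abs_def]
    by (intro smooth.add smooth.mult smooth.const smooth.affine smooth_step_smooth)
  then show "(deriv ^^ n) (plateau e x y) differentiable (at t)" for n t
    by (rule smooth_iterate_differentiable)
  have "{t. plateau e x y t \<noteq> 0} \<subseteq> {x..y+e}"
  proof
    fix t assume t: "t \<in> {t. plateau e x y t \<noteq> 0}"
    have "\<not> t < x"
    proof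
      assume "t < x"
      then have "1 / e * t + - (x / e) \<le> 0" "1 / e * t + - (y / e) \<le> 0"
        using assms by (auto simp: field_simps)
      then show False using t by (simp add: plateau_def smooth_step_le_0)
    qed
    moreover have "\<not> t > y + e"
    proof
      assume "t > y + e"
      then have "1 / e * t + - (x / e) \<ge> 1" "1 / e * t + - (y / e) \<ge> 1"
        using assms by (auto simp: field_simps)
      then show False using t by (simp add: plateau_def smooth_step_ge_1)
    qed
    ultimately show "t \<in> {x..y+e}" by auto
  qed
  then have "bounded {t. plateau e x y t \<noteq> 0}" using bounded_subset bounded_closed_interval by blast
  then show "compact (closure {t. plateau e x y t \<noteq> 0})" by simp
qed auto

lemma test_functionD:
  assumes "test_function U \<zeta>"
  shows "(\<zeta> has_real_derivative deriv \<zeta> x) (at x)" "continuous_on A (deriv \<zeta>)" "continuous_on A \<zeta>"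
proof -
  have d: "(deriv ^^ n) \<zeta> differentiable (at x)" for n x using assms unfolding test_function_def by blast
  show 1: "(\<zeta> has_real_derivative deriv \<zeta> x) (at x)" for x
    using d[of 0 x] by (simp add: DERIV_deriv_iff_real_differentiable)
  show "continuous_on A (deriv \<zeta>)"
    using d[of 1] by (auto intro!: continuous_at_imp_continuous_on differentiable_imp_continuous_within)
  show "continuous_on A \<zeta>"
    using d[of 0] by (auto intro!: continuous_at_imp_continuous_on differentiable_imp_continuous_within)
qed

lemma integral_lebesgue_support:
  fixes F :: "real \<Rightarrow> 'a::euclidean_space"
  assumes "\<And>t. t \<notin> S \<Longrightarrow> F t = 0" "F absolutely_integrable_on S"
  shows "integrable lebesgue F" "(LINT t|lebesgue. F t) = integral S F"
proof -
  have eq: "(\<lambda>t. indicator S t *\<^sub>R F t) = F" using assms(1) by (auto simp: indicator_def)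
  show "integrable lebesgue F" using assms(2) unfolding set_integrable_def eq .
  show "(LINT t|lebesgue. F t) = integral S F"
    using set_lebesgue_integral_eq_integral(2)[OF assms(2)] unfolding set_lebesgue_integral_def eq .
qed

subsection \<open>Weak derivatives and primitives\<close>

text \<open>The derivative of \<open>smooth_step\<close> is non-negative, has integral
  \<open>1\<close> and lives on \<open>[0, 1]\<close>; rescaled by \<open>Suc n\<close> it becomes
  an approximate point mass on \<open>[z, z + 1/(n+1)]\<close>, one-sided but sufficient for
  continuous \<open>f\<close>.\<close>

lemma mollified_value_tendsto:
  fixes f :: "real \<Rightarrow> 'a::euclidean_space" and z :: real
  assumes S: "\<And>x. (smooth_step has_real_derivative \<rho> x) (at x)" and \<rho>: "continuous_on UNIV \<rho>"
    and f: "continuous_on UNIV f"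
  defines "r \<equiv> \<lambda>n t. real (Suc n) * \<rho> (real (Suc n) * t + - (real (Suc n) * z))"
  shows "integrable lebesgue (\<lambda>t. r n t *\<^sub>R f t)"
    and "(\<lambda>n. LINT t|lebesgue. r n t *\<^sub>R f t) \<longlonglongrightarrow> f z"
proof -
  have \<rho>0: "\<rho> t = 0" if "t < 0 \<or> t > 1" for t
  proof -
    obtain c where c: "eventually (\<lambda>x. smooth_step x = c) (nhds t)"
    proof (cases "t < 0")
      case True
      then have "eventually (\<lambda>x. x \<in> {..<0}) (nhds t)" by (intro eventually_nhds_in_open) auto
      then have "eventually (\<lambda>x. smooth_step x = 0) (nhds t)"
        by eventually_elim (simp add: smooth_step_le_0)
      then show thesis by (rule that)
    next
      case False
      then have "eventually (\<lambda>x. x \<in> {1<..}) (nhds t)" using \<open>t < 0 \<or> t > 1\<close> by (intro eventually_nhds_in_open) auto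
      then have "eventually (\<lambda>x. smooth_step x = 1) (nhds t)"
        by eventually_elim (simp add: smooth_step_ge_1)
      then show thesis by (rule that)
    qed
    have "(smooth_step has_real_derivative 0) (at t)"
      using DERIV_cong_ev[OF refl c refl, of 0] by simp
    then show ?thesis using DERIV_unique[OF S] by blast
  qed
  have \<rho>nonneg: "\<rho> t \<ge> 0" for t
    by (rule mono_on_imp_deriv_nonneg[where A = UNIV, OF _ S]) (auto intro!: mono_onI smooth_step_mono)
  define I where "I n = {z..z + 1 / real (Suc n)}" for n
  have r0: "r n t = 0" if "t \<notin> I n" for n t
  proof -
    have eq: "real (Suc n) * t + - (real (Suc n) * z) = real (Suc n) * (t - z)" by (simp add: right_diff_distrib)
    have "real (Suc n) * (t - z) < 0 \<or> real (Suc n) * (t - z) > 1"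
    proof (cases "t < z")
      case True then show ?thesis by (simp add: mult_pos_neg)
    next
      case False
      then have "t - z > 1 / real (Suc n)" using that unfolding I_def by auto
      then have "(t - z) * real (Suc n) > 1" by (subst (asm) divide_less_eq) simp
      then have "real (Suc n) * (t - z) > 1" by (simp only: mult.commute)
      then show ?thesis by blast
    qed
    then show ?thesis unfolding r_def eq using \<rho>0 by simp
  qed
  have rc: "continuous_on A (r n)" for A n
    unfolding r_def using continuous_on_subset[OF \<rho>]
    by (intro continuous_intros continuous_on_compose2[OF \<rho>]) auto
  have fc: "continuous_on A f" for A using f continuous_on_subset by blast
  have ri: "(r n has_integral 1) (I n)" for n
  proof -
    have "(r n has_integral (smooth_step (real (Suc n) * (z + 1 / real (Suc n)) + - (real (Suc n) * z)) 
        - smooth_step (real (Suc n) * z + - (real (Suc n) * z)))) (I n)"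
      unfolding I_def
    proof (rule fundamental_theorem_of_calculus)
      fix t
      have "((\<lambda>t. smooth_step (real (Suc n) * t + - (real (Suc n) * z))) has_real_derivative
        \<rho> (real (Suc n) * t + - (real (Suc n) * z)) * real (Suc n)) (at t)"
        by (rule DERIV_chain2[where f = smooth_step, OF S]) (auto intro!: derivative_eq_intros)
      then show "((\<lambda>t. smooth_step (real (Suc n) * t + - (real (Suc n) * z))) has_vector_derivative r n t)
         (at t within {z..z + 1 / real (Suc n)})"
        unfolding r_def has_real_derivative_iff_has_vector_derivative
        by (simp only: mult.commute has_vector_derivative_at_within)
    qed simp
    moreover have "real (Suc n) * (z + 1 / real (Suc n)) + - (real (Suc n) * z) = 1"
      by (simp add: distrib_left del: of_nat_Suc)
    ultimately show ?thesis using smooth_step_le_0[of 0] smooth_step_ge_1[of 1] by simp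
  qed
  have ai: "(\<lambda>t. r n t *\<^sub>R f t) absolutely_integrable_on I n" for n
    unfolding I_def by (intro absolutely_integrable_continuous_real continuous_intros rc fc)
  show "integrable lebesgue (\<lambda>t. r n t *\<^sub>R f t)" for n
    by (rule integral_lebesgue_support(1)[OF _ ai]) (simp add: r0)
  have eq: "(LINT t|lebesgue. r n t *\<^sub>R f t) = integral (I n) (\<lambda>t. r n t *\<^sub>R f t)" for n
    by (rule integral_lebesgue_support(2)[OF _ ai]) (simp add: r0)
  show "(\<lambda>n. LINT t|lebesgue. r n t *\<^sub>R f t) \<longlonglongrightarrow> f z"
  proof (rule metric_LIMSEQ_I)
    fix e :: real assume e: "e > 0"
    have "isCont f z" using f by (simp add: continuous_on_eq_continuous_at)
    then obtain d where d: "d > 0" "\<forall>t. dist t z < d \<longrightarrow> dist (f t) (f z) < e / 2"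
      using e unfolding continuous_at_eps_delta by (meson half_gt_zero)
    obtain N where N: "1 / real (Suc N) < d" using d(1) nat_approx_posE by blast
    show "\<exists>N. \<forall>n\<ge>N. dist (LINT t|lebesgue. r n t *\<^sub>R f t) (f z) < e"
    proof (intro exI[of _ N] allI impI)
      fix n assume "N \<le> n"
      then have "1 / real (Suc n) \<le> 1 / real (Suc N)" by (intro divide_left_mono) auto
      then have n: "1 / real (Suc n) < d" using N by linarith
      have h1: "((\<lambda>t. r n t *\<^sub>R f t) has_integral integral (I n) (\<lambda>t. r n t *\<^sub>R f t)) (I n)"
        by (rule integrable_integral[OF set_lebesgue_integral_eq_integral(1)[OF ai]])
      have h2: "((\<lambda>t. r n t *\<^sub>R f z) has_integral f z) (I n)"
        using has_integral_linear[OF ri bounded_linear_scaleR_left] by (simp add: o_def)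
      have h3: "((\<lambda>t. r n t *\<^sub>R (f t - f z)) has_integral (integral (I n) (\<lambda>t. r n t *\<^sub>R f t) - f z)) (I n)"
        using has_integral_diff[OF h1 h2] by (simp add: scaleR_diff_right)
      have "norm (integral (I n) (\<lambda>t. r n t *\<^sub>R (f t - f z))) \<le> integral (I n) (\<lambda>t. r n t * (e / 2))"
      proof (rule integral_norm_bound_integral)
        show "(\<lambda>t. r n t * (e / 2)) integrable_on I n"
          by (rule has_integral_integrable[OF has_integral_mult_left[OF ri]])
        fix t assume t: "t \<in> I n"
        then have "dist t z < d" using n by (auto simp: I_def dist_real_def)
        then have "norm (f t - f z) \<le> e / 2" using d(2) by (simp add: dist_norm less_imp_le)
        moreover have "r n t \<ge> 0" unfolding r_def using \<rho>nonneg by simp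
        ultimately show "norm (r n t *\<^sub>R (f t - f z)) \<le> r n t * (e / 2)"
          by (simp only: norm_scaleR real_norm_def abs_of_nonneg mult_left_mono)
      qed (use h3 in blast)
      also have "\<dots> = e / 2" using integral_unique[OF has_integral_mult_left[OF ri[of n], of "e/2"]] by simp
      finally show "dist (LINT t|lebesgue. r n t *\<^sub>R f t) (f z) < e"
        using integral_unique[OF h3] e by (simp add: dist_norm eq)
    qed
  qed
qed

text \<open>The defining identity is tested with plateaus whose ramps shrink: their derivatives
  produce \<open>f x - f y\<close> in the limit, while the plateaus themselves converge to the
  indicator of \<open>[x, y]\<close> under a common integrable bound.\<close>

lemma has_weak_deriv_primitive:
  fixes f g :: "real \<Rightarrow> 'a::euclidean_space"
  assumes w: "has_weak_deriv UNIV f g" and c: "continuous_on UNIV f"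
  shows "primitive_on u v f g"
proof -
  have gi: "g absolutely_integrable_on {x..y}" for x y
    using w unfolding has_weak_deriv_def locally_integrable_on_def by simp
  have test: "(LINT t|lebesgue. deriv \<zeta> t *\<^sub>R f t) = - (LINT t|lebesgue. \<zeta> t *\<^sub>R g t)"
    if "test_function UNIV \<zeta>" for \<zeta> using w that unfolding has_weak_deriv_def by blast
  obtain \<rho> where \<rho>: "\<rho> \<in> smooth" "\<And>x. (smooth_step has_real_derivative \<rho> x) (at x)"
    using smooth_derivative[OF smooth_step_smooth] by blast
  have \<rho>c: "continuous_on UNIV \<rho>"
    using smooth_derivative[OF \<rho>(1)] DERIV_isCont continuous_at_imp_continuous_on by blast
  have main: "(g has_integral f y - f x) {x..y}" if xy: "x < y" for x y
  proof -
    define r where "r z n t = real (Suc n) * \<rho> (real (Suc n) * t + - (real (Suc n) * z))" for z n t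
    define \<zeta> where "\<zeta> n = plateau (1 / real (Suc n)) x y" for n
    have \<zeta>eq: "\<zeta> n t = smooth_step (real (Suc n) * t + - (real (Suc n) * x)) +
        - 1 * smooth_step (real (Suc n) * t + - (real (Suc n) * y))" for n t
      by (simp add: \<zeta>_def plateau_def mult.commute)
    have D: "((\<lambda>t. smooth_step (real (Suc n) * t + - (real (Suc n) * z))) has_real_derivative r z n t) (at t)" for n z t
    proof -
      have "((\<lambda>t. smooth_step (real (Suc n) * t + - (real (Suc n) * z))) has_real_derivative
        \<rho> (real (Suc n) * t + - (real (Suc n) * z)) * real (Suc n)) (at t)"
        by (rule DERIV_chain2[where f = smooth_step, OF \<rho>(2)]) (auto intro!: derivative_eq_intros)
      then show ?thesis unfolding r_def by (simp only: mult.commute)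
    qed
    have d\<zeta>: "deriv (\<zeta> n) t = r x n t - r y n t" for n t
    proof (rule DERIV_imp_deriv)
      have "(\<zeta> n has_real_derivative r x n t + - 1 * r y n t) (at t)"
        unfolding \<zeta>eq by (intro DERIV_add DERIV_cmult D)
      then show "(\<zeta> n has_real_derivative r x n t - r y n t) (at t)" by simp
    qed
    have int: "integrable lebesgue (\<lambda>t. r z n t *\<^sub>R f t)"
      and lim: "(\<lambda>n. LINT t|lebesgue. r z n t *\<^sub>R f t) \<longlonglongrightarrow> f z" for z n
      unfolding r_def by (rule mollified_value_tendsto[OF \<rho>(2) \<rho>c c])+
    have "(LINT t|lebesgue. deriv (\<zeta> n) t *\<^sub>R f t) =
        (LINT t|lebesgue. r x n t *\<^sub>R f t) - (LINT t|lebesgue. r y n t *\<^sub>R f t)" for n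
      unfolding d\<zeta> scaleR_diff_left by (rule Bochner_Integration.integral_diff[OF int int])
    then have L: "(\<lambda>n. LINT t|lebesgue. deriv (\<zeta> n) t *\<^sub>R f t) \<longlonglongrightarrow> f x - f y"
      using tendsto_diff[OF lim lim] by simp
    have z1: "test_function UNIV (\<zeta> n)" for n
      unfolding \<zeta>_def by (rule plateau_test_function) (use xy in auto)
    have gm: "(\<lambda>t. indicator {x..y+1} t *\<^sub>R g t) \<in> borel_measurable lebesgue"
      using gi[of x "y+1"] unfolding set_integrable_def by (rule borel_measurable_integrable)
    have \<zeta>0: "\<zeta> n t = 0" if "t \<notin> {x..y+1}" for n t
    proof (cases "t < x")
      case True
      then have "real (Suc n) * t + - (real (Suc n) * x) \<le> 0" "real (Suc n) * t + - (real (Suc n) * y) \<le> 0"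
        using xy by simp_all
      then show ?thesis unfolding \<zeta>eq by (simp only: smooth_step_le_0)
    next
      case False
      then have t: "t > y + 1" using that by auto
      have "real (Suc n) * (t - x) \<ge> 1 * 1" "real (Suc n) * (t - y) \<ge> 1 * 1"
        using t xy by (intro mult_mono; simp)+
      then have "real (Suc n) * t + - (real (Suc n) * x) \<ge> 1" "real (Suc n) * t + - (real (Suc n) * y) \<ge> 1"
        by (simp_all add: right_diff_distrib)
      then show ?thesis unfolding \<zeta>eq by (simp only: smooth_step_ge_1)
    qed
    have \<zeta>g: "\<zeta> n t *\<^sub>R g t = \<zeta> n t *\<^sub>R (indicator {x..y+1} t *\<^sub>R g t)" for n t
      using \<zeta>0[of t n] by (cases "t \<in> {x..y+1}") simp_all
    have \<zeta>b: "\<bar>\<zeta> n t\<bar> \<le> 1" for n t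
      unfolding \<zeta>eq using smooth_step_bounds[of "real (Suc n) * t + - (real (Suc n) * x)"]
        smooth_step_bounds[of "real (Suc n) * t + - (real (Suc n) * y)"] by linarith
    have \<zeta>m: "\<zeta> n \<in> borel_measurable lebesgue" for n
    proof -
      have "\<zeta> n \<in> borel_measurable lborel"
        using borel_measurable_continuous_onI[OF test_functionD(3)[OF z1[of n], of UNIV]] by simp
      then show ?thesis by (rule measurable_completion)
    qed
    \<comment> \<open>At \<open>t = x\<close> every \<open>\<zeta> n\<close> vanishes although the
      indicator is \<open>1\<close>; this single point is negligible.\<close>
    have \<zeta>lim: "(\<lambda>n. \<zeta> n t) \<longlonglongrightarrow> indicator {x..y} t" if "t \<noteq> x" for t
    proof -
      have one: "eventually (\<lambda>n. smooth_step (real (Suc n) * t + - (real (Suc n) * z)) = 1) sequentially" if "z < t" for z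
      proof -
        obtain N where N: "1 / real (Suc N) < t - z" using \<open>z < t\<close> nat_approx_posE[of "t - z"] by auto
        show ?thesis
        proof (rule eventually_sequentiallyI[of N])
          fix n assume "N \<le> n"
          have "1 < (t - z) * real (Suc N)" using N by (subst (asm) divide_less_eq) simp
          also have "\<dots> \<le> (t - z) * real (Suc n)" using \<open>N \<le> n\<close> \<open>z < t\<close> by (intro mult_left_mono) auto
          finally have "1 \<le> real (Suc n) * t + - (real (Suc n) * z)"
            by (simp add: algebra_simps)
          then show "smooth_step (real (Suc n) * t + - (real (Suc n) * z)) = 1" by (rule smooth_step_ge_1)
        qed
      qed
      have zero: "smooth_step (real (Suc n) * t + - (real (Suc n) * z)) = 0" if "t \<le> z" for z n
      proof (rule smooth_step_le_0)
        have "real (Suc n) * t \<le> real (Suc n) * z" using that by (intro mult_left_mono) auto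
        then show "real (Suc n) * t + - (real (Suc n) * z) \<le> 0" by linarith
      qed
      consider "t < x" | "x < t" "t \<le> y" | "y < t" using \<open>t \<noteq> x\<close> by linarith
      then show ?thesis
      proof cases
        case 1 then show ?thesis using xy by (simp add: \<zeta>0)
      next
        case 2
        have "eventually (\<lambda>n. \<zeta> n t = indicator {x..y} t) sequentially"
          using one[OF 2(1)] by eventually_elim (use 2 zero[of y] in \<open>simp add: \<zeta>eq\<close>)
        then show ?thesis by (rule tendsto_eventually)
      next
        case 3
        have "eventually (\<lambda>n. \<zeta> n t = indicator {x..y} t) sequentially"
          using one[OF 3] one[OF less_trans[OF xy 3]] by eventually_elim (use 3 in \<open>simp add: \<zeta>eq\<close>)
        then show ?thesis by (rule tendsto_eventually)
      qed
    qed
    have "(\<lambda>n. LINT t|lebesgue. \<zeta> n t *\<^sub>R g t) \<longlonglongrightarrow> (LINT t|lebesgue. indicator {x..y} t *\<^sub>R g t)"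
    proof (rule integral_dominated_convergence[where w = "\<lambda>t. norm (indicator {x..y+1} t *\<^sub>R g t)"])
      show "(\<lambda>t. indicator {x..y} t *\<^sub>R g t) \<in> borel_measurable lebesgue"
        using gi[of x y] unfolding set_integrable_def by (rule borel_measurable_integrable)
      show "(\<lambda>t. \<zeta> n t *\<^sub>R g t) \<in> borel_measurable lebesgue" for n
        unfolding \<zeta>g by (intro borel_measurable_scaleR \<zeta>m gm)
      show "integrable lebesgue (\<lambda>t. norm (indicator {x..y+1} t *\<^sub>R g t))"
        using gi[of x "y+1"] unfolding set_integrable_def by (rule integrable_norm)
      show "AE t in lebesgue. (\<lambda>n. \<zeta> n t *\<^sub>R g t) \<longlonglongrightarrow> indicator {x..y} t *\<^sub>R g t"
        unfolding eventually_ae_filter_negligible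
        by (intro exI[of _ "{x}"] conjI subsetI) (auto intro!: tendsto_scaleR \<zeta>lim tendsto_const)
      show "AE t in lebesgue. norm (\<zeta> n t *\<^sub>R g t) \<le> norm (indicator {x..y+1} t *\<^sub>R g t)" for n
      proof (rule AE_I2)
        fix t show "norm (\<zeta> n t *\<^sub>R g t) \<le> norm (indicator {x..y+1} t *\<^sub>R g t)"
          using mult_right_mono[OF \<zeta>b[of n t] norm_ge_zero[of "indicator {x..y+1} t *\<^sub>R g t"]]
          unfolding \<zeta>g norm_scaleR[of "\<zeta> n t"] mult_1 .
      qed
    qed
    then have "(\<lambda>n. LINT t|lebesgue. deriv (\<zeta> n) t *\<^sub>R f t) \<longlonglongrightarrow> - (LINT t|lebesgue. indicator {x..y} t *\<^sub>R g t)"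
      unfolding test[OF z1] by (rule tendsto_minus)
    from LIMSEQ_unique[OF L this] have "f y - f x = (LINT t:{x..y}|lebesgue. g t)"
      unfolding set_lebesgue_integral_def by (simp add: algebra_simps eq_neg_iff_add_eq_0)
    then show ?thesis using has_integral_set_lebesgue[OF gi[of x y]] by simp
  qed
  show ?thesis unfolding primitive_on_def
  proof (intro conjI allI impI)
    fix x y :: real assume "x \<le> y"
    then show "(g has_integral f y - f x) {x..y}"
      using main[of x y] has_integral_refl(2)[of g x] by (cases "x = y") auto
  qed (rule gi)
qed

lemma primitive_on_C1:
  assumes "\<And>x. x \<in> {u..v} \<Longrightarrow> (f has_vector_derivative f' x) (at x within {u..v})" "continuous_on {u..v} f'"
  shows "primitive_on u v f f'"
  unfolding primitive_on_def
proof (intro conjI allI impI)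
  show "f' absolutely_integrable_on {u..v}" by (rule absolutely_integrable_continuous_real[OF assms(2)])
  fix x y assume "u \<le> x" "x \<le> y" "y \<le> v"
  then show "(f' has_integral f y - f x) {x..y}"
    by (intro fundamental_theorem_of_calculus) (auto intro: has_vector_derivative_within_subset[OF assms(1)])
qed

text \<open>Open intervals are used because two of them with a common endpoint stay disjoint, which
  lets the integrals over the pieces be added.\<close>

lemma Ioo_by_parts:
  fixes f g :: "real \<Rightarrow> 'a::euclidean_space"
  assumes p: "primitive_on u v f g" and \<zeta>: "test_function U \<zeta>" and 0: "u \<le> v \<Longrightarrow> \<zeta> u = 0 \<and> \<zeta> v = 0"
  shows "(\<lambda>x. deriv \<zeta> x *\<^sub>R f x) absolutely_integrable_on {u<..<v}"
    "(\<lambda>x. \<zeta> x *\<^sub>R g x) absolutely_integrable_on {u<..<v}"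
    "integral {u<..<v} (\<lambda>x. deriv \<zeta> x *\<^sub>R f x) = - integral {u<..<v} (\<lambda>x. \<zeta> x *\<^sub>R g x)"
proof -
  have z: "primitive_on u v \<zeta> (deriv \<zeta>)"
    by (rule primitive_on_C1) (auto intro!: test_functionD[OF \<zeta>] has_field_derivative_at_within
        simp flip: has_real_derivative_iff_has_vector_derivative)
  have a1: "(\<lambda>x. deriv \<zeta> x *\<^sub>R f x) absolutely_integrable_on {u..v}"
    by (intro absolutely_integrable_continuous_real continuous_intros test_functionD[OF \<zeta>] primitive_on_continuous[OF p])
  have a2: "(\<lambda>x. \<zeta> x *\<^sub>R g x) absolutely_integrable_on {u..v}"
    by (rule abs_integrable_bilinear[OF bounded_bilinear_scaleR test_functionD(3)[OF \<zeta>] primitive_on_abs_integrable[OF p]])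
  show "(\<lambda>x. deriv \<zeta> x *\<^sub>R f x) absolutely_integrable_on {u<..<v}" 
    "(\<lambda>x. \<zeta> x *\<^sub>R g x) absolutely_integrable_on {u<..<v}"
    using a1 a2 by (simp_all add: absolutely_integrable_on_Icc_iff_Ioo)
  show "integral {u<..<v} (\<lambda>x. deriv \<zeta> x *\<^sub>R f x) = - integral {u<..<v} (\<lambda>x. \<zeta> x *\<^sub>R g x)"
  proof (cases "u \<le> v")
    case True
    have "integral {u..v} (\<lambda>x. \<zeta> x *\<^sub>R g x + deriv \<zeta> x *\<^sub>R f x) = 0"
      using primitive_on_integral[OF primitive_on_bilinear[OF bounded_bilinear_scaleR z p], of u v] True 0 by simp
    then have "integral {u..v} (\<lambda>x. \<zeta> x *\<^sub>R g x) + integral {u..v} (\<lambda>x. deriv \<zeta> x *\<^sub>R f x) = 0"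
      using Henstock_Kurzweil_Integration.integral_add[OF set_lebesgue_integral_eq_integral(1)[OF a2] set_lebesgue_integral_eq_integral(1)[OF a1]] by simp
    then show ?thesis by (simp add: integral_open_interval_real eq_neg_iff_add_eq_0 add.commute)
  qed auto
qed

text \<open>Two intervals are what a compact subset of the punctured line takes, one on each side of
  the puncture; the values of \<open>f\<close> on the two pieces are unrelated, so \<open>f\<close>
  may jump across the gap. Integration by parts leaves no boundary contribution, since the test
  function vanishes at the endpoints.\<close>

lemma has_weak_derivI:
  fixes f g :: "real \<Rightarrow> 'a::euclidean_space"
  assumes loc: "\<And>K. compact K \<Longrightarrow> K \<subseteq> U \<Longrightarrow>
     \<exists>u1 v1 u2 v2. K \<subseteq> {u1<..<v1} \<union> {u2<..<v2} \<and> v1 \<le> u2 \<and> primitive_on u1 v1 f g \<and> primitive_on u2 v2 f g"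
  shows "has_weak_deriv U f g"
  unfolding has_weak_deriv_def locally_integrable_on_def
proof (intro conjI allI impI)
  have both: "f absolutely_integrable_on K \<and> g absolutely_integrable_on K" if K: "compact K \<and> K \<subseteq> U" for K
  proof -
    obtain u1 v1 u2 v2 where o: "K \<subseteq> {u1<..<v1} \<union> {u2<..<v2}"
      "primitive_on u1 v1 f g" "primitive_on u2 v2 f g" using loc K by metis
    note i = absolutely_integrable_continuous_real[OF primitive_on_continuous[OF o(2)]]
      absolutely_integrable_continuous_real[OF primitive_on_continuous[OF o(3)]]
      primitive_on_abs_integrable[OF o(2)] primitive_on_abs_integrable[OF o(3)]
    have "f absolutely_integrable_on {u1..v1} \<union> {u2..v2}" "g absolutely_integrable_on {u1..v1} \<union> {u2..v2}"
      by (intro absolutely_integrable_Un i)+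
    moreover have "K \<subseteq> {u1..v1} \<union> {u2..v2}" using o(1) by force
    moreover have "K \<in> sets lebesgue" using K by (simp add: lmeasurable_compact fmeasurableD)
    ultimately show ?thesis by (meson set_integrable_subset)
  qed
  show "f absolutely_integrable_on K" "g absolutely_integrable_on K" if "compact K \<and> K \<subseteq> U" for K
    using both[OF that] by auto
  fix \<zeta> assume \<zeta>: "test_function U \<zeta>"
  define K where "K = closure {x. \<zeta> x \<noteq> 0}"
  have K: "compact K" "K \<subseteq> U" using \<zeta> unfolding test_function_def K_def by auto
  obtain u1 v1 u2 v2 where o: "K \<subseteq> {u1<..<v1} \<union> {u2<..<v2}" "v1 \<le> u2"
    "primitive_on u1 v1 f g" "primitive_on u2 v2 f g" using loc[OF K] by metis
  have z0: "\<zeta> x = 0" if "x \<notin> K" for x using that closure_subset[of "{x. \<zeta> x \<noteq> 0}"] by (auto simp: K_def)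
  have d0: "deriv \<zeta> x = 0" if "x \<notin> K" for x
  proof -
    have "eventually (\<lambda>y. y \<in> - K) (nhds x)"
      using that by (intro eventually_nhds_in_open) (auto simp: K_def)
    then have "eventually (\<lambda>y. \<zeta> y = 0) (nhds x)" by eventually_elim (simp add: z0)
    then have "(\<zeta> has_real_derivative 0) (at x)" using DERIV_cong_ev[OF refl, of \<zeta> "\<lambda>_. 0" x 0 0] by simp
    then show ?thesis by (rule DERIV_imp_deriv)
  qed
  have out: "x \<notin> K" if "x \<le> u1 \<or> v1 \<le> x" "x \<le> u2 \<or> v2 \<le> x" for x
    using that o(1) by force
  have e1: "u1 \<le> v1 \<Longrightarrow> \<zeta> u1 = 0 \<and> \<zeta> v1 = 0"
    using o(2) z0[OF out[of u1]] z0[OF out[of v1]] by auto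
  have e2: "u2 \<le> v2 \<Longrightarrow> \<zeta> u2 = 0 \<and> \<zeta> v2 = 0"
    using o(2) z0[OF out[of u2]] z0[OF out[of v2]] by auto
  note b1 = Ioo_by_parts[OF o(3) \<zeta> e1] and b2 = Ioo_by_parts[OF o(4) \<zeta> e2]
  have split: "(LINT x|lebesgue. F x) = integral {u1<..<v1} F + integral {u2<..<v2} F"
    if F: "\<And>x. x \<notin> K \<Longrightarrow> F x = 0" "F absolutely_integrable_on {u1<..<v1}" "F absolutely_integrable_on {u2<..<v2}"
    for F :: "real \<Rightarrow> 'a"
  proof -
    have dis: "{u1<..<v1} \<inter> {u2<..<v2} = {}" using o(2) by auto
    have "(LINT x|lebesgue. F x) = integral ({u1<..<v1} \<union> {u2<..<v2}) F"
    proof (rule integral_lebesgue_support(2))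
      show "F x = 0" if "x \<notin> {u1<..<v1} \<union> {u2<..<v2}" for x using F(1) that o(1) by blast
      show "F absolutely_integrable_on {u1<..<v1} \<union> {u2<..<v2}" by (intro absolutely_integrable_Un F)
    qed
    also have "\<dots> = integral {u1<..<v1} F + integral {u2<..<v2} F"
      by (rule Henstock_Kurzweil_Integration.integral_Un) (use F dis set_lebesgue_integral_eq_integral(1) in \<open>auto\<close>)
    finally show ?thesis .
  qed
  show "(LINT x|lebesgue. deriv \<zeta> x *\<^sub>R f x) = - (LINT x|lebesgue. \<zeta> x *\<^sub>R g x)"
    using split[OF _ b1(1) b2(1)] split[OF _ b1(2) b2(2)] b1(3) b2(3) by (simp add: z0 d0)
qed

lemma has_weak_deriv_UNIV_I:
  assumes "\<And>u v. primitive_on u v f g"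
  shows "has_weak_deriv UNIV f g"
proof (rule has_weak_derivI)
  fix K :: "real set" assume "compact K"
  then obtain R where "\<forall>x\<in>K. \<bar>x\<bar> \<le> R" using compact_imp_bounded bounded_real by blast
  \<comment> \<open>Everything lies in the first interval; the second is empty.\<close>
  then have "K \<subseteq> {- (R + 1)<..<R + 1} \<union> {R + 1<..<R + 1}" by force
  then show "\<exists>u1 v1 u2 v2. K \<subseteq> {u1<..<v1} \<union> {u2<..<v2} \<and> v1 \<le> u2 \<and> primitive_on u1 v1 f g \<and> primitive_on u2 v2 f g"
    using assms by blast
qed

lemma has_weak_deriv_punctured_I:
  assumes p: "\<And>u v. 0 \<notin> {u..v} \<Longrightarrow> primitive_on u v f g"
  shows "has_weak_deriv (UNIV - {0}) f g"
proof (rule has_weak_derivI)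
  fix K :: "real set" assume K: "compact K" "K \<subseteq> UNIV - {0}"
  then obtain R where R: "\<forall>x\<in>K. \<bar>x\<bar> \<le> R" using compact_imp_bounded bounded_real by blast
  have "open (- K)" "0 \<in> - K" using K compact_imp_closed by auto
  then obtain e where e: "e > 0" "ball 0 e \<subseteq> - K" using open_contains_ball by blast
  have "x \<in> {- (\<bar>R\<bar> + 1)<..<- (e / 2)} \<union> {e / 2<..<\<bar>R\<bar> + 1}" if x: "x \<in> K" for x
  proof -
    have "\<not> \<bar>x\<bar> < e" using e(2) x by (auto simp: subset_iff)
    moreover have "\<bar>x\<bar> \<le> R" using R x by blast
    ultimately show ?thesis using e(1) by auto
  qed
  then have "K \<subseteq> {- (\<bar>R\<bar> + 1)<..<- (e / 2)} \<union> {e / 2<..<\<bar>R\<bar> + 1}" by blast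
  then show "\<exists>u1 v1 u2 v2. K \<subseteq> {u1<..<v1} \<union> {u2<..<v2} \<and> v1 \<le> u2 \<and> primitive_on u1 v1 f g \<and> primitive_on u2 v2 f g"
    using e(1) by (intro exI[of _ "- (\<bar>R\<bar> + 1)"] exI[of _ "- (e / 2)"] exI[of _ "e/2"] exI[of _ "\<bar>R\<bar> + 1"] conjI p) auto
qed

lemma primitive_unique_AE:
  assumes "\<And>u v. primitive_on u v f g" "\<And>u v. primitive_on u v f h"
  shows "AE x in lebesgue. g x = h x"
proof -
  have "AE x in lebesgue. \<forall>n::nat. - real n \<le> x \<and> x \<le> real n \<longrightarrow> g x = h x"
    unfolding AE_all_countable using primitive_on_unique_AE[OF assms] by blast
  then show ?thesis
  proof eventually_elim
    fix x assume *: "\<forall>n::nat. - real n \<le> x \<and> x \<le> real n \<longrightarrow> g x = h x"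
    obtain n :: nat where "\<bar>x\<bar> \<le> real n" using real_arch_simple by blast
    then show "g x = h x" using *[rule_format, of n] by linarith
  qed
qed

text \<open>\<open>weak_deriv\<close> is an arbitrary choice; this replaces it, almost everywhere,
  by any explicitly known derivative.\<close>

lemma weak_deriv_primitive:
  assumes "\<And>u v. primitive_on u v f g"
  shows "primitive_on u v f (weak_deriv f)" "AE x in lebesgue. weak_deriv f x = g x"
proof -
  have c: "continuous_on UNIV f" by (rule primitive_continuous[OF assms])
  have "has_weak_deriv UNIV f (weak_deriv f)"
    unfolding weak_deriv_def by (rule someI[of _ g], rule has_weak_deriv_UNIV_I[OF assms])
  from has_weak_deriv_primitive[OF this c] show 1: "primitive_on u v f (weak_deriv f)" for u v .
  show "AE x in lebesgue. weak_deriv f x = g x" by (rule primitive_unique_AE[OF 1 assms])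
qed

subsection \<open>A Volterra equation and a shooting argument\<close>

lemma has_integral_exp_mult:
  assumes "K > 0" "0 \<le> y"
  shows "((\<lambda>t. B * exp (K * t)) has_integral (B * (exp (K * y) - 1) / K)) {0..y::real}"
proof -
  have "((\<lambda>t. B * exp (K * t)) has_integral (B * exp (K * y) / K - B * exp (K * 0) / K)) {0..y}"
    using assms
    by (intro fundamental_theorem_of_calculus)
      (auto intro!: derivative_eq_intros simp flip: has_real_derivative_iff_has_vector_derivative)
  then show ?thesis by (simp add: diff_divide_distrib right_diff_distrib)
qed

text \<open>Fixed point in the sup norm weighted by \<open>exp (- 2 L x)\<close>: there the integral
  operator contracts with factor \<open>L / (2 L) = 1/2\<close> on the whole half-line at once. The
  Lipschitz hypothesis is stated in the same weight because \<open>N q t\<close> may depend on the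
  past of \<open>q\<close>. The factor \<open>2\<close> in the dependence on \<open>c\<close> is
  \<open>1 / (1 - 1/2)\<close>.\<close>

lemma volterra_solution:
  fixes N :: "(real \<Rightarrow> real) \<Rightarrow> real \<Rightarrow> real"
  assumes L: "L > 0"
    and int: "\<And>q x. continuous_on UNIV q \<Longrightarrow> N q absolutely_integrable_on {0..x}"
    and bd: "\<And>q t. 0 \<le> t \<Longrightarrow> \<bar>N q t\<bar> \<le> C"
    and lip: "\<And>q r D t. continuous_on UNIV q \<Longrightarrow> continuous_on UNIV r \<Longrightarrow> 0 \<le> t \<Longrightarrow>
      (\<And>s. 0 \<le> s \<Longrightarrow> s \<le> t \<Longrightarrow> \<bar>q s - r s\<bar> \<le> D * exp (2 * L * s)) \<Longrightarrow>
      \<bar>N q t - N r t\<bar> \<le> L * D * exp (2 * L * t)"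
  shows "\<exists>Q. (\<forall>c. continuous_on UNIV (Q c) \<and> (\<forall>x\<ge>0. Q c x = c + integral {0..x} (N (Q c)))) \<and>
     (\<forall>c d x. 0 \<le> x \<longrightarrow> \<bar>Q c x - Q d x\<bar> \<le> 2 * \<bar>c - d\<bar> * exp (2 * L * x))"
proof -
  define K where "K = 2 * L"
  have K: "K > 0" using L by (simp add: K_def)
  have C: "C \<ge> 0" using bd[of 0 "\<lambda>_. 0"] by simp
  \<comment> \<open>A bounded function \<open>u\<close> stands for \<open>q = exp (K t) u\<close>,
    so the plain sup norm of \<open>u\<close> is the weighted norm of \<open>q\<close>.\<close>
  define P where "P u t = exp (K * t) * apply_bcontfun u t" for u :: "real \<Rightarrow>\<^sub>C real" and t
  have Pc: "continuous_on UNIV (P u)" for u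
    unfolding P_def by (intro continuous_intros continuous_on_apply_bcontfun)
  \<comment> \<open>\<open>max 0 x\<close> continues the map by a constant to negative arguments,
    since bounded continuous functions live on the whole line here.\<close>
  define F where "F c u x = exp (- (K * max 0 x)) * (c + integral {0..max 0 x} (N (P u)))" for c u x
  have ii: "N (P u) integrable_on {0..x}" for u x
    by (rule set_lebesgue_integral_eq_integral(1)[OF int[OF Pc]])
  have ibd: "\<bar>integral {0..x} (N (P u))\<bar> \<le> C * x" if "x \<ge> 0" for u x
  proof -
    have "norm (integral {0..x} (N (P u))) \<le> integral {0..x} (\<lambda>t. C)"
      by (rule integral_norm_bound_integral[OF ii]) (use bd in auto)
    then show ?thesis using that by (simp add: mult.commute)
  qed
  have Fbd: "\<bar>F c u x\<bar> \<le> \<bar>c\<bar> + C / K" for c u x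
  proof -
    define y where "y = max 0 x"
    have y: "y \<ge> 0" by (simp add: y_def)
    have e1: "exp (- (K * y)) \<le> 1" using K y by simp
    \<comment> \<open>The linear growth of the integral is absorbed by the weight:
      \<open>y exp (- K y) \<le> 1 / K\<close>.\<close>
    have "K * y \<le> exp (K * y)" using exp_ge_add_one_self[of "K * y"] by linarith
    then have "exp (- (K * y)) * (K * y) \<le> exp (- (K * y)) * exp (K * y)" by (intro mult_left_mono) auto
    then have e2: "exp (- (K * y)) * y \<le> 1 / K" using K by (simp add: exp_minus field_simps)
    have "\<bar>F c u x\<bar> = exp (- (K * y)) * \<bar>c + integral {0..y} (N (P u))\<bar>"
      by (simp add: F_def y_def abs_mult)
    also have "\<dots> \<le> exp (- (K * y)) * (\<bar>c\<bar> + C * y)"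
      using ibd[OF y, of u] by (intro mult_left_mono) auto
    also have "\<dots> = exp (- (K * y)) * \<bar>c\<bar> + C * (exp (- (K * y)) * y)" by (simp add: algebra_simps)
    also have "\<dots> \<le> 1 * \<bar>c\<bar> + C * (1 / K)"
      using e1 e2 C by (intro add_mono mult_right_mono mult_left_mono) auto
    finally show ?thesis by simp
  qed
  have Fc: "continuous_on UNIV (F c u)" for c u
  proof (rule continuous_at_imp_continuous_on, rule ballI)
    fix x :: real
    have "continuous_on {0..\<bar>x\<bar> + 1} (\<lambda>y. integral {0..y} (N (P u)))"
      by (rule indefinite_integral_continuous_1[OF ii])
    then have "continuous_on {x - 1..x + 1} (\<lambda>x. integral {0..max 0 x} (N (P u)))"
      by (rule continuous_on_compose2) (auto intro!: continuous_intros)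
    then have "continuous_on {x - 1..x + 1} (F c u)"
      unfolding F_def by (intro continuous_intros)
    then show "isCont (F c u) x" by (rule continuous_on_interior) auto
  qed
  have Fb: "F c u \<in> bcontfun" for c u
    by (rule bcontfun_normI[OF Fc]) (use Fbd in auto)
  define S where "S c u = Bcontfun (F c u)" for c u
  have Sa: "apply_bcontfun (S c u) x = F c u x" for c u x
    unfolding S_def using Bcontfun_inverse[OF Fb] by simp
  have contr: "dist (S c u) (S c v) \<le> 1 / 2 * dist u v" for c u v
  proof (rule dist_bound)
    fix x :: real
    define y where "y = max 0 x"
    have y: "y \<ge> 0" by (simp add: y_def)
    have "norm (integral {0..y} (\<lambda>t. N (P u) t - N (P v) t)) \<le> integral {0..y} (\<lambda>t. (L * dist u v) * exp (K * t))"
    proof (rule integral_norm_bound_integral)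
      fix t assume t: "t \<in> {0..y}"
      have "\<bar>P u s - P v s\<bar> \<le> dist u v * exp (2 * L * s)" for s
      proof -
        have "\<bar>P u s - P v s\<bar> = exp (K * s) * \<bar>apply_bcontfun u s - apply_bcontfun v s\<bar>"
          by (simp add: P_def abs_mult flip: right_diff_distrib)
        also have "\<dots> \<le> exp (K * s) * dist u v"
          using dist_bounded[where f = u and g = v and x = s] by (intro mult_left_mono) (auto simp: dist_real_def)
        finally show ?thesis by (simp add: K_def mult.commute)
      qed
      then show "norm (N (P u) t - N (P v) t) \<le> (L * dist u v) * exp (K * t)"
        using lip[OF Pc Pc, of t u v "dist u v"] t by (simp add: K_def)
    qed (use has_integral_exp_mult[OF K y] ii in \<open>auto intro!: integrable_diff\<close>)
    also have "\<dots> = L * dist u v * (exp (K * y) - 1) / K" by (rule integral_unique[OF has_integral_exp_mult[OF K y]])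
    also have "\<dots> = 1 / 2 * dist u v * (exp (K * y) - 1)" using L by (simp add: K_def)
    also have "\<dots> \<le> 1 / 2 * dist u v * exp (K * y)" by (intro mult_left_mono) auto
    finally have b: "\<bar>integral {0..y} (N (P u)) - integral {0..y} (N (P v))\<bar> \<le> 1 / 2 * dist u v * exp (K * y)"
      using Henstock_Kurzweil_Integration.integral_diff[OF ii[of u y] ii[of v y]] by simp
    have "dist (F c u x) (F c v x) = exp (- (K * y)) * \<bar>integral {0..y} (N (P u)) - integral {0..y} (N (P v))\<bar>"
      by (simp add: F_def y_def dist_real_def abs_mult flip: right_diff_distrib)
    also have "\<dots> \<le> exp (- (K * y)) * (1 / 2 * dist u v * exp (K * y))" by (rule mult_left_mono[OF b]) simp
    also have "\<dots> = 1 / 2 * dist u v" by (simp add: exp_minus field_simps)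
    finally show "dist (apply_bcontfun (S c u) x) (apply_bcontfun (S c v) x) \<le> 1 / 2 * dist u v"
      unfolding Sa .
  qed
  have "\<exists>!u. S c u = u" for c
    by (rule banach_fix_type[of "1/2"]) (use contr in auto)
  then obtain U where U: "\<And>c. S c (U c) = U c" by metis
  define Q where "Q c = P (U c)" for c
  have 1: "continuous_on UNIV (Q c)" for c unfolding Q_def by (rule Pc)
  have 2: "Q c x = c + integral {0..x} (N (Q c))" if "x \<ge> 0" for c x
  proof -
    have "apply_bcontfun (U c) x = F c (U c) x" using Sa[of c "U c" x] U[of c] by simp
    then show ?thesis using that by (simp add: Q_def P_def F_def exp_minus)
  qed
  have 3: "\<bar>Q c x - Q d x\<bar> \<le> 2 * \<bar>c - d\<bar> * exp (2 * L * x)" if "x \<ge> 0" for c d x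
  proof -
    have "dist (S c (U d)) (S d (U d)) \<le> \<bar>c - d\<bar>"
    proof (rule dist_bound)
      fix x
      have "dist (F c (U d) x) (F d (U d) x) = exp (- (K * max 0 x)) * \<bar>c - d\<bar>"
        by (simp add: F_def dist_real_def abs_mult flip: right_diff_distrib)
      also have "\<dots> \<le> 1 * \<bar>c - d\<bar>" using K by (intro mult_right_mono) auto
      finally show "dist (apply_bcontfun (S c (U d)) x) (apply_bcontfun (S d (U d)) x) \<le> \<bar>c - d\<bar>"
        unfolding Sa by simp
    qed
    then have "dist (U c) (U d) \<le> 1 / 2 * dist (U c) (U d) + \<bar>c - d\<bar>"
      using contr[of c "U c" "U d"] dist_triangle[of "S c (U c)" "S d (U d)" "S c (U d)"] U by (simp add: dist_commute)
    then have d: "dist (U c) (U d) \<le> 2 * \<bar>c - d\<bar>" by simp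
    have "\<bar>Q c x - Q d x\<bar> = exp (K * x) * \<bar>apply_bcontfun (U c) x - apply_bcontfun (U d) x\<bar>"
      by (simp add: Q_def P_def abs_mult flip: right_diff_distrib)
    also have "\<dots> \<le> exp (K * x) * (2 * \<bar>c - d\<bar>)"
      using dist_bounded[where f = "U c" and g = "U d" and x = x] d by (intro mult_left_mono) (auto simp: dist_real_def)
    finally show ?thesis by (simp add: K_def mult.commute)
  qed
  show ?thesis using 1 2 3 by blast
qed

text \<open>Up to the first time \<open>z\<close> at which \<open>q = A\<close>, the intermediate
  value theorem keeps \<open>q \<ge> A\<close>, so \<open>g \<ge> 0\<close> there and
  \<open>q\<close> cannot have come down from a value above \<open>A\<close>.\<close>

lemma upper_barrier:
  fixes q g :: "real \<Rightarrow> real"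
  assumes p: "primitive_on x1 x2 q g" and x: "x1 \<le> x2" and start: "q x1 > A"
    and sign: "\<And>t. x1 \<le> t \<Longrightarrow> t \<le> x2 \<Longrightarrow> q t \<ge> A \<Longrightarrow> g t \<ge> 0"
  shows "q x2 > A"
proof (rule ccontr)
  assume "\<not> q x2 > A"
  then have le: "q x2 \<le> A" by simp
  have c: "continuous_on {x1..x2} q" by (rule primitive_on_continuous[OF p])
  have hit: "\<exists>s\<ge>x1. s \<le> t \<and> q s = A" if "x1 \<le> t" "t \<le> x2" "q t \<le> A" for t
    by (rule IVT2') (use that start c in \<open>auto intro: continuous_on_subset\<close>)
  define S where "S = {t \<in> {x1..x2}. q t = A}"
  have Sne: "S \<noteq> {}" using hit[OF x order_refl le] by (auto simp: S_def)
  have "closed S" unfolding S_def by (rule continuous_closed_preimage_constant[OF c]) simp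
  moreover have bdd: "bdd_below S" by (auto simp: S_def intro: bdd_belowI)
  ultimately have zS: "Inf S \<in> S" using Sne closed_contains_Inf by blast
  define z where "z = Inf S"
  have z: "x1 \<le> z" "z \<le> x2" "q z = A" using zS by (auto simp: z_def S_def)
  have "q t \<ge> A" if t: "x1 \<le> t" "t \<le> z" for t
  proof (rule ccontr)
    assume "\<not> q t \<ge> A"
    then have lt: "q t < A" by simp
    obtain s where s: "s \<ge> x1" "s \<le> t" "q s = A" using hit[of t] t z lt by auto
    then have "s \<in> S" using t z by (auto simp: S_def)
    then have "z \<le> s" unfolding z_def using bdd by (rule cInf_lower)
    then have "s = t" using s t by simp
    then show False using s lt by simp
  qed
  then have "q z - q x1 \<ge> 0"
    by (intro has_integral_nonneg[OF primitive_onD[OF p]]) (use z sign in auto)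
  then show False using z start by simp
qed

lemma lower_barrier:
  fixes q g :: "real \<Rightarrow> real"
  assumes p: "primitive_on x1 x2 q g" and x: "x1 \<le> x2" and start: "q x1 < A"
    and sign: "\<And>t. x1 \<le> t \<Longrightarrow> t \<le> x2 \<Longrightarrow> q t \<le> A \<Longrightarrow> g t \<le> 0"
  shows "q x2 < A"
  using upper_barrier[OF primitive_on_minus[OF p] x, of "- A"] start sign by simp

lemma bounded_measurable_abs_integrable:
  fixes f :: "real \<Rightarrow> 'a::euclidean_space"
  assumes "f \<in> borel_measurable lebesgue" "\<And>x. x \<in> {u..v} \<Longrightarrow> norm (f x) \<le> B"
  shows "f absolutely_integrable_on {u..v}"
proof (rule measurable_bounded_by_integrable_imp_absolutely_integrable)
  show "f \<in> borel_measurable (lebesgue_on {u..v})"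
    using assms(1) by (rule measurable_restrict_space1)
  show "(\<lambda>x. B) integrable_on {u..v}" by (rule integrable_const_ivl)
qed (use assms in auto)

lemma continuous_measurable_lebesgue:
  fixes f :: "real \<Rightarrow> 'a::euclidean_space"
  assumes "continuous_on UNIV f"
  shows "f \<in> borel_measurable lebesgue"
proof -
  have "f \<in> borel_measurable lborel" using borel_measurable_continuous_onI[OF assms] by simp
  then show ?thesis by (rule measurable_completion)
qed

lemma abs_tanh_diff_le: "\<bar>tanh x - tanh y\<bar> \<le> \<bar>x - (y::real)\<bar>"
proof -
  have *: "tanh v - tanh u \<le> v - u \<and> 0 \<le> tanh v - tanh u" if "u < v" for u v :: real
  proof -
    have "\<exists>z>u. z < v \<and> tanh v - tanh u = (v - u) * (1 - tanh z ^ 2)"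
      by (rule MVT2[OF that]) (auto intro!: derivative_eq_intros)
    then obtain z where z: "tanh v - tanh u = (v - u) * (1 - tanh z ^ 2)" by blast
    have "(v - u) * (1 - tanh z ^ 2) \<le> (v - u) * 1" using that by (intro mult_left_mono) auto
    moreover have "tanh u < tanh v" using that by simp
    ultimately show ?thesis using z by (metis diff_ge_0_iff_ge less_imp_le mult.right_neutral)
  qed
  show ?thesis using *[of x y] *[of y x] by (cases x y rule: linorder_cases) auto
qed

text \<open>
  With \<open>sin \<phi> = tanh \<tau>\<close> and \<open>a \<phi>' = q cos \<phi>\<close> the pendulum equation becomes the system
  \<open>\<tau>' = q/a\<close>, \<open>q' = (q\<^sup>2/a - a) tanh \<tau>\<close>, and \<open>\<phi>(\<infinity>) = \<pi>/2\<close> amounts to \<open>q\<close> staying in \<open>[a\<^sub>0, A\<^sub>0]\<close>. Replacing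
  \<open>q\<close> by its truncation to this interval on the right-hand sides makes the system globally
  Lipschitz, and a solution that leaves the interval on either side never returns. The initial values
  leaving through the top and those leaving through the bottom are disjoint open sets, so some
  initial value never leaves.
\<close>

definition half_profile :: "(real \<Rightarrow> real) \<Rightarrow> real \<Rightarrow> real \<Rightarrow> (real \<Rightarrow> real) \<times> (real \<Rightarrow> real) \<Rightarrow> bool" where
  "half_profile a a\<^sub>0 A\<^sub>0 = (\<lambda>(\<tau>, q). continuous_on UNIV q \<and> \<tau> 0 = 0 \<and>
     (\<forall>x\<ge>0. a\<^sub>0 \<le> q x \<and> q x \<le> A\<^sub>0) \<and>
     (\<forall>R. primitive_on 0 R \<tau> (\<lambda>x. q x / a x)) \<and>
     (\<forall>R. primitive_on 0 R q (\<lambda>x. ((q x)\<^sup>2 / a x - a x) * tanh (\<tau> x))))"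

lemma half_profile_exists:
  fixes a :: "real \<Rightarrow> real"
  assumes am: "a \<in> borel_measurable lebesgue" and a0: "0 < a\<^sub>0"
    and ab: "\<And>x. a\<^sub>0 \<le> a x" "\<And>x. a x \<le> A\<^sub>0"
  shows "\<exists>p. half_profile a a\<^sub>0 A\<^sub>0 p"
proof -
  have aA: "a\<^sub>0 \<le> A\<^sub>0" using ab[of 0] by linarith
  have apos: "a x > 0" for x using a0 ab(1)[of x] by linarith
  have A0: "A\<^sub>0 > 0" using a0 aA by linarith
  define cl where "cl y = max a\<^sub>0 (min A\<^sub>0 y)" for y
  have cl: "a\<^sub>0 \<le> cl y" "cl y \<le> A\<^sub>0" "0 < cl y" for y using aA a0 by (auto simp: cl_def)
  have cllip: "\<bar>cl y - cl z\<bar> \<le> \<bar>y - z\<bar>" for y z unfolding cl_def by (auto simp: max_def min_def)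
  have clc: "continuous_on UNIV cl" unfolding cl_def by (intro continuous_intros)
  define T where "T q t = integral {0..t} (\<lambda>s. cl (q s) / a s)" for q t
  define B where "B = A\<^sub>0\<^sup>2 / a\<^sub>0 + A\<^sub>0"
  have B: "B > 0" using A0 a0 by (simp add: B_def add_pos_pos)
  define V where "V y t = (cl y)\<^sup>2 / a t - a t" for y t
  define N where "N q t = V (q t) t * tanh (T q t)" for q t
  \<comment> \<open>Lipschitz constant of \<open>N\<close>: \<open>2 A\<^sub>0 / a\<^sub>0\<close>
    from the square in \<open>V\<close>, and \<open>B / a\<^sub>0\<close> from the bound on
    \<open>V\<close> times the constant of \<open>T\<close>. The summand \<open>1\<close> gives
    \<open>2 L \<ge> 1\<close>, which absorbs the division by \<open>2 L\<close> in the estimate of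
    \<open>T\<close>.\<close>
  define L where "L = 2 * A\<^sub>0 / a\<^sub>0 + B / a\<^sub>0 + 1"
  have Lpos: "L \<ge> 1" using A0 a0 B by (simp add: L_def)
  have Vb: "\<bar>V y t\<bar> \<le> B" for y t
  proof -
    have "(cl y)\<^sup>2 / a t \<le> A\<^sub>0\<^sup>2 / a\<^sub>0"
      using cl[of y] ab(1)[of t] a0 by (intro frac_le power_mono) auto
    moreover have "0 \<le> (cl y)\<^sup>2 / a t" using apos[of t] by simp
    ultimately show ?thesis unfolding V_def B_def using ab(2)[of t] apos[of t] A0 a0
      by (smt (verit) divide_nonneg_pos zero_le_power2)
  qed
  have clm: "(\<lambda>s. cl (q s)) \<in> borel_measurable lebesgue" if "continuous_on UNIV q" for q :: "real \<Rightarrow> real"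
    by (rule continuous_measurable_lebesgue) (rule continuous_on_compose2[OF clc that], simp)
  have Ti: "(\<lambda>s. cl (q s) / a s) absolutely_integrable_on {u..v}" if "continuous_on UNIV q" for q u v
  proof (rule bounded_measurable_abs_integrable[where B = "A\<^sub>0 / a\<^sub>0"])
    show "(\<lambda>s. cl (q s) / a s) \<in> borel_measurable lebesgue"
      using clm[OF that] am by (intro borel_measurable_divide)
    show "norm (cl (q x) / a x) \<le> A\<^sub>0 / a\<^sub>0" for x
      using cl[of "q x"] ab(1)[of x] a0 apos[of x] by (simp add: frac_le)
  qed
  have Tprim: "primitive_on 0 R (T q) (\<lambda>s. cl (q s) / a s)" if "continuous_on UNIV q" for q R
    by (rule primitive_onI[OF Ti[OF that], where c = 0]) (simp add: T_def)
  have Vi: "(\<lambda>t. V (q t) t) absolutely_integrable_on {u..v}" if "continuous_on UNIV q" for q u v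
  proof (rule bounded_measurable_abs_integrable[where B = B])
    show "(\<lambda>t. V (q t) t) \<in> borel_measurable lebesgue"
      unfolding V_def using clm[OF that] am by (intro borel_measurable_divide borel_measurable_diff borel_measurable_power)
    show "norm (V (q x) x) \<le> B" for x using Vb by simp
  qed
  have Ni: "N q absolutely_integrable_on {0..x}" if "continuous_on UNIV q" for q x
  proof -
    have "continuous_on {0..x} (\<lambda>t. tanh (T q t))"
      by (intro continuous_on_tanh primitive_on_continuous[OF Tprim[OF that]]) auto
    from abs_integrable_bilinear[OF bounded_bilinear_mult this Vi[OF that]]
    show ?thesis unfolding N_def by (simp only: mult.commute)
  qed
  have tanh1: "\<bar>tanh y\<bar> \<le> 1" for y :: real using tanh_real_lt_1[of y] tanh_real_gt_neg1[of y] by linarith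
  have Nb: "\<bar>N q t\<bar> \<le> B" for q t
  proof -
    have "\<bar>V (q t) t\<bar> * \<bar>tanh (T q t)\<bar> \<le> B * 1" using Vb tanh1 B by (intro mult_mono) auto
    then show ?thesis by (simp add: N_def abs_mult)
  qed
  have lip: "\<bar>N q t - N r t\<bar> \<le> L * D * exp (2 * L * t)"
    if q: "continuous_on UNIV q" and r: "continuous_on UNIV r" and t: "0 \<le> t"
      and D: "\<And>s. 0 \<le> s \<Longrightarrow> s \<le> t \<Longrightarrow> \<bar>q s - r s\<bar> \<le> D * exp (2 * L * s)" for q r D t
  proof -
    define E where "E = D * exp (2 * L * t)"
    have D0: "D \<ge> 0" using D[of 0] t by (simp add: order_trans[OF abs_ge_zero])
    have "\<bar>V (q t) t - V (r t) t\<bar> = \<bar>cl (q t) - cl (r t)\<bar> * (cl (q t) + cl (r t)) / a t"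
    proof -
      have "V (q t) t - V (r t) t = (cl (q t) - cl (r t)) * (cl (q t) + cl (r t)) / a t"
        by (simp add: V_def power2_eq_square algebra_simps diff_divide_distrib add_divide_distrib)
      then show ?thesis using apos[of t] cl(3)[of "q t"] cl(3)[of "r t"] by (simp add: abs_mult)
    qed
    also have "\<dots> \<le> E * (2 * A\<^sub>0) / a\<^sub>0"
    proof (rule frac_le)
      have "\<bar>cl (q t) - cl (r t)\<bar> \<le> E" using cllip[of "q t" "r t"] D[of t] t by (simp add: E_def)
      then show "\<bar>cl (q t) - cl (r t)\<bar> * (cl (q t) + cl (r t)) \<le> E * (2 * A\<^sub>0)"
        using cl[of "q t"] cl[of "r t"] by (intro mult_mono) auto
      show "0 \<le> E * (2 * A\<^sub>0)" using D0 A0 by (simp add: E_def)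
    qed (use ab a0 in auto)
    finally have V1: "\<bar>V (q t) t - V (r t) t\<bar> \<le> (2 * A\<^sub>0 / a\<^sub>0) * E" by (simp add: algebra_simps)
    have "norm (integral {0..t} (\<lambda>s. cl (q s) / a s - cl (r s) / a s)) \<le> integral {0..t} (\<lambda>s. (D / a\<^sub>0) * exp (2 * L * s))"
    proof (rule integral_norm_bound_integral)
      show "(\<lambda>s. cl (q s) / a s - cl (r s) / a s) integrable_on {0..t}"
        using Ti[OF q] Ti[OF r] by (intro integrable_diff set_lebesgue_integral_eq_integral(1))
      show "(\<lambda>s. (D / a\<^sub>0) * exp (2 * L * s)) integrable_on {0..t}"
        by (rule has_integral_integrable[OF has_integral_exp_mult]) (use Lpos t in auto)
      fix s assume s: "s \<in> {0..t}"
      have "\<bar>cl (q s) / a s - cl (r s) / a s\<bar> = \<bar>cl (q s) - cl (r s)\<bar> / a s"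
        using apos[of s] by (simp flip: diff_divide_distrib)
      also have "\<dots> \<le> (D * exp (2 * L * s)) / a\<^sub>0"
        using cllip[of "q s" "r s"] D[of s] s ab(1)[of s] a0 by (intro frac_le) auto
      finally show "norm (cl (q s) / a s - cl (r s) / a s) \<le> (D / a\<^sub>0) * exp (2 * L * s)" by simp
    qed
    also have "\<dots> = (D / a\<^sub>0) * (exp (2 * L * t) - 1) / (2 * L)"
      by (rule integral_unique[OF has_integral_exp_mult]) (use Lpos t in auto)
    also have "\<dots> \<le> (D / a\<^sub>0) * exp (2 * L * t) / 1"
      using Lpos D0 a0 by (intro frac_le mult_left_mono mult_nonneg_nonneg) auto
    finally have "\<bar>T q t - T r t\<bar> \<le> E / a\<^sub>0"
      unfolding T_def E_def
      using Henstock_Kurzweil_Integration.integral_diff[OF set_lebesgue_integral_eq_integral(1)[OF Ti[OF q]]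
          set_lebesgue_integral_eq_integral(1)[OF Ti[OF r]], of 0 t] by simp
    then have T1: "\<bar>tanh (T q t) - tanh (T r t)\<bar> \<le> E / a\<^sub>0" using abs_tanh_diff_le order_trans by blast
    have "N q t - N r t = (V (q t) t - V (r t) t) * tanh (T q t) + V (r t) t * (tanh (T q t) - tanh (T r t))"
      by (simp add: N_def algebra_simps)
    then have "\<bar>N q t - N r t\<bar> \<le> \<bar>V (q t) t - V (r t) t\<bar> * \<bar>tanh (T q t)\<bar> + \<bar>V (r t) t\<bar> * \<bar>tanh (T q t) - tanh (T r t)\<bar>"
      using abs_triangle_ineq by (metis abs_mult)
    also have "\<dots> \<le> (2 * A\<^sub>0 / a\<^sub>0) * E * 1 + B * (E / a\<^sub>0)"
      by (intro add_mono mult_mono V1 T1 Vb tanh1) (use B D0 A0 a0 in \<open>auto simp: E_def\<close>)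
    also have "\<dots> = (L - 1) * E" by (simp add: L_def algebra_simps)
    also have "\<dots> \<le> L * E" using D0 by (intro mult_right_mono) (auto simp: E_def)
    finally show ?thesis by (simp add: E_def)
  qed
  have "L > 0" using Lpos by simp
  from volterra_solution[of L N B, OF this Ni Nb lip]
  obtain Q where "(\<forall>c. continuous_on UNIV (Q c) \<and> (\<forall>x\<ge>0. Q c x = c + integral {0..x} (N (Q c)))) \<and>
     (\<forall>c d x. 0 \<le> x \<longrightarrow> \<bar>Q c x - Q d x\<bar> \<le> 2 * \<bar>c - d\<bar> * exp (2 * L * x))" ..
  then have Qc: "\<And>c. continuous_on UNIV (Q c)"
    and Qeq: "\<And>c x. x \<ge> 0 \<Longrightarrow> Q c x = c + integral {0..x} (N (Q c))"
    and Qdep: "\<And>c d x. 0 \<le> x \<Longrightarrow> \<bar>Q c x - Q d x\<bar> \<le> 2 * \<bar>c - d\<bar> * exp (2 * L * x)"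
    by blast+
  have Qp: "primitive_on 0 R (Q c) (N (Q c))" for R c
    by (rule primitive_onI[OF Ni[OF Qc], where c = c]) (rule Qeq)
  have Tnn: "T (Q c) t \<ge> 0" for c t
  proof -
    have "0 \<le> cl (Q c s) / a s" for s using cl(3)[of "Q c s"] apos[of s] by simp
    then show ?thesis unfolding T_def by (intro integral_nonneg set_lebesgue_integral_eq_integral(1)[OF Ti[OF Qc]])
  qed
  \<comment> \<open>Above \<open>A\<^sub>0\<close> the truncation freezes at
    \<open>A\<^sub>0\<close>, so \<open>A\<^sub>0\<^sup>2 / a - a \<ge> 0\<close>; with
    \<open>T \<ge> 0\<close> the slope of \<open>Q\<close> is non-negative. Below
    \<open>a\<^sub>0\<close> the sign of \<open>V\<close> is reversed.\<close>
  have up: "Q c y > A\<^sub>0" if "Q c x > A\<^sub>0" "0 \<le> x" "x \<le> y" for c x y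
  proof (rule upper_barrier[OF primitive_on_subset[OF Qp]])
    fix t assume "Q c t \<ge> A\<^sub>0"
    then have "cl (Q c t) = A\<^sub>0" using aA by (simp add: cl_def)
    moreover have "(a t)\<^sup>2 \<le> A\<^sub>0\<^sup>2" using ab[of t] apos[of t] by (intro power_mono) auto
    ultimately have "V (Q c t) t \<ge> 0" using apos[of t] by (simp add: V_def field_simps power2_eq_square)
    then show "N (Q c) t \<ge> 0" unfolding N_def using Tnn by simp
  qed (use that in auto)
  have dn: "Q c y < a\<^sub>0" if "Q c x < a\<^sub>0" "0 \<le> x" "x \<le> y" for c x y
  proof (rule lower_barrier[OF primitive_on_subset[OF Qp]])
    fix t assume "Q c t \<le> a\<^sub>0"
    then have "cl (Q c t) = a\<^sub>0" using aA by (simp add: cl_def)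
    moreover have "a\<^sub>0\<^sup>2 \<le> (a t)\<^sup>2" using ab[of t] a0 by (intro power_mono) auto
    ultimately have "V (Q c t) t \<le> 0" using apos[of t] by (simp add: V_def field_simps power2_eq_square)
    then show "N (Q c) t \<le> 0" unfolding N_def using Tnn by (simp add: mult_nonpos_nonneg)
  qed (use that in auto)
  define Up where "Up = (\<Union>x\<in>{0..}. {c. A\<^sub>0 < Q c x})"
  define Dn where "Dn = (\<Union>x\<in>{0..}. {c. Q c x < a\<^sub>0})"
  have cdep: "continuous_on UNIV (\<lambda>c. Q c x)" if "0 \<le> x" for x
  proof (rule lipschitz_on_continuous_on)
    show "(2 * exp (2 * L * x))-lipschitz_on UNIV (\<lambda>c. Q c x)"
      by (rule lipschitz_onI) (use Qdep[OF that] in \<open>auto simp: dist_real_def mult_ac\<close>)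
  qed
  have "open Up" unfolding Up_def
    by (intro open_UN ballI open_Collect_less continuous_on_const cdep) auto
  moreover have "open Dn" unfolding Dn_def
    by (intro open_UN ballI open_Collect_less continuous_on_const cdep) auto
  moreover have "Up \<inter> Dn = {}"
  proof -
    have False if h: "0 \<le> x" "A\<^sub>0 < Q c x" "0 \<le> y" "Q c y < a\<^sub>0" for c x y
    proof -
      have "A\<^sub>0 < Q c (max x y)" by (rule up[OF h(2,1)]) simp
      moreover have "Q c (max x y) < a\<^sub>0" by (rule dn[OF h(4,3)]) simp
      ultimately show False using aA by linarith
    qed
    then show ?thesis by (auto simp: Up_def Dn_def)
  qed
  \<comment> \<open>These initial values are outside the interval already at \<open>x = 0\<close>,
    so neither open set is empty.\<close>
  moreover have "A\<^sub>0 + 1 \<in> Up" "a\<^sub>0 - 1 \<in> Dn"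
    using Qeq[of 0] by (auto simp: Up_def Dn_def intro!: bexI[of _ 0])
  moreover have "connected (UNIV :: real set)" by (rule connected_UNIV)
  ultimately have "Up \<union> Dn \<noteq> UNIV"
    using connectedD[of UNIV Up Dn] by blast
  then obtain c where c: "c \<notin> Up" "c \<notin> Dn" by blast
  have Qb: "a\<^sub>0 \<le> Q c x \<and> Q c x \<le> A\<^sub>0" if "x \<ge> 0" for x
    using c that unfolding Up_def Dn_def by (auto simp: not_less)
  then have clQ: "cl (Q c x) = Q c x" if "x \<ge> 0" for x using that by (simp add: cl_def)
  have "half_profile a a\<^sub>0 A\<^sub>0 (T (Q c), Q c)"
    unfolding half_profile_def prod.case
  proof (intro conjI allI impI)
    show "primitive_on 0 R (T (Q c)) (\<lambda>x. Q c x / a x)" for R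
      by (rule primitive_on_cong[OF Tprim[OF Qc]]) (auto simp: clQ)
    show "primitive_on 0 R (Q c) (\<lambda>x. ((Q c x)\<^sup>2 / a x - a x) * tanh (T (Q c) x))" for R
      by (rule primitive_on_cong[OF Qp]) (auto simp: clQ N_def V_def)
  qed (use Qb Qc in \<open>auto simp: T_def\<close>)
  then show ?thesis by blast
qed

subsection \<open>The profile of the wall\<close>

text \<open>\<open>q\<close> may jump at \<open>0\<close>, as the two half-lines are solved independently.\<close>

locale wall =
  fixes a \<tau> q :: "real \<Rightarrow> real" and a\<^sub>0 A\<^sub>0 :: real
  assumes a_measurable: "a \<in> borel_measurable lebesgue"
    and a0_pos: "0 < a\<^sub>0"
    and a_ge: "a\<^sub>0 \<le> a x" and a_le: "a x \<le> A\<^sub>0"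
    and q_measurable: "q \<in> borel_measurable lebesgue"
    and q_ge: "a\<^sub>0 \<le> q x" and q_le: "q x \<le> A\<^sub>0"
    and \<tau>_primitive: "primitive_on u v \<tau> (\<lambda>x. q x / a x)"
    and q_primitive: "0 \<notin> {u..v} \<Longrightarrow> primitive_on u v q (\<lambda>x. ((q x)\<^sup>2 / a x - a x) * tanh (\<tau> x))"
    and \<tau>_0: "\<tau> 0 = 0"

lemma AE_lebesgue_nonzero: "AE x in lebesgue. x \<noteq> (0::real)"
  unfolding eventually_ae_filter_negligible by (intro exI[of _ "{0}"]) auto

lemma wall_exists:
  fixes a :: "real \<Rightarrow> real"
  assumes am: "a \<in> borel_measurable lebesgue" and a0: "0 < a\<^sub>0"
    and ab: "\<And>x. a\<^sub>0 \<le> a x" "\<And>x. a x \<le> A\<^sub>0"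
  shows "\<exists>\<tau> q. wall a \<tau> q a\<^sub>0 A\<^sub>0 \<and> ((\<forall>x. a (- x) = a x) \<longrightarrow>
     (\<forall>x. \<tau> (- x) = - \<tau> x) \<and> (\<forall>x. q (- x) = q x) \<and>
     (\<forall>u v. primitive_on u v q (\<lambda>x. ((q x)\<^sup>2 / a x - a x) * tanh (\<tau> x))))"
proof -
  \<comment> \<open>The half-profile is chosen as a function of the weight, and the left half is the
    reflected half-profile of \<open>b\<close>. If \<open>a\<close> is even, then
    \<open>b = a\<close> gives literally the same choice on both sides, so no uniqueness of
    half-profiles is invoked.\<close>
  define sol where "sol b = (SOME p. half_profile b a\<^sub>0 A\<^sub>0 p)" for b
  define b where "b x = a (- x)" for x
  have bm: "b \<in> borel_measurable lebesgue"
  proof -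
    have "(\<lambda>x. a ((- 1) *\<^sub>R x)) \<in> borel_measurable lebesgue"
      by (rule measurable_compose[OF lebesgue_measurable_scaling[of "- 1"] am])
    then show ?thesis by (simp add: b_def[abs_def])
  qed
  obtain \<tau>1 q1 where s1: "sol a = (\<tau>1, q1)" by fastforce
  obtain \<tau>2 q2 where s2: "sol b = (\<tau>2, q2)" by fastforce
  have "half_profile a a\<^sub>0 A\<^sub>0 (sol a)" unfolding sol_def
    using half_profile_exists[OF am a0 ab] by (rule someI_ex)
  then have 1: "continuous_on UNIV q1" "\<tau>1 0 = 0" "\<And>x. x \<ge> 0 \<Longrightarrow> a\<^sub>0 \<le> q1 x \<and> q1 x \<le> A\<^sub>0"
    "\<And>R. primitive_on 0 R \<tau>1 (\<lambda>x. q1 x / a x)"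
    "\<And>R. primitive_on 0 R q1 (\<lambda>x. ((q1 x)\<^sup>2 / a x - a x) * tanh (\<tau>1 x))"
    unfolding s1 half_profile_def prod.case by blast+
  have "half_profile b a\<^sub>0 A\<^sub>0 (sol b)" unfolding sol_def
    using half_profile_exists[OF bm a0] ab by (intro someI_ex[of "half_profile b a\<^sub>0 A\<^sub>0"]) (simp add: b_def)
  then have 2: "continuous_on UNIV q2" "\<tau>2 0 = 0" "\<And>x. x \<ge> 0 \<Longrightarrow> a\<^sub>0 \<le> q2 x \<and> q2 x \<le> A\<^sub>0"
    "\<And>R. primitive_on 0 R \<tau>2 (\<lambda>x. q2 x / b x)"
    "\<And>R. primitive_on 0 R q2 (\<lambda>x. ((q2 x)\<^sup>2 / b x - b x) * tanh (\<tau>2 x))"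
    unfolding s2 half_profile_def prod.case by blast+
  define \<tau> where "\<tau> x = (if 0 \<le> x then \<tau>1 x else - \<tau>2 (- x))" for x
  define q where "q x = (if 0 \<le> x then q1 x else q2 (- x))" for x
  have \<tau>neg: "\<tau> x = - \<tau>2 (- x)" if "x \<le> 0" for x using that 1(2) 2(2) by (auto simp: \<tau>_def)
  have tpos: "primitive_on 0 v \<tau> (\<lambda>x. q x / a x)" for v
    by (rule primitive_on_cong[OF 1(4)]) (auto simp: \<tau>_def q_def)
  have tneg: "primitive_on u 0 \<tau> (\<lambda>x. q x / a x)" for u
  proof -
    have "primitive_on u 0 (\<lambda>x. - \<tau>2 (- x)) (\<lambda>x. - (- (q2 (- x) / b (- x))))"
      using primitive_on_minus[OF primitive_on_reflect[OF 2(4)[of "- u"]]] by simp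
    then show ?thesis
    proof (rule primitive_on_cong)
      show "AE x in lebesgue. u \<le> x \<and> x \<le> 0 \<longrightarrow> - (- (q2 (- x) / b (- x))) = q x / a x"
        using AE_lebesgue_nonzero by eventually_elim (auto simp: q_def b_def)
    qed (use \<tau>neg in auto)
  qed
  have tall: "primitive_on u v \<tau> (\<lambda>x. q x / a x)" for u v
  proof -
    have "primitive_on (min u 0) (max v 0) \<tau> (\<lambda>x. q x / a x)"
      by (rule primitive_on_combine[OF tneg tpos]) auto
    then show ?thesis by (rule primitive_on_subset) auto
  qed
  have qpos: "primitive_on 0 v q (\<lambda>x. ((q x)\<^sup>2 / a x - a x) * tanh (\<tau> x))" for v
    by (rule primitive_on_cong[OF 1(5)]) (auto simp: \<tau>_def q_def)
  \<comment> \<open>\<open>q 0\<close> is taken from the right, so the left branch may include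
    \<open>0\<close> only if both branches agree there.\<close>
  have qneg: "primitive_on u v q (\<lambda>x. ((q x)\<^sup>2 / a x - a x) * tanh (\<tau> x))"
    if "v \<le> 0" "v < 0 \<or> q1 0 = q2 0" for u v
  proof -
    have "primitive_on u v (\<lambda>x. q2 (- x)) (\<lambda>x. - (((q2 (- x))\<^sup>2 / b (- x) - b (- x)) * tanh (\<tau>2 (- x))))"
      using primitive_on_subset[OF primitive_on_reflect[OF 2(5)[of "- u"]], of u v] that by simp
    then show ?thesis
    proof (rule primitive_on_cong)
      show "AE x in lebesgue. u \<le> x \<and> x \<le> v \<longrightarrow>
        - (((q2 (- x))\<^sup>2 / b (- x) - b (- x)) * tanh (\<tau>2 (- x))) = ((q x)\<^sup>2 / a x - a x) * tanh (\<tau> x)"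
        using AE_lebesgue_nonzero by eventually_elim (use that in \<open>auto simp: q_def b_def \<tau>_def\<close>)
      fix x assume x: "u \<le> x" "x \<le> v"
      show "q2 (- x) = q x"
      proof (cases "x < 0")
        case False
        then have "x = 0" "v = 0" using x that(1) by linarith+
        then show ?thesis using that(2) by (simp add: q_def)
      qed (simp add: q_def)
    qed
  qed
  have "wall a \<tau> q a\<^sub>0 A\<^sub>0"
  proof
    have [measurable]: "q1 \<in> borel_measurable lebesgue" "(\<lambda>x. q2 (- x)) \<in> borel_measurable lebesgue"
      by (intro continuous_measurable_lebesgue 1(1) continuous_on_compose2[OF 2(1)] continuous_intros; simp)+
    have [measurable]: "Measurable.pred lebesgue (\<lambda>x::real. 0 \<le> x)"
    proof -
      have "{0::real..} \<in> sets lebesgue" by simp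
      then show ?thesis unfolding Measurable.pred_def by (simp add: atLeast_def)
    qed
    show "q \<in> borel_measurable lebesgue" unfolding q_def[abs_def] by measurable
    show "a\<^sub>0 \<le> q x" "q x \<le> A\<^sub>0" for x
      using 1(3)[of x] 2(3)[of "- x"] by (auto simp: q_def)
    show "primitive_on u v q (\<lambda>x. ((q x)\<^sup>2 / a x - a x) * tanh (\<tau> x))" if "0 \<notin> {u..v}" for u v
    proof (cases "u \<le> v")
      case True
      then consider "0 < u" | "v < 0" using \<open>0 \<notin> {u..v}\<close> by force
      then show ?thesis
        by cases (auto intro: qneg primitive_on_subset[OF qpos])
    qed (simp add: primitive_on_empty)
  qed (use am a0 ab tall 1(2) in \<open>auto simp: \<tau>_def\<close>)
  moreover have "(\<forall>x. \<tau> (- x) = - \<tau> x) \<and> (\<forall>x. q (- x) = q x) \<and>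
     (\<forall>u v. primitive_on u v q (\<lambda>x. ((q x)\<^sup>2 / a x - a x) * tanh (\<tau> x)))"
    if even: "\<forall>x. a (- x) = a x"
  proof -
    have "b = a" using even by (auto simp: b_def)
    then have eq: "\<tau>2 = \<tau>1" "q2 = q1" using s1 s2 by auto
    have "primitive_on u v q (\<lambda>x. ((q x)\<^sup>2 / a x - a x) * tanh (\<tau> x))" for u v
    proof -
      have "primitive_on (min u 0) (max v 0) q (\<lambda>x. ((q x)\<^sup>2 / a x - a x) * tanh (\<tau> x))"
        by (rule primitive_on_combine[OF qneg qpos]) (auto simp: eq)
      then show ?thesis by (rule primitive_on_subset) auto
    qed
    moreover have "\<tau> (- x) = - \<tau> x" "q (- x) = q x" for x
      using 1(2) by (auto simp: \<tau>_def q_def eq)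
    ultimately show ?thesis by blast
  qed
  ultimately show ?thesis by blast
qed

section \<open>Coordinates in three-space, and integrals over exhausting sets\<close>

lemma inner_vec3: "(x::real^3) \<bullet> y = x $ 1 * y $ 1 + x $ 2 * y $ 2 + x $ 3 * y $ 3"
  by (simp add: inner_vec_def sum_3)

lemma norm_vec3: "(norm (x::real^3))\<^sup>2 = (x $ 1)\<^sup>2 + (x $ 2)\<^sup>2 + (x $ 3)\<^sup>2"
  unfolding power2_norm_eq_inner inner_vec3 by (simp add: power2_eq_square)

lemma e_components [simp]:
  "e1 $ 1 = 1" "e1 $ 2 = 0" "e1 $ 3 = 0" "e2 $ 1 = 0" "e2 $ 2 = 1" "e2 $ 3 = 0"
  by (simp_all add: e1_def e2_def)

lemma vec3_eq_iff: "(x::real^3) = y \<longleftrightarrow> x $ 1 = y $ 1 \<and> x $ 2 = y $ 2 \<and> x $ 3 = y $ 3"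
  by (simp add: vec_eq_iff forall_3)

text \<open>Monotone convergence along sets covering almost all of the line; the exceptional null
  set leaves room for exhaustions that avoid the point \<open>0\<close>.\<close>

lemma nn_integral_exhaust:
  fixes f :: "real \<Rightarrow> ennreal"
  assumes "f \<in> borel_measurable lebesgue"
    and "incseq K" "\<And>n. K n \<in> sets lebesgue" "AE x in lebesgue. x \<in> (\<Union>n. K n)"
  shows "(\<lambda>n. \<integral>\<^sup>+x. f x * indicator (K n) x \<partial>lebesgue) \<longlonglongrightarrow> (\<integral>\<^sup>+x. f x \<partial>lebesgue)"
proof -
  have inc: "incseq (\<lambda>n x. f x * indicator (K n) x)"
    using assms(2) by (auto simp: incseq_def le_fun_def indicator_def subset_iff intro!: mult_left_mono)
  have "(\<lambda>n. \<integral>\<^sup>+x. f x * indicator (K n) x \<partial>lebesgue) \<longlonglongrightarrow> (SUP n. \<integral>\<^sup>+x. f x * indicator (K n) x \<partial>lebesgue)"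
    by (intro LIMSEQ_SUP) (use inc in \<open>auto simp: incseq_def le_fun_def intro!: nn_integral_mono\<close>)
  also have "(SUP n. \<integral>\<^sup>+x. f x * indicator (K n) x \<partial>lebesgue) = (\<integral>\<^sup>+x. (SUP n. f x * indicator (K n) x) \<partial>lebesgue)"
    by (rule nn_integral_monotone_convergence_SUP[symmetric, OF inc]) (use assms in measurable)
  also have "\<dots> = (\<integral>\<^sup>+x. f x \<partial>lebesgue)"
  proof (rule nn_integral_cong_AE)
    show "AE x in lebesgue. (SUP n. f x * indicator (K n) x) = f x"
      using assms(4)
    proof eventually_elim
      fix x assume "x \<in> (\<Union>n. K n)"
      then obtain N where N: "x \<in> K N" by blast
      show "(SUP n. f x * indicator (K n) x) = f x"
      proof (rule antisym)
        show "(SUP n. f x * indicator (K n) x) \<le> f x" by (rule SUP_least) (simp add: indicator_def)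
        have "f x = f x * indicator (K N) x" using N by simp
        also have "\<dots> \<le> (SUP n. f x * indicator (K n) x)" by (rule SUP_upper) simp
        finally show "f x \<le> (SUP n. f x * indicator (K n) x)" .
      qed
    qed
  qed
  finally show ?thesis .
qed

lemma nn_integral_indicator_eq_integral:
  fixes f :: "real \<Rightarrow> real"
  assumes "f absolutely_integrable_on S" "\<And>x. 0 \<le> f x" "S \<in> sets lebesgue"
  shows "(\<integral>\<^sup>+x. ennreal (f x) * indicator S x \<partial>lebesgue) = ennreal (integral S f)"
proof -
  have "(\<integral>\<^sup>+x. ennreal (f x) * indicator S x \<partial>lebesgue) = (\<integral>\<^sup>+x. ennreal (indicator S x *\<^sub>R f x) \<partial>lebesgue)"
    by (rule nn_integral_cong) (simp add: indicator_def)
  also have "\<dots> = ennreal (LINT x|lebesgue. indicator S x *\<^sub>R f x)"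
    by (rule nn_integral_eq_integral) (use assms in \<open>auto simp: set_integrable_def\<close>)
  also have "(LINT x|lebesgue. indicator S x *\<^sub>R f x) = integral S f"
    using set_lebesgue_integral_eq_integral(2)[OF assms(1)] by (simp add: set_lebesgue_integral_def)
  finally show ?thesis .
qed

lemma AE_exhaust_Icc: "AE x in lebesgue. x \<in> (\<Union>n. {- real n..real n})"
proof (rule AE_I2)
  fix x :: real
  obtain n :: nat where "\<bar>x\<bar> \<le> real n" using real_arch_simple by blast
  then have "x \<in> {- real n..real n}" by auto
  then show "x \<in> (\<Union>n. {- real n..real n})" by blast
qed

text \<open>The integral over \<open>[-n, n]\<close> is an increment of \<open>F\<close>, hence at
  most \<open>2 B\<close>.\<close>

lemma integrable_of_bounded_primitive:
  fixes f F :: "real \<Rightarrow> real"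
  assumes p: "\<And>u v. primitive_on u v F f" and nn: "\<And>x. 0 \<le> f x" and bd: "\<And>x. \<bar>F x\<bar> \<le> B"
    and m: "f \<in> borel_measurable lebesgue"
  shows "integrable lebesgue f"
proof (rule integrableI_nonneg)
  have le: "(\<integral>\<^sup>+x. ennreal (f x) * indicator {- real n..real n} x \<partial>lebesgue) \<le> ennreal (2 * B)" for n
  proof -
    have "(\<integral>\<^sup>+x. ennreal (f x) * indicator {- real n..real n} x \<partial>lebesgue) = ennreal (F (real n) - F (- real n))"
      using nn_integral_indicator_eq_integral[OF primitive_on_abs_integrable[OF p] nn, of "- real n" "real n"]
        primitive_on_integral[OF p, of "- real n" "- real n" "real n" "real n"] by simp
    also have "\<dots> \<le> ennreal (2 * B)"
      using bd[of "real n"] bd[of "- real n"] by (intro ennreal_leI) linarith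
    finally show ?thesis .
  qed
  have "(\<lambda>n. \<integral>\<^sup>+x. ennreal (f x) * indicator {- real n..real n} x \<partial>lebesgue) \<longlonglongrightarrow> (\<integral>\<^sup>+x. ennreal (f x) \<partial>lebesgue)"
    by (rule nn_integral_exhaust) (use m AE_exhaust_Icc in \<open>auto simp: incseq_def\<close>)
  then have "(\<integral>\<^sup>+x. ennreal (f x) \<partial>lebesgue) \<le> ennreal (2 * B)"
    by (rule LIMSEQ_le_const2) (use le in blast)
  also have "\<dots> < \<infinity>" by simp
  finally show "(\<integral>\<^sup>+x. ennreal (f x) \<partial>lebesgue) < \<infinity>" .
qed (use nn m in auto)

section \<open>Closed form, limits and integrability of the profile\<close>

context wall
begin

text \<open>\<open>\<phi>\<close> is the Gudermannian of \<open>\<tau>\<close>: \<open>S\<close> and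
  \<open>C\<close> are its sine and cosine, and \<open>C q / a\<close> is its derivative.
  \<open>dM\<close> is \<open>\<phi>'\<close> times the unit tangent
  \<open>(cos \<phi>, - sin \<phi>, 0)\<close>.\<close>

definition \<phi> :: "real \<Rightarrow> real" where "\<phi> x = arctan (sinh (\<tau> x))"
definition S :: "real \<Rightarrow> real" where "S x = tanh (\<tau> x)"
definition C :: "real \<Rightarrow> real" where "C x = 1 / cosh (\<tau> x)"
definition M :: "real \<Rightarrow> real^3" where "M x = S x *\<^sub>R e1 + C x *\<^sub>R e2"
definition dM :: "real \<Rightarrow> real^3" where "dM x = (C x * q x / a x) *\<^sub>R (C x *\<^sub>R e1 - S x *\<^sub>R e2)"

lemma a_pos: "a x > 0" and q_pos: "q x > 0" and A0_pos: "A\<^sub>0 > 0"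
  using a0_pos a_ge[of x] q_ge[of x] a_le[of x] by linarith+

lemma sinh_cosh: "cosh (\<tau> x) > 0" "(cosh (\<tau> x))\<^sup>2 = (sinh (\<tau> x))\<^sup>2 + 1"
  by (simp_all add: cosh_square_eq)

lemma S_C: "(S x)\<^sup>2 + (C x)\<^sup>2 = 1" "C x > 0" "C x \<le> 1" "S x = sinh (\<tau> x) * C x"
proof -
  show "(S x)\<^sup>2 + (C x)\<^sup>2 = 1"
  proof -
    have "(S x)\<^sup>2 + (C x)\<^sup>2 = ((sinh (\<tau> x))\<^sup>2 + 1) / (cosh (\<tau> x))\<^sup>2"
      by (simp add: S_def C_def tanh_def power_divide add_divide_distrib)
    then show ?thesis unfolding sinh_cosh(2)[symmetric] using sinh_cosh(1)[of x] by simp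
  qed
  show "C x > 0" "C x \<le> 1" "S x = sinh (\<tau> x) * C x"
    using sinh_cosh(1)[of x] cosh_real_ge_1[of "\<tau> x"] by (auto simp: C_def S_def tanh_def)
qed

lemma sin_\<phi>: "sin (\<phi> x) = S x" and cos_\<phi>: "cos (\<phi> x) = C x"
proof -
  have "sqrt (1 + (sinh (\<tau> x))\<^sup>2) = cosh (\<tau> x)"
    using sinh_cosh[of x] by (simp add: add.commute real_sqrt_unique)
  then show "sin (\<phi> x) = S x" "cos (\<phi> x) = C x"
    by (simp_all add: \<phi>_def S_def C_def sin_arctan cos_arctan tanh_def)
qed

lemma abs_S_le: "\<bar>S x\<bar> \<le> 1"
  using S_C(1)[of x] by (metis abs_square_le_1 le_add_same_cancel1 zero_le_power2)

lemma slope: "a\<^sub>0 / A\<^sub>0 \<le> q x / a x" "q x / a x \<le> A\<^sub>0 / a\<^sub>0" "0 < q x / a x"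
proof -
  show "a\<^sub>0 / A\<^sub>0 \<le> q x / a x"
    by (rule frac_le) (use a_le[of x] q_ge[of x] a_pos[of x] q_pos[of x] in auto)
  show "q x / a x \<le> A\<^sub>0 / a\<^sub>0"
    by (rule frac_le) (use q_le[of x] a_ge[of x] a0_pos A0_pos in auto)
  show "0 < q x / a x" using a_pos[of x] q_pos[of x] by simp
qed

text \<open>Since \<open>q / a\<close> lies between positive constants, \<open>\<tau>\<close> is
  bi-Lipschitz; the limits at infinity and the estimates near \<open>0\<close> both come from
  this.\<close>

lemma \<tau>_increment:
  assumes "x \<le> y"
  shows "a\<^sub>0 / A\<^sub>0 * (y - x) \<le> \<tau> y - \<tau> x" "\<tau> y - \<tau> x \<le> A\<^sub>0 / a\<^sub>0 * (y - x)"
proof -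
  note i = primitive_onD[OF \<tau>_primitive order_refl assms order_refl]
  have c: "((\<lambda>x. c) has_integral (c * (y - x))) {x..y}" for c :: real
    using has_integral_const_real[of c x y] assms by (simp add: mult.commute)
  show "a\<^sub>0 / A\<^sub>0 * (y - x) \<le> \<tau> y - \<tau> x" by (rule has_integral_le[OF c i]) (rule slope)
  show "\<tau> y - \<tau> x \<le> A\<^sub>0 / a\<^sub>0 * (y - x)" by (rule has_integral_le[OF i c]) (rule slope)
qed

lemma \<tau>_strict_mono: "x < y \<Longrightarrow> \<tau> x < \<tau> y"
  using \<tau>_increment(1)[of x y] a0_pos A0_pos by (smt (verit) divide_pos_pos mult_pos_pos)

lemma \<tau>_abs: "a\<^sub>0 / A\<^sub>0 * \<bar>x\<bar> \<le> \<bar>\<tau> x\<bar>" "\<bar>\<tau> x\<bar> \<le> A\<^sub>0 / a\<^sub>0 * \<bar>x\<bar>"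
proof -
  have "0 < a\<^sub>0 / A\<^sub>0" using a0_pos A0_pos by simp
  show "a\<^sub>0 / A\<^sub>0 * \<bar>x\<bar> \<le> \<bar>\<tau> x\<bar>" "\<bar>\<tau> x\<bar> \<le> A\<^sub>0 / a\<^sub>0 * \<bar>x\<bar>"
    using \<tau>_increment[of 0 x] \<tau>_increment[of x 0] \<tau>_0 \<tau>_strict_mono[of 0 x] \<tau>_strict_mono[of x 0]
    by (cases x "0::real" rule: linorder_cases; simp add: abs_if)+
qed

lemma \<tau>_nonzero: "x \<noteq> 0 \<Longrightarrow> \<tau> x \<noteq> 0"
  using \<tau>_strict_mono[of 0 x] \<tau>_strict_mono[of x 0] \<tau>_0 by (cases x "0::real" rule: linorder_cases) auto

lemma \<tau>_at_top: "filterlim \<tau> at_top at_top"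
proof (rule filterlim_at_top_mono)
  show "filterlim (\<lambda>x. a\<^sub>0 / A\<^sub>0 * x) at_top at_top"
    using a0_pos A0_pos by (intro filterlim_tendsto_pos_mult_at_top[OF tendsto_const _ filterlim_ident]) auto
  show "eventually (\<lambda>x. a\<^sub>0 / A\<^sub>0 * x \<le> \<tau> x) at_top"
    using eventually_ge_at_top[of 0] by eventually_elim (use \<tau>_increment(1)[of 0] \<tau>_0 in fastforce)
qed

lemma \<tau>_at_bot: "filterlim \<tau> at_bot at_bot"
  unfolding filterlim_at_bot
proof
  fix Z :: real
  show "eventually (\<lambda>x. \<tau> x \<le> Z) at_bot"
    using eventually_le_at_bot[of "min 0 (Z * A\<^sub>0 / a\<^sub>0)"]
  proof eventually_elim
    fix x assume x: "x \<le> min 0 (Z * A\<^sub>0 / a\<^sub>0)"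
    have "\<tau> x \<le> a\<^sub>0 / A\<^sub>0 * x" using \<tau>_increment(1)[of x 0] x \<tau>_0 by simp
    also have "\<dots> \<le> a\<^sub>0 / A\<^sub>0 * (Z * A\<^sub>0 / a\<^sub>0)" using x a0_pos A0_pos by (intro mult_left_mono) auto
    also have "\<dots> = Z" using a0_pos A0_pos by simp
    finally show "\<tau> x \<le> Z" .
  qed
qed

lemma S_limits: "(S \<longlongrightarrow> 1) at_top" "(S \<longlongrightarrow> - 1) at_bot"
  unfolding S_def[abs_def]
  by (rule filterlim_compose[OF tanh_real_at_top \<tau>_at_top] filterlim_compose[OF tanh_real_at_bot \<tau>_at_bot])+

lemma \<phi>_limits: "(\<phi> \<longlongrightarrow> pi / 2) at_top" "(\<phi> \<longlongrightarrow> - (pi / 2)) at_bot"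
proof -
  show "(\<phi> \<longlongrightarrow> pi / 2) at_top" unfolding \<phi>_def[abs_def]
    by (rule filterlim_compose[OF tendsto_arctan_at_top filterlim_compose[OF sinh_real_at_top \<tau>_at_top]])
  show "(\<phi> \<longlongrightarrow> - (pi / 2)) at_bot" unfolding \<phi>_def[abs_def]
    by (rule filterlim_compose[OF tendsto_arctan_at_bot filterlim_compose[OF sinh_real_at_bot \<tau>_at_bot]])
qed

lemma \<phi>_strict_mono: "strict_mono \<phi>"
  by (rule strict_monoI) (simp add: \<phi>_def arctan_less_iff \<tau>_strict_mono)

lemma \<phi>_0: "\<phi> 0 = 0" by (simp add: \<phi>_def \<tau>_0)

lemma \<phi>_primitive: "primitive_on u v \<phi> (\<lambda>x. C x * q x / a x)"
proof -
  have "primitive_on u v (\<lambda>x. arctan (sinh (\<tau> x))) (\<lambda>x. (1 / cosh (\<tau> x)) * (q x / a x))"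
  proof (rule primitive_on_chain[OF \<tau>_primitive, where H = "\<lambda>y. arctan (sinh y)" and H' = "\<lambda>y. 1 / cosh y"])
    fix y :: real
    have "((\<lambda>y. arctan (sinh y)) has_real_derivative inverse (1 + (sinh y)\<^sup>2) * cosh y) (at y)"
      by (rule DERIV_chain2[OF DERIV_arctan]) (auto intro!: derivative_eq_intros)
    moreover have "1 + (sinh y)\<^sup>2 = (cosh y)\<^sup>2" by (simp add: cosh_square_eq)
    then have "inverse (1 + (sinh y)\<^sup>2) * cosh y = 1 / cosh y" by (simp add: power2_eq_square field_simps)
    ultimately show "((\<lambda>y. arctan (sinh y)) has_real_derivative 1 / cosh y) (at y)" by simp
  qed (intro continuous_intros; simp)
  then show ?thesis by (simp add: \<phi>_def[abs_def] C_def)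
qed

lemma S_primitive: "primitive_on u v S (\<lambda>x. (C x)\<^sup>2 * q x / a x)"
proof -
  have "primitive_on u v (\<lambda>x. tanh (\<tau> x)) (\<lambda>x. (1 - (tanh (\<tau> x))\<^sup>2) * (q x / a x))"
    by (rule primitive_on_chain[OF \<tau>_primitive, where H = tanh and H' = "\<lambda>y. 1 - (tanh y)\<^sup>2"])
      (auto intro!: derivative_eq_intros continuous_intros)
  moreover have "1 - (tanh (\<tau> x))\<^sup>2 = (C x)\<^sup>2" for x using S_C(1)[of x] by (simp add: S_def)
  ultimately show ?thesis by (simp add: S_def[abs_def])
qed

lemma C_primitive: "primitive_on u v C (\<lambda>x. - (S x * C x * q x / a x))"
proof -
  have "primitive_on u v (\<lambda>x. 1 / cosh (\<tau> x)) (\<lambda>x. - (sinh (\<tau> x) / (cosh (\<tau> x))\<^sup>2) * (q x / a x))"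
  proof (rule primitive_on_chain[OF \<tau>_primitive, where H = "\<lambda>y. 1 / cosh y" and H' = "\<lambda>y. - (sinh y / (cosh y)\<^sup>2)"])
    show "((\<lambda>y. 1 / cosh y) has_real_derivative - (sinh y / (cosh y)\<^sup>2)) (at y)" for y :: real
      by (auto intro!: derivative_eq_intros simp: power2_eq_square)
  qed (intro continuous_intros; simp)
  moreover have "- (sinh (\<tau> x) / (cosh (\<tau> x))\<^sup>2) * (q x / a x) = - (S x * C x * q x / a x)" for x
    by (simp add: S_def C_def tanh_def power2_eq_square)
  ultimately show ?thesis by (simp add: C_def[abs_def])
qed

lemma M_primitive: "primitive_on u v M dM"
proof -
  have "primitive_on u v M (\<lambda>x. ((C x)\<^sup>2 * q x / a x) *\<^sub>R e1 + (- (S x * C x * q x / a x)) *\<^sub>R e2)"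
    unfolding M_def[abs_def]
    by (intro primitive_on_add primitive_on_linear[OF S_primitive] primitive_on_linear[OF C_primitive]
        bounded_linear_scaleR_left)
  moreover have "((C x)\<^sup>2 * q x / a x) *\<^sub>R e1 + (- (S x * C x * q x / a x)) *\<^sub>R e2 = dM x" for x
    by (simp add: dM_def vec3_eq_iff power2_eq_square)
  ultimately show ?thesis by simp
qed

lemma M_components: "M x $ 1 = S x" "M x $ 2 = C x" "M x $ 3 = 0"
  by (simp_all add: M_def)

lemma M_eq: "M = (\<lambda>x. vector [sin (\<phi> x), cos (\<phi> x), 0])"
  by (rule ext) (simp add: vec3_eq_iff M_components sin_\<phi> cos_\<phi>)

lemma norm_M: "norm (M x) = 1"
proof -
  have "(norm (M x))\<^sup>2 = 1" using S_C(1)[of x] by (simp add: norm_vec3 M_components)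
  then show ?thesis by (simp add: power2_eq_1_iff) (metis norm_ge_zero not_one_le_zero neg_0_le_iff_le power2_eq_1_iff)
qed

lemma norm_dM: "(norm (dM x))\<^sup>2 = (C x * q x / a x)\<^sup>2"
proof -
  have "(norm (dM x))\<^sup>2 = (C x * q x / a x)\<^sup>2 * ((S x)\<^sup>2 + (C x)\<^sup>2)"
    unfolding norm_vec3 dM_def by (simp add: power2_eq_square algebra_simps add_divide_distrib)
  then show ?thesis using S_C(1)[of x] by simp
qed

lemma \<tau>_continuous: "continuous_on A \<tau>"
  by (rule primitive_continuous[OF \<tau>_primitive])

lemma C_continuous: "continuous_on A C" and S_continuous: "continuous_on A S" and M_continuous: "continuous_on A M"
proof -
  show C: "continuous_on A C" unfolding C_def[abs_def]
    by (intro continuous_intros \<tau>_continuous) simp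
  show S: "continuous_on A S" unfolding S_def[abs_def]
    by (intro continuous_intros \<tau>_continuous) simp
  show "continuous_on A M" unfolding M_def[abs_def] by (intro continuous_intros C S)
qed

lemma C_measurable [measurable]: "C \<in> borel_measurable lebesgue"
  and S_measurable [measurable]: "S \<in> borel_measurable lebesgue"
  by (intro continuous_measurable_lebesgue C_continuous S_continuous)+

lemmas [measurable] = a_measurable q_measurable

lemma dM_measurable [measurable]: "dM \<in> borel_measurable lebesgue"
  unfolding dM_def[abs_def] by measurable

text \<open>\<open>C\<^sup>2 q / a\<close> is the derivative of the bounded function
  \<open>S\<close>, hence integrable, and \<open>q / a \<ge> a\<^sub>0 / A\<^sub>0\<close>.
  Finiteness of the energy of the profile rests on this.\<close>

lemma integrable_C2: "integrable lebesgue (\<lambda>x. (C x)\<^sup>2)"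
proof -
  have 1: "integrable lebesgue (\<lambda>x. (C x)\<^sup>2 * q x / a x)"
  proof (rule integrable_of_bounded_primitive[OF S_primitive, where B = 1])
    show "0 \<le> (C x)\<^sup>2 * q x / a x" for x using q_pos[of x] a_pos[of x] by simp
  qed (use abs_S_le in auto)
  show ?thesis
  proof (rule Bochner_Integration.integrable_bound[OF integrable_mult_right[OF 1, of "A\<^sub>0 / a\<^sub>0"]])
    show "AE x in lebesgue. norm ((C x)\<^sup>2) \<le> norm (A\<^sub>0 / a\<^sub>0 * ((C x)\<^sup>2 * q x / a x))"
    proof (rule AE_I2)
      fix x
      have "1 \<le> A\<^sub>0 / a\<^sub>0 * (q x / a x)"
        using mult_left_mono[OF slope(1)[of x], of "A\<^sub>0 / a\<^sub>0"] a0_pos A0_pos by simp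
      then have "(C x)\<^sup>2 * 1 \<le> (C x)\<^sup>2 * (A\<^sub>0 / a\<^sub>0 * (q x / a x))" by (rule mult_left_mono) simp
      also have "\<dots> = A\<^sub>0 / a\<^sub>0 * ((C x)\<^sup>2 * q x / a x)" by simp
      finally show "norm ((C x)\<^sup>2) \<le> norm (A\<^sub>0 / a\<^sub>0 * ((C x)\<^sup>2 * q x / a x))"
        unfolding real_norm_def abs_power2 mult_1_right by (rule order_trans[OF _ abs_ge_self])
    qed
  qed measurable
qed

end

subsection \<open>Calibration and minimality\<close>

text \<open>Here \<open>c = cos \<phi>\<close> and \<open>d = n'\<close>, and the term with factor
  \<open>- 2\<close> is the product-rule derivative of \<open>a r (n\<^sub>2 - c)\<close>, given
  \<open>(a r)' = - a (1 + r\<^sup>2) c\<close> and \<open>c' = - r (1 - c\<^sup>2)\<close>. Keeping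
  only the lower bound \<open>a\<^sub>0\<close> in front of the remainder makes it continuous in
  \<open>x\<close>, which uniqueness exploits.\<close>

lemma calibration_inequality:
  fixes d1 d2 d3 n1 n2 n3 a a\<^sub>0 r c :: real
  assumes a: "0 < a\<^sub>0" "a\<^sub>0 \<le> a" and unit: "n1\<^sup>2 + n2\<^sup>2 + n3\<^sup>2 = 1" and orth: "n1 * d1 + n2 * d2 + n3 * d3 = 0"
  shows "a * (r\<^sup>2 * (1 - c\<^sup>2) + c\<^sup>2) + a\<^sub>0 * ((n2 - c)\<^sup>2 + n3\<^sup>2)
      + (- 2) * (a * r * (d2 + r * (1 - c\<^sup>2)) + (- a * (1 + r\<^sup>2) * c) * (n2 - c))
    \<le> a * (d1\<^sup>2 + d2\<^sup>2 + d3\<^sup>2) + a * (n2\<^sup>2 + n3\<^sup>2)"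
proof -
  \<comment> \<open>The squared length of \<open>n' + r (e\<^sub>2 - n\<^sub>2 n)\<close>;
    simplifying its expansion consumes both constraints on \<open>n\<close>.\<close>
  define sos where "sos = (d1 - r * n2 * n1)\<^sup>2 + (d2 + r * (1 - n2\<^sup>2))\<^sup>2 + (d3 - r * n2 * n3)\<^sup>2"
  have "sos = d1\<^sup>2 + d2\<^sup>2 + d3\<^sup>2 - 2 * r * n2 * (n1 * d1 + n2 * d2 + n3 * d3) + 2 * r * d2
      + r\<^sup>2 * (n2\<^sup>2 * (n1\<^sup>2 + n2\<^sup>2 + n3\<^sup>2) - 2 * n2\<^sup>2 + 1)"
    unfolding sos_def by algebra
  then have sos: "sos = d1\<^sup>2 + d2\<^sup>2 + d3\<^sup>2 + 2 * r * d2 + r\<^sup>2 * (1 - n2\<^sup>2)"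
    unfolding unit orth by simp
  have "a * (d1\<^sup>2 + d2\<^sup>2 + d3\<^sup>2) + a * (n2\<^sup>2 + n3\<^sup>2) - (a * (r\<^sup>2 * (1 - c\<^sup>2) + c\<^sup>2)
      + (- 2) * (a * r * (d2 + r * (1 - c\<^sup>2)) + (- a * (1 + r\<^sup>2) * c) * (n2 - c)))
    = a * sos + a * (1 + r\<^sup>2) * (n2 - c)\<^sup>2 + a * n3\<^sup>2"
    unfolding sos by algebra
  moreover have "0 \<le> a * sos" unfolding sos_def using a by (intro mult_nonneg_nonneg add_nonneg_nonneg) auto
  moreover have "a\<^sub>0 * (n2 - c)\<^sup>2 \<le> a * (1 + r\<^sup>2) * (n2 - c)\<^sup>2"
  proof (rule mult_right_mono)
    have "a * 1 \<le> a * (1 + r\<^sup>2)" using a by (intro mult_left_mono) auto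
    then show "a\<^sub>0 \<le> a * (1 + r\<^sup>2)" using a by linarith
  qed simp
  moreover have "a\<^sub>0 * n3\<^sup>2 \<le> a * n3\<^sup>2" using a by (intro mult_right_mono) auto
  moreover have "a\<^sub>0 * ((n2 - c)\<^sup>2 + n3\<^sup>2) = a\<^sub>0 * (n2 - c)\<^sup>2 + a\<^sub>0 * n3\<^sup>2" by (rule distrib_left)
  ultimately show ?thesis by linarith
qed

lemma abs_integrable_bounded_mult:
  fixes f :: "real \<Rightarrow> real"
  assumes "f \<in> borel_measurable lebesgue" "\<And>x. \<bar>f x\<bar> \<le> B" "g absolutely_integrable_on {u..v}"
  shows "(\<lambda>x. f x * g x) absolutely_integrable_on {u..v}"
proof (rule absolutely_integrable_bounded_measurable_product_real)
  show "f \<in> borel_measurable (lebesgue_on {u..v})" using assms(1) by (rule measurable_restrict_space1)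
  show "bounded (f ` {u..v})" using assms(2) by (intro boundedI[of _ B]) auto
qed (use assms in auto)

text \<open>A constant inner product has two derivatives, zero and the one from the product rule,
  and they agree almost everywhere.\<close>

lemma primitive_on_orthogonal_AE:
  fixes n n' :: "real \<Rightarrow> 'a::euclidean_space"
  assumes n: "primitive_on u v n n'" and m: "primitive_on u v m m'"
    and eq: "\<And>x. u \<le> x \<Longrightarrow> x \<le> v \<Longrightarrow> n x \<bullet> m x = c"
  shows "AE x in lebesgue. u \<le> x \<and> x \<le> v \<longrightarrow> n x \<bullet> m' x + n' x \<bullet> m x = 0"
proof -
  have "primitive_on u v (\<lambda>x. n x \<bullet> m x) (\<lambda>x. n x \<bullet> m' x + n' x \<bullet> m x)"
    by (rule primitive_on_bilinear[OF bounded_bilinear_inner n m])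
  then have "primitive_on u v (\<lambda>x. c) (\<lambda>x. n x \<bullet> m' x + n' x \<bullet> m x)"
    by (rule primitive_on_cong) (use eq in auto)
  from primitive_on_unique_AE[OF this primitive_on_const] show ?thesis .
qed

lemma abs_le_abs_sinh: "\<bar>y\<bar> \<le> \<bar>sinh (y::real)\<bar>"
proof -
  have *: "y \<le> sinh y" if "y \<ge> 0" for y :: real
  proof -
    have "sinh 0 - 0 \<le> sinh y - y"
    proof (rule DERIV_nonneg_imp_nondecreasing[OF that])
      fix x :: real
      show "\<exists>z. ((\<lambda>y. sinh y - y) has_real_derivative z) (at x) \<and> 0 \<le> z"
        using cosh_real_ge_1[of x] by (intro exI[of _ "cosh x - 1"]) (auto intro!: derivative_eq_intros)
    qed
    then show ?thesis by simp
  qed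
  show ?thesis using *[of y] *[of "- y"] by (cases "y \<ge> 0") auto
qed

text \<open>The integral of \<open>(g - c)\<^sup>2\<close> is non-negative when \<open>c\<close> is
  the mean of \<open>g\<close>.\<close>

lemma cauchy_schwarz_interval:
  fixes g :: "real \<Rightarrow> real"
  assumes uv: "u \<le> v" and g: "g integrable_on {u..v}" and g2: "(\<lambda>x. (g x)\<^sup>2) integrable_on {u..v}"
  shows "(integral {u..v} g)\<^sup>2 \<le> (v - u) * integral {u..v} (\<lambda>x. (g x)\<^sup>2)"
proof (cases "u = v")
  case False
  define c where "c = integral {u..v} g / (v - u)"
  have "((\<lambda>x. (g x)\<^sup>2 - 2 * c * g x + c\<^sup>2) has_integral
     (integral {u..v} (\<lambda>x. (g x)\<^sup>2) - 2 * c * integral {u..v} g + c\<^sup>2 * (v - u))) {u..v}"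
    using has_integral_const_real[of "c\<^sup>2" u v] uv
    by (intro has_integral_add has_integral_diff has_integral_mult_right integrable_integral g g2) (simp add: mult.commute)
  then have "0 \<le> integral {u..v} (\<lambda>x. (g x)\<^sup>2) - 2 * c * integral {u..v} g + c\<^sup>2 * (v - u)"
    by (rule has_integral_nonneg) (use zero_le_power2[of "g _ - c"] in \<open>auto simp: power2_diff algebra_simps\<close>)
  then have "0 \<le> (v - u) * (integral {u..v} (\<lambda>x. (g x)\<^sup>2) - 2 * c * integral {u..v} g + c\<^sup>2 * (v - u))"
    using uv by simp
  also have "\<dots> = (v - u) * integral {u..v} (\<lambda>x. (g x)\<^sup>2) - 2 * (c * (v - u)) * integral {u..v} g + (c * (v - u))\<^sup>2"
    by algebra
  also have "c * (v - u) = integral {u..v} g" using False by (simp add: c_def)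
  also have "(v - u) * integral {u..v} (\<lambda>x. (g x)\<^sup>2) - 2 * integral {u..v} g * integral {u..v} g + (integral {u..v} g)\<^sup>2
      = (v - u) * integral {u..v} (\<lambda>x. (g x)\<^sup>2) - (integral {u..v} g)\<^sup>2" by (simp add: power2_eq_square)
  finally show ?thesis by simp
qed (use assms in auto)

section \<open>Calibration of a competitor against the profile, and its boundary terms\<close>

context wall
begin

text \<open>
  \<open>dens\<close> is the energy density of \<open>M\<close>, and equals the Lagrange multiplier. Up to the derivative of
  \<open>boundary_term n\<close>, the energy density of a competitor \<open>n\<close> is at least \<open>dens + gap n\<close>.
\<close>

definition dens :: "real \<Rightarrow> real" where "dens x = a x * ((C x * q x / a x)\<^sup>2 + (C x)\<^sup>2)"

definition gap :: "(real \<Rightarrow> real^3) \<Rightarrow> real \<Rightarrow> real" where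
  "gap n x = a\<^sub>0 * ((n x $ 2 - C x)\<^sup>2 + (n x $ 3)\<^sup>2)"

definition boundary_term :: "(real \<Rightarrow> real^3) \<Rightarrow> real \<Rightarrow> real" where
  "boundary_term n x = - 2 * (q x * (1 / sinh (\<tau> x)) * (n x $ 2 - C x))"

lemma sinh_\<tau>_nonzero: "x \<noteq> 0 \<Longrightarrow> sinh (\<tau> x) \<noteq> 0"
  using \<tau>_nonzero by simp

lemma dens_bounds: "0 \<le> dens x" "dens x \<le> A\<^sub>0 * ((A\<^sub>0 / a\<^sub>0)\<^sup>2 + 1) * (C x)\<^sup>2"
proof -
  show "0 \<le> dens x" unfolding dens_def using a_pos[of x] by simp
  have "(q x / a x)\<^sup>2 \<le> (A\<^sub>0 / a\<^sub>0)\<^sup>2" using slope[of x] by (intro power_mono) auto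
  then have "(C x)\<^sup>2 * ((q x / a x)\<^sup>2 + 1) \<le> (C x)\<^sup>2 * ((A\<^sub>0 / a\<^sub>0)\<^sup>2 + 1)" by (intro mult_left_mono) auto
  then have "a x * ((C x)\<^sup>2 * ((q x / a x)\<^sup>2 + 1)) \<le> A\<^sub>0 * ((C x)\<^sup>2 * ((A\<^sub>0 / a\<^sub>0)\<^sup>2 + 1))"
    by (rule mult_mono[OF a_le]) (use A0_pos in auto)
  moreover have "dens x = a x * ((C x)\<^sup>2 * ((q x / a x)\<^sup>2 + 1))"
    by (simp add: dens_def power_mult_distrib power_divide algebra_simps)
  ultimately show "dens x \<le> A\<^sub>0 * ((A\<^sub>0 / a\<^sub>0)\<^sup>2 + 1) * (C x)\<^sup>2" by (simp add: algebra_simps)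
qed

lemma dens_measurable [measurable]: "dens \<in> borel_measurable lebesgue"
  unfolding dens_def[abs_def] by measurable

lemma integrable_dens: "integrable lebesgue dens"
proof (rule Bochner_Integration.integrable_bound[OF integrable_mult_right[OF integrable_C2, of "A\<^sub>0 * ((A\<^sub>0 / a\<^sub>0)\<^sup>2 + 1)"]])
  show "AE x in lebesgue. norm (dens x) \<le> norm (A\<^sub>0 * ((A\<^sub>0 / a\<^sub>0)\<^sup>2 + 1) * (C x)\<^sup>2)"
  proof (rule AE_I2)
    fix x show "norm (dens x) \<le> norm (A\<^sub>0 * ((A\<^sub>0 / a\<^sub>0)\<^sup>2 + 1) * (C x)\<^sup>2)"
      unfolding real_norm_def using dens_bounds[of x] by linarith
  qed
qed measurable

text \<open>The singular factor \<open>\<kappa> = a \<phi>' / sin \<phi>\<close> satisfies the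
  Riccati equation \<open>\<kappa>' = - (a + \<kappa>\<^sup>2 / a) cos \<phi>\<close>. This is what
  makes the cross terms of the calibration an exact derivative.\<close>

lemma kappa_primitive:
  assumes 0: "0 \<notin> {u..v}"
  shows "primitive_on u v (\<lambda>x. q x * (1 / sinh (\<tau> x)))
    (\<lambda>x. - a x * (1 + (q x / (a x * sinh (\<tau> x)))\<^sup>2) * C x)"
proof -
  have s: "sinh (\<tau> x) \<noteq> 0" if "u \<le> x" "x \<le> v" for x
    by (rule sinh_\<tau>_nonzero) (use 0 that in auto)
  have "primitive_on u v (\<lambda>x. 1 / sinh (\<tau> x)) (\<lambda>x. - (cosh (\<tau> x) / (sinh (\<tau> x))\<^sup>2) * (q x / a x))"
  proof (rule primitive_on_chain[OF \<tau>_primitive, where H = "\<lambda>y. 1 / sinh y" and H' = "\<lambda>y. - (cosh y / (sinh y)\<^sup>2)"])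
    fix x assume "u \<le> x" "x \<le> v"
    then show "((\<lambda>y. 1 / sinh y) has_real_derivative - (cosh (\<tau> x) / (sinh (\<tau> x))\<^sup>2)) (at (\<tau> x))"
      using s by (auto intro!: derivative_eq_intros simp: power2_eq_square)
  next
    show "continuous_on (\<tau> ` {u..v}) (\<lambda>y. - (cosh y / (sinh y)\<^sup>2))"
      by (intro continuous_intros) (use s in auto)
  qed
  from primitive_on_bilinear[OF bounded_bilinear_mult q_primitive[OF 0] this]
  show ?thesis
  proof (rule primitive_on_cong)
    show "AE x in lebesgue. u \<le> x \<and> x \<le> v \<longrightarrow>
      q x * (- (cosh (\<tau> x) / (sinh (\<tau> x))\<^sup>2) * (q x / a x)) + ((q x)\<^sup>2 / a x - a x) * tanh (\<tau> x) * (1 / sinh (\<tau> x))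
      = - a x * (1 + (q x / (a x * sinh (\<tau> x)))\<^sup>2) * C x"
    proof (rule AE_I2, rule impI)
      fix x assume x: "u \<le> x \<and> x \<le> v"
      \<comment> \<open>\<open>k\<close> is \<open>\<kappa>\<^sup>2 / a\<close>; in terms of it
        every summand of the product rule is polynomial in \<open>k\<close>, \<open>a\<close>,
        \<open>c\<close> and \<open>1/c\<close>.\<close>
      define k where "k = (q x)\<^sup>2 / (a x * (sinh (\<tau> x))\<^sup>2)"
      define c where "c = cosh (\<tau> x)"
      have sx: "sinh (\<tau> x) \<noteq> 0" using s x by blast
      have c: "c > 0" "c\<^sup>2 = (sinh (\<tau> x))\<^sup>2 + 1" using sinh_cosh[of x] by (auto simp: c_def)
      have k1: "(q x)\<^sup>2 / a x = k * (sinh (\<tau> x))\<^sup>2" unfolding k_def using sx by simp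
      have k2: "a x * (q x / (a x * sinh (\<tau> x)))\<^sup>2 = k" unfolding k_def using a_pos[of x]
        by (simp add: power_divide power_mult_distrib power2_eq_square)
      have k3: "q x * (- (c / (sinh (\<tau> x))\<^sup>2) * (q x / a x)) = - k * c" unfolding k_def
        by (simp add: power2_eq_square mult_ac)
      have "tanh (\<tau> x) * (1 / sinh (\<tau> x)) = 1 / c" using sx by (simp add: tanh_def c_def)
      then have "q x * (- (c / (sinh (\<tau> x))\<^sup>2) * (q x / a x)) + ((q x)\<^sup>2 / a x - a x) * tanh (\<tau> x) * (1 / sinh (\<tau> x))
        = - k * c + (k * (c\<^sup>2 - 1) - a x) * (1 / c)"
        unfolding k3 k1 c(2) mult.assoc by simp
      also have "\<dots> = - (a x + k) * (1 / c)" using c(1) by (simp add: field_simps power2_eq_square)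
      also have "\<dots> = - a x * (1 + (q x / (a x * sinh (\<tau> x)))\<^sup>2) * C x"
        unfolding k2[symmetric] by (simp add: C_def c_def algebra_simps)
      finally show "q x * (- (cosh (\<tau> x) / (sinh (\<tau> x))\<^sup>2) * (q x / a x)) + ((q x)\<^sup>2 / a x - a x) * tanh (\<tau> x) * (1 / sinh (\<tau> x))
      = - a x * (1 + (q x / (a x * sinh (\<tau> x)))\<^sup>2) * C x" unfolding c_def .
    qed
  qed auto
qed

text \<open>The pointwise inequality is available almost everywhere, because
  \<open>n \<bullet> n' = 0\<close> follows from \<open>\<bar>n\<bar> = 1\<close> only there. The
  interval avoids \<open>0\<close>, where the boundary term is singular.\<close>

lemma calibration:
  assumes n: "primitive_on u v n n'" and unit: "\<And>x. norm (n x) = 1" and 0: "0 \<notin> {u..v}" and uv: "u \<le> v"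
    and L2: "(\<lambda>x. (norm (n' x))\<^sup>2) absolutely_integrable_on {u..v}"
  defines "e \<equiv> \<lambda>x. a x * (norm (n' x))\<^sup>2 + a x * ((n x $ 2)\<^sup>2 + (n x $ 3)\<^sup>2)"
  shows "(\<lambda>x. dens x + gap n x) absolutely_integrable_on {u..v}" "e absolutely_integrable_on {u..v}"
    "integral {u..v} (\<lambda>x. dens x + gap n x) + (boundary_term n v - boundary_term n u) \<le> integral {u..v} e"
proof -
  define r where "r x = q x / (a x * sinh (\<tau> x))" for x
  have nc: "continuous_on {u..v} n" by (rule primitive_on_continuous[OF n])
  have gc: "continuous_on {u..v} (gap n)" unfolding gap_def
    by (intro continuous_intros C_continuous continuous_on_component nc)
  show DI: "(\<lambda>x. dens x + gap n x) absolutely_integrable_on {u..v}"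
  proof (intro set_integral_add(1))
    show "dens absolutely_integrable_on {u..v}"
      using integrable_dens unfolding set_integrable_def by (intro integrable_mult_indicator) auto
    show "gap n absolutely_integrable_on {u..v}" by (rule absolutely_integrable_continuous_real[OF gc])
  qed
  have ab: "\<bar>a x\<bar> \<le> A\<^sub>0" for x using a_pos[of x] a_le[of x] by simp
  show EI: "e absolutely_integrable_on {u..v}"
    unfolding e_def
    by (intro set_integral_add(1) abs_integrable_bounded_mult[OF a_measurable ab] L2
        absolutely_integrable_continuous_real continuous_intros continuous_on_component nc)
  have p2: "primitive_on u v (\<lambda>x. n x $ 2 - C x) (\<lambda>x. n' x $ 2 - - (S x * C x * q x / a x))"
    by (intro primitive_on_diff C_primitive primitive_on_linear[OF n] bounded_linear_vec_nth)
  define B' where "B' x = - 2 * (q x * (1 / sinh (\<tau> x)) * (n' x $ 2 - - (S x * C x * q x / a x))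
      + (- a x * (1 + (q x / (a x * sinh (\<tau> x)))\<^sup>2) * C x) * (n x $ 2 - C x))" for x
  have pB: "primitive_on u v (boundary_term n) B'"
    unfolding boundary_term_def[abs_def] B'_def[abs_def]
    by (rule primitive_on_linear[OF primitive_on_bilinear[OF bounded_bilinear_mult kappa_primitive[OF 0] p2]])
      (rule bounded_linear_mult_right)
  have orth: "AE x in lebesgue. u \<le> x \<and> x \<le> v \<longrightarrow> n x \<bullet> n' x = 0"
  proof -
    have "n x \<bullet> n x = 1" for x using unit[of x] by (simp add: dot_square_norm)
    from primitive_on_orthogonal_AE[OF n n this]
    show ?thesis by eventually_elim (auto simp: inner_commute)
  qed
  have B'I: "B' absolutely_integrable_on {u..v}" by (rule primitive_on_abs_integrable[OF pB])
  have "(LINT x:{u..v}|lebesgue. (dens x + gap n x) + B' x) \<le> (LINT x:{u..v}|lebesgue. e x)"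
  proof (rule set_integral_mono_AE)
    show "set_integrable lebesgue {u..v} (\<lambda>x. dens x + gap n x + B' x)" by (intro set_integral_add(1) DI B'I)
    show "set_integrable lebesgue {u..v} e" by (rule EI)
    show "AE x\<in>{u..v} in lebesgue. dens x + gap n x + B' x \<le> e x"
      using orth
    proof eventually_elim
      case (elim x)
      show ?case
      proof
        assume x: "x \<in> {u..v}"
        have sx: "sinh (\<tau> x) \<noteq> 0" by (rule sinh_\<tau>_nonzero) (use x 0 in auto)
        have or: "n x $ 1 * n' x $ 1 + n x $ 2 * n' x $ 2 + n x $ 3 * n' x $ 3 = 0"
          using elim x by (simp add: inner_vec3)
        have un: "(n x $ 1)\<^sup>2 + (n x $ 2)\<^sup>2 + (n x $ 3)\<^sup>2 = 1"
          using unit[of x] norm_vec3[of "n x"] by simp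
        have S2: "1 - (C x)\<^sup>2 = (S x)\<^sup>2" using S_C(1)[of x] by simp
        have e1: "q x * (1 / sinh (\<tau> x)) = a x * r x" using a_pos[of x] by (simp add: r_def)
        have e2: "n' x $ 2 - - (S x * C x * q x / a x) = n' x $ 2 + r x * (1 - (C x)\<^sup>2)"
          unfolding S2 S_C(4) r_def using sx by (simp add: power2_eq_square)
        have e3: "dens x = a x * ((r x)\<^sup>2 * (1 - (C x)\<^sup>2) + (C x)\<^sup>2)"
          unfolding S2 S_C(4) r_def dens_def using sx by (simp add: power_mult_distrib power_divide)
        have "dens x + gap n x + B' x =
          a x * ((r x)\<^sup>2 * (1 - (C x)\<^sup>2) + (C x)\<^sup>2) + a\<^sub>0 * ((n x $ 2 - C x)\<^sup>2 + (n x $ 3)\<^sup>2)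
          + (- 2) * (a x * r x * (n' x $ 2 + r x * (1 - (C x)\<^sup>2)) + (- a x * (1 + (r x)\<^sup>2) * C x) * (n x $ 2 - C x))"
          unfolding B'_def e1 e2 e3 gap_def unfolding r_def ..
        also have "\<dots> \<le> a x * ((n' x $ 1)\<^sup>2 + (n' x $ 2)\<^sup>2 + (n' x $ 3)\<^sup>2) + a x * ((n x $ 2)\<^sup>2 + (n x $ 3)\<^sup>2)"
          by (rule calibration_inequality[OF a0_pos a_ge un or])
        finally show "dens x + gap n x + B' x \<le> e x" unfolding e_def norm_vec3 .
      qed
    qed
  qed
  moreover have "(LINT x:{u..v}|lebesgue. (dens x + gap n x) + B' x) =
    integral {u..v} (\<lambda>x. dens x + gap n x) + (boundary_term n v - boundary_term n u)"
    using set_integral_add(2)[OF DI B'I] set_lebesgue_integral_eq_integral(2)[OF DI]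
      set_lebesgue_integral_eq_integral(2)[OF B'I] primitive_on_integral[OF pB order_refl uv order_refl] by simp
  ultimately show "integral {u..v} (\<lambda>x. dens x + gap n x) + (boundary_term n v - boundary_term n u) \<le> integral {u..v} e"
    using set_lebesgue_integral_eq_integral(2)[OF EI] by simp
qed

text \<open>From \<open>\<bar>sinh \<tau>\<bar> \<ge> \<bar>\<tau>\<bar> \<ge> (a\<^sub>0 /
  A\<^sub>0) \<bar>x\<bar>\<close>. One bound serves twice: as decay at infinity and as control of
  the blow-up at \<open>0\<close>.\<close>

lemma kappa_bound:
  assumes "x \<noteq> 0"
  shows "\<bar>q x * (1 / sinh (\<tau> x))\<bar> \<le> A\<^sub>0\<^sup>2 / (a\<^sub>0 * \<bar>x\<bar>)"
proof -
  have "a\<^sub>0 / A\<^sub>0 * \<bar>x\<bar> \<le> \<bar>sinh (\<tau> x)\<bar>" using \<tau>_abs(1)[of x] abs_le_abs_sinh[of "\<tau> x"] by linarith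
  moreover have "0 < a\<^sub>0 / A\<^sub>0 * \<bar>x\<bar>" using assms a0_pos A0_pos by simp
  ultimately have "q x / \<bar>sinh (\<tau> x)\<bar> \<le> A\<^sub>0 / (a\<^sub>0 / A\<^sub>0 * \<bar>x\<bar>)"
    using q_le[of x] A0_pos by (intro frac_le) auto
  note le = this
  have eq1: "\<bar>q x * (1 / sinh (\<tau> x))\<bar> = q x / \<bar>sinh (\<tau> x)\<bar>" using q_pos[of x] by (simp add: abs_mult)
  have eq2: "A\<^sub>0 / (a\<^sub>0 / A\<^sub>0 * \<bar>x\<bar>) = A\<^sub>0\<^sup>2 / (a\<^sub>0 * \<bar>x\<bar>)" by (simp add: power2_eq_square)
  show ?thesis unfolding eq1 eq2[symmetric] by (rule le)
qed

lemma boundary_term_infinity: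
  assumes "norm (n x) = 1" "x \<noteq> 0"
  shows "\<bar>boundary_term n x\<bar> \<le> 4 * A\<^sub>0\<^sup>2 / (a\<^sub>0 * \<bar>x\<bar>)"
proof -
  have "\<bar>n x $ 2\<bar> \<le> 1" using component_le_norm_cart[of "n x" 2] assms by simp
  then have "\<bar>n x $ 2 - C x\<bar> \<le> 2" using S_C(2,3)[of x] by linarith
  then have "\<bar>q x * (1 / sinh (\<tau> x))\<bar> * \<bar>n x $ 2 - C x\<bar> \<le> A\<^sub>0\<^sup>2 / (a\<^sub>0 * \<bar>x\<bar>) * 2"
    using kappa_bound[OF assms(2)] a0_pos by (intro mult_mono) auto
  then show ?thesis unfolding boundary_term_def by (simp add: abs_mult)
qed

text \<open>\<open>C' = - S C q / a\<close>, and \<open>S\<close> is itself at most linear in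
  \<open>x\<close>, so \<open>C\<close> leaves the value \<open>1\<close> quadratically.\<close>

lemma C_near_0: "\<bar>1 - C x\<bar> \<le> (A\<^sub>0 / a\<^sub>0)\<^sup>2 * x\<^sup>2"
proof -
  define c where "c = A\<^sub>0 / a\<^sub>0"
  have c: "c \<ge> 0" using A0_pos a0_pos by (simp add: c_def)
  define u where "u = min 0 x" define v where "v = max 0 x"
  have uv: "u \<le> v" "v - u = \<bar>x\<bar>" by (auto simp: u_def v_def)
  have "norm (C v - C u) \<le> (c * \<bar>x\<bar> * c) * measure lborel {u..v}"
  proof (rule has_integral_bound_real[OF _ finite.emptyI primitive_onD[OF C_primitive order_refl uv(1) order_refl]])
    show "0 \<le> c * \<bar>x\<bar> * c" using c by simp
    fix t assume t: "t \<in> {u..v} - {}"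
    have "\<bar>S t\<bar> \<le> \<bar>\<tau> t\<bar>" using abs_tanh_diff_le[of "\<tau> t" 0] by (simp add: S_def)
    also have "\<dots> \<le> c * \<bar>t\<bar>" unfolding c_def by (rule \<tau>_abs)
    also have "\<dots> \<le> c * \<bar>x\<bar>" using t c by (intro mult_left_mono) (auto simp: u_def v_def)
    finally have s: "\<bar>S t\<bar> \<le> c * \<bar>x\<bar>" .
    have cq: "\<bar>C t\<bar> * \<bar>q t / a t\<bar> \<le> 1 * c"
      using S_C(2,3)[of t] slope[of t] c by (intro mult_mono) (auto simp: c_def)
    have "\<bar>S t\<bar> * (\<bar>C t\<bar> * \<bar>q t / a t\<bar>) \<le> c * \<bar>x\<bar> * (1 * c)"
      by (rule mult_mono[OF s cq]) (use c in auto)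
    then show "norm (- (S t * C t * q t / a t)) \<le> c * \<bar>x\<bar> * c" by (simp add: abs_mult)
  qed
  moreover have "norm (C v - C u) = \<bar>1 - C x\<bar>"
    using \<tau>_0 by (auto simp: u_def v_def min_def max_def C_def)
  ultimately show ?thesis using uv by (simp add: c_def power2_eq_square algebra_simps)
qed

text \<open>
  Near \<open>0\<close> the factor \<open>q / sinh \<tau>\<close> blows up like \<open>1/x\<close>, while \<open>1 - n\<^sub>2 = \<bar>n - e\<^sub>2\<bar>\<^sup>2/2 = o(x)\<close>.
\<close>

lemma boundary_term_zero:
  assumes n: "\<And>u v. primitive_on u v n n'" and unit: "\<And>x. norm (n x) = 1" and n0: "n 0 = e2"
    and L2: "\<And>u v. (\<lambda>x. (norm (n' x))\<^sup>2) absolutely_integrable_on {u..v}" and x: "x \<noteq> 0" "\<bar>x\<bar> \<le> h"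
  shows "\<bar>boundary_term n x\<bar> \<le> A\<^sub>0\<^sup>2 / a\<^sub>0 * (integral {- h..h} (\<lambda>x. (norm (n' x))\<^sup>2) + 2 * (A\<^sub>0 / a\<^sub>0)\<^sup>2 * \<bar>x\<bar>)"
proof -
  define I where "I = integral {- h..h} (\<lambda>x. (norm (n' x))\<^sup>2)"
  define u where "u = min 0 x" define v where "v = max 0 x"
  have uv: "u \<le> v" "v - u = \<bar>x\<bar>" "- h \<le> u" "v \<le> h" using x by (auto simp: u_def v_def)
  have ni: "n' absolutely_integrable_on {u..v}" for u v by (rule primitive_on_abs_integrable[OF n])
  have nn: "(\<lambda>x. norm (n' x)) integrable_on {u..v}" for u v
    using set_lebesgue_integral_eq_integral(1)[OF absolutely_integrable_norm[OF ni]] by (simp add: o_def)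
  have n2: "(\<lambda>x. (norm (n' x))\<^sup>2) integrable_on {u..v}" for u v
    by (rule set_lebesgue_integral_eq_integral(1)[OF L2])
  have "norm (n v - n u) \<le> integral {u..v} (\<lambda>x. norm (n' x))"
    using integral_norm_bound_integral[OF _ nn, of n' u v] primitive_onD[OF n order_refl uv(1) order_refl]
    by (metis has_integral_integrable_integral order_refl)
  then have "(norm (n v - n u))\<^sup>2 \<le> (integral {u..v} (\<lambda>x. norm (n' x)))\<^sup>2" by (intro power_mono) auto
  \<comment> \<open>Cauchy-Schwarz gives
    \<open>\<bar>n(x) - e\<^sub>2\<bar>\<^sup>2 \<le> \<bar>x\<bar> I\<close>; the factor
    \<open>I\<close>, an integral over a shrinking interval, supplies the smallness beyond
    \<open>O(x)\<close>.\<close>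
  also have "\<dots> \<le> (v - u) * integral {u..v} (\<lambda>x. (norm (n' x))\<^sup>2)"
    by (rule cauchy_schwarz_interval[OF uv(1) nn n2])
  also have "\<dots> \<le> \<bar>x\<bar> * I"
    unfolding uv(2) I_def
    by (intro mult_left_mono integral_subset_le n2) (use uv in auto)
  finally have "(norm (n v - n u))\<^sup>2 \<le> \<bar>x\<bar> * I" .
  moreover have "norm (n v - n u) = norm (n x - e2)"
    using n0 by (auto simp: u_def v_def min_def max_def norm_minus_commute)
  \<comment> \<open>On the sphere the squared distance to \<open>e2\<close> is twice the defect
    \<open>1 - n\<^sub>2\<close>.\<close>
  moreover have "(norm (n x - e2))\<^sup>2 = 2 - 2 * n x $ 2"
  proof -
    have "(norm (n x - e2))\<^sup>2 = (n x $ 1)\<^sup>2 + (n x $ 2 - 1)\<^sup>2 + (n x $ 3)\<^sup>2" by (simp add: norm_vec3)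
    also have "\<dots> = ((n x $ 1)\<^sup>2 + (n x $ 2)\<^sup>2 + (n x $ 3)\<^sup>2) + 1 - 2 * n x $ 2" by (simp add: power2_diff)
    finally show ?thesis using norm_vec3[of "n x"] unit[of x] by simp
  qed
  ultimately have 1: "2 - 2 * n x $ 2 \<le> \<bar>x\<bar> * I" by simp
  have "0 \<le> 2 - 2 * n x $ 2" using component_le_norm_cart[of "n x" 2] unit[of x] by simp
  then have "\<bar>n x $ 2 - C x\<bar> \<le> \<bar>x\<bar> * I / 2 + (A\<^sub>0 / a\<^sub>0)\<^sup>2 * x\<^sup>2"
    using 1 C_near_0[of x] by linarith
  then have "\<bar>q x * (1 / sinh (\<tau> x))\<bar> * \<bar>n x $ 2 - C x\<bar> \<le> A\<^sub>0\<^sup>2 / (a\<^sub>0 * \<bar>x\<bar>) * (\<bar>x\<bar> * I / 2 + (A\<^sub>0 / a\<^sub>0)\<^sup>2 * x\<^sup>2)"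
    using kappa_bound[OF x(1)] a0_pos by (intro mult_mono) auto
  also have "\<dots> = A\<^sub>0\<^sup>2 / a\<^sub>0 * (I / 2 + (A\<^sub>0 / a\<^sub>0)\<^sup>2 * \<bar>x\<bar>)"
  proof -
    have "x\<^sup>2 = \<bar>x\<bar> * \<bar>x\<bar>" by (simp add: power2_eq_square)
    then have "\<bar>x\<bar> * I / 2 + (A\<^sub>0 / a\<^sub>0)\<^sup>2 * x\<^sup>2 = \<bar>x\<bar> * (I / 2 + (A\<^sub>0 / a\<^sub>0)\<^sup>2 * \<bar>x\<bar>)" by (simp add: algebra_simps)
    then show ?thesis using x(1) by simp
  qed
  finally have "2 * (\<bar>q x * (1 / sinh (\<tau> x))\<bar> * \<bar>n x $ 2 - C x\<bar>) \<le> 2 * (A\<^sub>0\<^sup>2 / a\<^sub>0 * (I / 2 + (A\<^sub>0 / a\<^sub>0)\<^sup>2 * \<bar>x\<bar>))"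
    by (rule mult_left_mono) simp
  also have "\<dots> = A\<^sub>0\<^sup>2 / a\<^sub>0 * (2 * (I / 2 + (A\<^sub>0 / a\<^sub>0)\<^sup>2 * \<bar>x\<bar>))" by (simp only: mult.left_commute)
  also have "2 * (I / 2 + (A\<^sub>0 / a\<^sub>0)\<^sup>2 * \<bar>x\<bar>) = I + 2 * (A\<^sub>0 / a\<^sub>0)\<^sup>2 * \<bar>x\<bar>" by simp
  finally show ?thesis unfolding boundary_term_def I_def[symmetric] abs_mult by (simp only: abs_neg_numeral)
qed

text \<open>The calibration is applied on the sets \<open>K k\<close>, which exhaust the line
  without \<open>0\<close>. The total boundary contribution \<open>b k\<close> is kept on the
  right-hand side, where it can be added to an energy that may be infinite, and tends to
  \<open>0\<close>.\<close>

lemma energy_lower_bound: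
  assumes n: "\<And>u v. primitive_on u v n n'" and unit: "\<And>x. norm (n x) = 1" and n0: "n 0 = e2"
    and n'm: "n' \<in> borel_measurable lebesgue"
    and L2: "\<And>u v. (\<lambda>x. (norm (n' x))\<^sup>2) absolutely_integrable_on {u..v}"
  shows "(\<integral>\<^sup>+x. ennreal (dens x + gap n x) \<partial>lebesgue)
    \<le> (\<integral>\<^sup>+x. ennreal (a x * (norm (n' x))\<^sup>2 + a x * ((n x $ 2)\<^sup>2 + (n x $ 3)\<^sup>2)) \<partial>lebesgue)" (is "?D \<le> ?E")
proof (rule ennreal_le_epsilon)
  fix \<epsilon> :: real assume \<epsilon>: "\<epsilon> > 0"
  define e where "e x = a x * (norm (n' x))\<^sup>2 + a x * ((n x $ 2)\<^sup>2 + (n x $ 3)\<^sup>2)" for x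
  define d where "d x = dens x + gap n x" for x
  define R where "R k = real (Suc k)" for k
  define K where "K k = {- R k..- (1 / R k)} \<union> {1 / R k..R k}" for k
  have R: "R k > 0" "R k \<ge> 1" "1 / R k \<le> R k" "1 / R k > 0" "1 / R k \<le> 1" for k
  proof -
    show "R k > 0" "R k \<ge> 1" "1 / R k > 0" by (auto simp: R_def)
    have "1 / R k \<le> 1 / 1" by (rule divide_left_mono) (auto simp: R_def)
    moreover have "1 \<le> R k" by (simp add: R_def)
    ultimately show "1 / R k \<le> R k" "1 / R k \<le> 1" by linarith+
  qed
  have nc: "continuous_on UNIV n" by (rule primitive_continuous[OF n])
  have gapc: "continuous_on UNIV (gap n)" unfolding gap_def
    by (intro continuous_intros C_continuous continuous_on_component nc)
  have dm: "d \<in> borel_measurable lebesgue" unfolding d_def[abs_def]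
    by (intro borel_measurable_add dens_measurable continuous_measurable_lebesgue[OF gapc])
  have dnn: "0 \<le> d x" for x unfolding d_def gap_def using dens_bounds(1)[of x] a0_pos by simp
  have enn: "0 \<le> e x" for x unfolding e_def using a_pos[of x] by simp
  define bt where "bt = boundary_term n"
  define b where "b k = \<bar>bt (R k)\<bar> + \<bar>bt (- R k)\<bar> + \<bar>bt (1 / R k)\<bar> + \<bar>bt (- (1 / R k))\<bar>" for k
  have Rlim: "(\<lambda>k. 1 / R k) \<longlonglongrightarrow> 0" unfolding R_def using LIMSEQ_inverse_real_of_nat by (simp add: inverse_eq_divide)
  have blim: "b \<longlonglongrightarrow> 0"
  proof -
    define I where "I k = integral {- (1 / R k)..1 / R k} (\<lambda>x. (norm (n' x))\<^sup>2)" for k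
    have Ilim: "I \<longlonglongrightarrow> 0"
    proof -
      \<comment> \<open>Continuity at \<open>0\<close> of the indefinite integral of
        \<open>\<bar>n'\<bar>\<^sup>2\<close> makes \<open>I\<close> vanish in the limit.\<close>
      define J where "J x = integral {- 1..x} (\<lambda>x. (norm (n' x))\<^sup>2)" for x
      have "continuous_on {- 1..1} J" unfolding J_def
        by (rule indefinite_integral_continuous_1[OF set_lebesgue_integral_eq_integral(1)[OF L2]])
      then have "isCont J 0" by (rule continuous_on_interior) auto
      then have "(\<lambda>k. J (1 / R k) - J (- (1 / R k))) \<longlonglongrightarrow> J 0 - J 0"
        using Rlim tendsto_minus[OF Rlim] by (intro tendsto_diff isCont_tendsto_compose[of 0 J]) auto
      moreover have "J (1 / R k) - J (- (1 / R k)) = I k" for k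
        unfolding J_def I_def
        by (rule abs_integrable_integral_diff[OF L2, where v = "1 / R k"]) (use R(4,5)[of k] in auto)
      ultimately show ?thesis by simp
    qed
    have "(\<lambda>k. 2 * (4 * A\<^sub>0\<^sup>2 / a\<^sub>0 * (1 / R k)) + 2 * (A\<^sub>0\<^sup>2 / a\<^sub>0 * (I k + 2 * (A\<^sub>0 / a\<^sub>0)\<^sup>2 * (1 / R k)))) \<longlonglongrightarrow>
       2 * (4 * A\<^sub>0\<^sup>2 / a\<^sub>0 * 0) + 2 * (A\<^sub>0\<^sup>2 / a\<^sub>0 * (0 + 2 * (A\<^sub>0 / a\<^sub>0)\<^sup>2 * 0))"
      by (intro tendsto_add tendsto_mult tendsto_const Ilim Rlim)
    moreover have "norm (b k) \<le> 2 * (4 * A\<^sub>0\<^sup>2 / a\<^sub>0 * (1 / R k)) + 2 * (A\<^sub>0\<^sup>2 / a\<^sub>0 * (I k + 2 * (A\<^sub>0 / a\<^sub>0)\<^sup>2 * (1 / R k)))" for k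
    proof -
      have inf: "\<bar>bt x\<bar> \<le> 4 * A\<^sub>0\<^sup>2 / a\<^sub>0 * (1 / R k)" if "\<bar>x\<bar> = R k" for x
        using boundary_term_infinity[OF unit, of x] that R(1)[of k] unfolding bt_def by force
      have zero: "\<bar>bt x\<bar> \<le> A\<^sub>0\<^sup>2 / a\<^sub>0 * (I k + 2 * (A\<^sub>0 / a\<^sub>0)\<^sup>2 * (1 / R k))" if "\<bar>x\<bar> = 1 / R k" for x
      proof -
        have "x \<noteq> 0" "\<bar>x\<bar> \<le> 1 / R k" using that R(4)[of k] by auto
        from boundary_term_zero[OF n unit n0 L2 this] show ?thesis unfolding bt_def I_def that .
      qed
      show ?thesis
        using inf[of "R k"] inf[of "- R k"] zero[of "1 / R k"] zero[of "- (1 / R k)"] R(1,4)[of k]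
        unfolding b_def by simp
    qed
    ultimately show ?thesis by (intro Lim_null_comparison[of b]) auto
  qed
  have bound: "(\<integral>\<^sup>+x. ennreal (d x) * indicator (K k) x \<partial>lebesgue) \<le> ?E + ennreal (b k)" for k
  proof -
    have 0: "0 \<notin> {- R k..- (1 / R k)}" "0 \<notin> {1 / R k..R k}" using R(4)[of k] by auto
    have le: "- R k \<le> - (1 / R k)" "1 / R k \<le> R k" using R(3)[of k] by auto
    note c1 = calibration[OF n unit 0(1) le(1) L2, folded e_def d_def bt_def]
      and c2 = calibration[OF n unit 0(2) le(2) L2, folded e_def d_def bt_def]
    have dis: "{- R k..- (1 / R k)} \<inter> {1 / R k..R k} = {}" using R(4)[of k] by auto
    have un: "integral (K k) f = integral {- R k..- (1 / R k)} f + integral {1 / R k..R k} f"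
      if "f absolutely_integrable_on {- R k..- (1 / R k)}" "f absolutely_integrable_on {1 / R k..R k}" for f :: "real \<Rightarrow> real"
      unfolding K_def
      by (rule Henstock_Kurzweil_Integration.integral_Un)
        (use dis that set_lebesgue_integral_eq_integral(1) in auto)
    have dK: "d absolutely_integrable_on K k" and eK: "e absolutely_integrable_on K k"
      unfolding K_def using c1(1,2) c2(1,2) by (auto intro: absolutely_integrable_Un)
    have Ks: "K k \<in> sets lebesgue" unfolding K_def by simp
    have "integral (K k) d \<le> integral (K k) e + b k"
      unfolding un[OF c1(1) c2(1)] un[OF c1(2) c2(2)] b_def using c1(3) c2(3) by linarith
    then have "(\<integral>\<^sup>+x. ennreal (d x) * indicator (K k) x \<partial>lebesgue) \<le> ennreal (integral (K k) e + b k)"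
      unfolding nn_integral_indicator_eq_integral[OF dK dnn Ks] by (rule ennreal_leI)
    also have "\<dots> = ennreal (integral (K k) e) + ennreal (b k)"
      by (rule ennreal_plus) (auto simp: b_def intro!: Henstock_Kurzweil_Integration.integral_nonneg
          set_lebesgue_integral_eq_integral(1)[OF eK] enn)
    also have "ennreal (integral (K k) e) = (\<integral>\<^sup>+x. ennreal (e x) * indicator (K k) x \<partial>lebesgue)"
      by (rule nn_integral_indicator_eq_integral[OF eK enn Ks, symmetric])
    also have "\<dots> \<le> (\<integral>\<^sup>+x. ennreal (e x) \<partial>lebesgue)"
      by (rule nn_integral_mono) (simp add: indicator_def)
    finally show ?thesis unfolding e_def by simp
  qed
  have Kinc: "incseq K"
  proof (rule incseq_SucI)
    fix k
    have "1 / R (Suc k) \<le> 1 / R k" by (rule divide_left_mono) (auto simp: R_def)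
    moreover have "R k \<le> R (Suc k)" by (simp add: R_def)
    ultimately show "K k \<subseteq> K (Suc k)" unfolding K_def by auto
  qed
  have KU: "AE x in lebesgue. x \<in> (\<Union>k. K k)"
  proof -
    have "x \<in> (\<Union>k. K k)" if "x \<noteq> 0" for x
    proof -
      have "\<bar>x\<bar> > 0" using that by simp
      have "eventually (\<lambda>k. 1 / R k < \<bar>x\<bar>) sequentially" using order_tendstoD(2)[OF Rlim \<open>\<bar>x\<bar> > 0\<close>] .
      moreover obtain N :: nat where "\<bar>x\<bar> \<le> real N" using real_arch_simple by blast
      then have "eventually (\<lambda>k. \<bar>x\<bar> \<le> R k) sequentially"
        by (intro eventually_sequentiallyI[of N]) (auto simp: R_def)
      ultimately have "eventually (\<lambda>k. 1 / R k < \<bar>x\<bar> \<and> \<bar>x\<bar> \<le> R k) sequentially" by eventually_elim simp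
      then obtain k where "1 / R k < \<bar>x\<bar>" "\<bar>x\<bar> \<le> R k" by (auto simp: eventually_sequentially)
      then have "x \<in> K k" unfolding K_def by (cases "x \<ge> 0") auto
      then show ?thesis by blast
    qed
    then show ?thesis unfolding eventually_ae_filter_negligible by (intro exI[of _ "{0}"]) auto
  qed
  have lim: "(\<lambda>k. \<integral>\<^sup>+x. ennreal (d x) * indicator (K k) x \<partial>lebesgue) \<longlonglongrightarrow> ?D"
    unfolding d_def[symmetric]
    by (rule nn_integral_exhaust[OF _ Kinc _ KU]) (use dm in \<open>auto simp: K_def\<close>)
  have "eventually (\<lambda>k. b k < \<epsilon>) sequentially" using order_tendstoD(2)[OF blim \<epsilon>] .
  then obtain N where N: "\<And>k. k \<ge> N \<Longrightarrow> b k < \<epsilon>" by (auto simp: eventually_sequentially)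
  show "?D \<le> ?E + ennreal \<epsilon>"
  proof (rule LIMSEQ_le_const2[OF lim], intro exI[of _ N] allI impI)
    fix k assume "N \<le> k"
    then have "ennreal (b k) \<le> ennreal \<epsilon>" using N by (intro ennreal_leI) (simp add: less_imp_le)
    then show "(\<integral>\<^sup>+x. ennreal (d x) * indicator (K k) x \<partial>lebesgue) \<le> ?E + ennreal \<epsilon>"
      using bound[of k] by (meson add_left_mono order_trans)
  qed
qed

end

subsection \<open>Null sets do not matter\<close>

text \<open>Completeness of Lebesgue measure transfers measurability between \<open>f\<close> and
  \<open>g\<close>; if both fail to be measurable, both integrals are \<open>0\<close> by
  convention.\<close>

lemma lebesgue_integral_cong_AE:
  fixes f g :: "real \<Rightarrow> 'a::euclidean_space"
  assumes "AE x in lebesgue. f x = g x"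
  shows "(LINT x|lebesgue. f x) = (LINT x|lebesgue. g x)"
proof (cases "f \<in> borel_measurable lebesgue")
  case True
  then show ?thesis using borel_measurable_AE[OF True assms] assms by (intro integral_cong_AE)
next
  case False
  have "g \<notin> borel_measurable lebesgue"
  proof
    assume "g \<in> borel_measurable lebesgue"
    then have "f \<in> borel_measurable lebesgue" by (rule borel_measurable_AE) (use assms in eventually_elim, simp)
    then show False using False by simp
  qed
  then have "\<not> integrable lebesgue f" "\<not> integrable lebesgue g" using False by auto
  then show ?thesis by (simp add: not_integrable_integral_eq)
qed

lemma set_integrable_lebesgue_cong_AE:
  fixes f g :: "real \<Rightarrow> 'a::euclidean_space"
  assumes "set_integrable lebesgue K f" "AE x in lebesgue. f x = g x"
  shows "set_integrable lebesgue K g"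
  unfolding set_integrable_def
proof (rule integrable_cong_AE_imp)
  show 1: "integrable lebesgue (\<lambda>x. indicator K x *\<^sub>R f x)" using assms(1) unfolding set_integrable_def .
  have ae: "AE x in lebesgue. indicator K x *\<^sub>R f x = indicator K x *\<^sub>R g x"
    using assms(2) by eventually_elim simp
  then show "(\<lambda>x. indicator K x *\<^sub>R g x) \<in> borel_measurable lebesgue"
    by (rule borel_measurable_AE[OF borel_measurable_integrable[OF 1]])
  show "AE x in lebesgue. indicator K x *\<^sub>R f x = indicator K x *\<^sub>R g x" by (rule ae)
qed

lemma has_weak_deriv_cong_AE:
  fixes f g :: "real \<Rightarrow> 'a::euclidean_space"
  assumes w: "has_weak_deriv U f g"
    and f: "AE x in lebesgue. f x = f' x" and g: "AE x in lebesgue. g x = g' x"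
  shows "has_weak_deriv U f' g'"
proof -
  have "(LINT x|lebesgue. deriv \<zeta> x *\<^sub>R f x) = (LINT x|lebesgue. deriv \<zeta> x *\<^sub>R f' x)" for \<zeta>
    by (rule lebesgue_integral_cong_AE) (use f in eventually_elim, simp)
  moreover have "(LINT x|lebesgue. \<zeta> x *\<^sub>R g x) = (LINT x|lebesgue. \<zeta> x *\<^sub>R g' x)" for \<zeta> :: "real \<Rightarrow> real"
    by (rule lebesgue_integral_cong_AE) (use g in eventually_elim, simp)
  ultimately show ?thesis
    using w set_integrable_lebesgue_cong_AE[OF _ f] set_integrable_lebesgue_cong_AE[OF _ g]
    unfolding has_weak_deriv_def locally_integrable_on_def by simp
qed

text \<open>A non-empty open set is never negligible.\<close>

lemma continuous_AE_zero:
  fixes f :: "real \<Rightarrow> real"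
  assumes "continuous_on UNIV f" "AE x in lebesgue. f x = 0"
  shows "f x = 0"
proof (rule ccontr)
  assume "f x \<noteq> 0"
  have "open {x. f x \<noteq> 0}"
    by (rule open_Collect_neq) (use assms(1) in \<open>auto intro: continuous_on_const\<close>)
  moreover have "{x. f x \<noteq> 0} \<noteq> {}" using \<open>f x \<noteq> 0\<close> by blast
  ultimately have "\<not> negligible {x. f x \<noteq> 0}" by (rule open_not_negligible)
  moreover have "negligible {x. f x \<noteq> 0}"
    using assms(2) unfolding eventually_ae_filter_negligible by (meson negligible_subset)
  ultimately show False by blast
qed

lemma energy_primitive:
  assumes "\<And>u v. primitive_on u v m m'"
  shows "energy a m = (\<integral>\<^sup>+ x. ennreal (a x * (norm (m' x))\<^sup>2 + a x * ((m x $ 2)\<^sup>2 + (m x $ 3)\<^sup>2)) \<partial>lebesgue)"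
  unfolding energy_def
  by (rule nn_integral_cong_AE) (use weak_deriv_primitive(2)[OF assms] in eventually_elim, simp)

lemma L2_loc_abs_integrable:
  assumes "g \<in> L2_loc"
  shows "g \<in> borel_measurable lebesgue" "(\<lambda>x. (norm (g x))\<^sup>2) absolutely_integrable_on {u..v}"
  using assms unfolding L2_loc_def by auto

lemma admissible_primitive:
  assumes "n \<in> admissible"
  shows "\<exists>n'. (\<forall>u v. primitive_on u v n n') \<and> n' \<in> borel_measurable lebesgue \<and>
    (\<forall>u v. (\<lambda>x. (norm (n' x))\<^sup>2) absolutely_integrable_on {u..v})"
    and "norm (n x) = 1" "n 0 = e2" "continuous_on UNIV n"
proof -
  obtain g where g: "g \<in> L2_loc" "has_weak_deriv UNIV n g" and c: "continuous_on UNIV n"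
    using assms unfolding admissible_def H1_loc_def by blast
  show "\<exists>n'. (\<forall>u v. primitive_on u v n n') \<and> n' \<in> borel_measurable lebesgue \<and>
    (\<forall>u v. (\<lambda>x. (norm (n' x))\<^sup>2) absolutely_integrable_on {u..v})"
    using has_weak_deriv_primitive[OF g(2) c] L2_loc_abs_integrable[OF g(1)] by blast
qed (use assms in \<open>auto simp: admissible_def H1_loc_def\<close>)

lemma bounded_L2_loc:
  fixes g :: "real \<Rightarrow> 'a::euclidean_space"
  assumes "g \<in> borel_measurable lebesgue" "\<And>x. norm (g x) \<le> B"
  shows "g \<in> L2_loc"
  unfolding L2_loc_def
proof (intro CollectI conjI allI impI assms(1))
  fix K :: "real set" assume K: "compact K"
  then obtain R where "\<forall>x\<in>K. \<bar>x\<bar> \<le> R" using compact_imp_bounded bounded_real by blast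
  then have sub: "K \<subseteq> {- R..R}" by force
  have "(\<lambda>x. (norm (g x))\<^sup>2) absolutely_integrable_on {- R..R}"
  proof (rule bounded_measurable_abs_integrable[where B = "B\<^sup>2"])
    show "(\<lambda>x. (norm (g x))\<^sup>2) \<in> borel_measurable lebesgue" using assms(1) by measurable
    show "norm ((norm (g x))\<^sup>2) \<le> B\<^sup>2" for x using assms(2)[of x] by (simp add: power_mono)
  qed
  then show "set_integrable lebesgue K (\<lambda>x. (norm (g x))\<^sup>2)"
    by (rule set_integrable_subset[OF _ _ sub]) (use K in \<open>simp add: lmeasurable_compact fmeasurableD\<close>)
qed

context wall
begin

subsection \<open>Existence and uniqueness of the minimizer\<close>

lemma norm_dM_le: "norm (dM x) \<le> A\<^sub>0 / a\<^sub>0"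
proof (rule power2_le_imp_le)
  have "C x * (q x / a x) \<le> 1 * (A\<^sub>0 / a\<^sub>0)"
    using S_C(2,3)[of x] slope[of x] by (intro mult_mono) auto
  then show "(norm (dM x))\<^sup>2 \<le> (A\<^sub>0 / a\<^sub>0)\<^sup>2"
    unfolding norm_dM using S_C(2)[of x] q_pos[of x] a_pos[of x] by (intro power_mono) auto
  show "0 \<le> A\<^sub>0 / a\<^sub>0" using A0_pos a0_pos by simp
qed

lemma C_limits: "(C \<longlongrightarrow> 0) at_top" "(C \<longlongrightarrow> 0) at_bot"
proof -
  have eq: "C = (\<lambda>x. sqrt (1 - (S x)\<^sup>2))"
  proof
    fix x
    have "(C x)\<^sup>2 = 1 - (S x)\<^sup>2" using S_C(1)[of x] by linarith
    then show "C x = sqrt (1 - (S x)\<^sup>2)" using S_C(2)[of x] by (metis abs_of_pos real_sqrt_abs)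
  qed
  have "((\<lambda>x. sqrt (1 - (S x)\<^sup>2)) \<longlongrightarrow> sqrt (1 - 1\<^sup>2)) at_top"
    by (intro tendsto_intros S_limits)
  then show "(C \<longlongrightarrow> 0) at_top" by (subst eq) simp
  have "((\<lambda>x. sqrt (1 - (S x)\<^sup>2)) \<longlongrightarrow> sqrt (1 - (- 1)\<^sup>2)) at_bot"
    by (intro tendsto_intros S_limits)
  then show "(C \<longlongrightarrow> 0) at_bot" by (subst eq) simp
qed

lemma M_admissible: "M \<in> admissible"
  unfolding admissible_def H1_loc_def
proof (intro CollectI conjI allI)
  show "continuous_on UNIV M" by (rule M_continuous)
  show "M \<in> L2_loc"
    by (rule bounded_L2_loc[where B = 1]) (auto simp: norm_M intro: continuous_measurable_lebesgue M_continuous)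
  show "\<exists>g\<in>L2_loc. has_weak_deriv UNIV M g"
    using bounded_L2_loc[OF dM_measurable norm_dM_le] has_weak_deriv_UNIV_I[OF M_primitive] by blast
  show "M x \<in> sphere 0 1" for x using norm_M[of x] by simp
  show "M 0 = e2" by (simp add: vec3_eq_iff M_components S_def C_def \<tau>_0)
  have "((\<lambda>x. S x *\<^sub>R e1 + C x *\<^sub>R e2) \<longlongrightarrow> 1 *\<^sub>R e1 + 0 *\<^sub>R e2) at_top"
    by (intro tendsto_intros S_limits C_limits)
  then show "(M \<longlongrightarrow> e1) at_top" by (simp add: M_def[abs_def])
  have "((\<lambda>x. S x *\<^sub>R e1 + C x *\<^sub>R e2) \<longlongrightarrow> (- 1) *\<^sub>R e1 + 0 *\<^sub>R e2) at_bot"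
    by (intro tendsto_intros S_limits C_limits)
  then show "(M \<longlongrightarrow> - e1) at_bot" by (simp add: M_def[abs_def])
qed

lemma energy_M: "energy a M = (\<integral>\<^sup>+ x. ennreal (dens x) \<partial>lebesgue)"
  unfolding energy_primitive[OF M_primitive]
  by (rule nn_integral_cong) (simp add: norm_dM M_components dens_def distrib_left)

lemma energy_M_finite: "energy a M < \<infinity>"
  using integrable_dens dens_bounds(1) by (simp add: energy_M nn_integral_eq_integral)

lemma gap_nonneg: "0 \<le> gap n x"
  using a0_pos by (simp add: gap_def)

text \<open>The surplus \<open>gap n\<close> is kept on the left so that equality of energies forces
  it to vanish.\<close>

lemma energy_lower_bound_admissible:
  assumes "n \<in> admissible"
  shows "energy a M + (\<integral>\<^sup>+ x. ennreal (gap n x) \<partial>lebesgue) \<le> energy a n"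
    and "continuous_on UNIV (gap n)"
proof -
  obtain n' where n': "\<And>u v. primitive_on u v n n'" "n' \<in> borel_measurable lebesgue"
    "\<And>u v. (\<lambda>x. (norm (n' x))\<^sup>2) absolutely_integrable_on {u..v}"
    using admissible_primitive(1)[OF assms] by blast
  note adm = admissible_primitive(2-4)[OF assms]
  show c: "continuous_on UNIV (gap n)" unfolding gap_def
    by (intro continuous_intros C_continuous continuous_on_component adm(3))
  have "(\<integral>\<^sup>+ x. ennreal (dens x + gap n x) \<partial>lebesgue) = (\<integral>\<^sup>+ x. ennreal (dens x) + ennreal (gap n x) \<partial>lebesgue)"
    by (rule nn_integral_cong) (simp add: dens_bounds(1) gap_nonneg)
  also have "\<dots> = energy a M + (\<integral>\<^sup>+ x. ennreal (gap n x) \<partial>lebesgue)"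
    unfolding energy_M using continuous_measurable_lebesgue[OF c]
    by (intro nn_integral_add) (auto intro: measurable_compose[OF _ measurable_ennreal])
  finally show "energy a M + (\<integral>\<^sup>+ x. ennreal (gap n x) \<partial>lebesgue) \<le> energy a n"
    unfolding energy_primitive[OF n'(1)] using energy_lower_bound[OF n'(1) adm(1,2) n'(2,3)] by simp
qed

lemma M_minimizer: "minimizer a M"
  unfolding minimizer_def
proof (intro conjI ballI M_admissible)
  fix n assume "n \<in> admissible"
  show "energy a M \<le> energy a n"
    by (rule order_trans[OF _ energy_lower_bound_admissible(1)[OF \<open>n \<in> admissible\<close>]]) simp
qed

lemma S_sign: "x > 0 \<Longrightarrow> S x > 0" "x < 0 \<Longrightarrow> S x < 0"
  using \<tau>_strict_mono[of 0 x] \<tau>_strict_mono[of x 0] \<tau>_0 by (auto simp: S_def)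

text \<open>Once the gap vanishes, only the sign of \<open>n\<^sub>1\<close> is open. On each open
  half-line \<open>n\<^sub>1\<close> is continuous without zeros, so the limits at infinity decide
  the sign.\<close>

lemma minimizer_unique:
  assumes "minimizer a n"
  shows "n = M"
proof -
  have adm: "n \<in> admissible" and le: "energy a n \<le> energy a M"
    using assms M_admissible unfolding minimizer_def by auto
  note nc = admissible_primitive(4)[OF adm] and unit = admissible_primitive(2)[OF adm]
  define g where "g = (\<integral>\<^sup>+ x. ennreal (gap n x) \<partial>lebesgue)"
  have "energy a M + g \<le> energy a M + 0"
    unfolding g_def add_0_right by (rule order_trans[OF energy_lower_bound_admissible(1)[OF adm] le])
  \<comment> \<open>The energy of \<open>M\<close> may be cancelled because it is finite.\<close>
  then have "g \<le> 0" using energy_M_finite ennreal_add_left_cancel_le[of "energy a M" g 0] by auto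
  then have "AE x in lebesgue. ennreal (gap n x) = 0"
    unfolding g_def using nn_integral_0_iff_AE[of "\<lambda>x. ennreal (gap n x)" lebesgue]
      measurable_compose[OF continuous_measurable_lebesgue[OF energy_lower_bound_admissible(2)[OF adm]] measurable_ennreal]
    by simp
  then have "AE x in lebesgue. gap n x = 0"
    by eventually_elim (use gap_nonneg in \<open>simp add: antisym\<close>)
  then have g0: "gap n x = 0" for x by (rule continuous_AE_zero[OF energy_lower_bound_admissible(2)[OF adm]])
  have n23: "n x $ 2 = C x" "n x $ 3 = 0" for x
    using g0[of x] a0_pos unfolding gap_def by (auto simp: sum_power2_eq_zero_iff)
  have n1: "(n x $ 1)\<^sup>2 = (S x)\<^sup>2" for x
    using norm_vec3[of "n x"] unit[of x] S_C(1)[of x] by (simp add: n23)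
  then have n1': "n x $ 1 = S x \<or> n x $ 1 = - S x" for x by (simp add: power2_eq_iff)
  have n1c: "continuous_on A (\<lambda>x. n x $ 1)" for A
    by (intro continuous_on_component continuous_on_subset[OF nc]) auto
  have n1z: "n x $ 1 \<noteq> 0" if "x \<noteq> 0" for x
    using n1[of x] S_sign[of x] that by (cases x "0::real" rule: linorder_cases) auto
  have lim: "((\<lambda>x. n x $ 1) \<longlongrightarrow> 1) at_top" "((\<lambda>x. n x $ 1) \<longlongrightarrow> - 1) at_bot"
    using adm tendsto_vec_nth[of n e1 at_top 1] tendsto_vec_nth[of n "- e1" at_bot 1] by (auto simp: admissible_def)
  have "n x $ 1 = S x" for x
  proof (cases x "0::real" rule: linorder_cases)
    case equal
    then show ?thesis using n1[of x] by (simp add: S_def \<tau>_0)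
  next
    case greater
    have "eventually (\<lambda>y. 0 < n y $ 1) at_top" using order_tendstoD(1)[OF lim(1), of 0] by simp
    then have "eventually (\<lambda>y. 0 < n y $ 1 \<and> x \<le> y) at_top" using eventually_ge_at_top[of x] by eventually_elim simp
    then obtain y where y: "0 < n y $ 1" "x \<le> y" by (auto simp: eventually_at_top_linorder)
    have "\<not> n x $ 1 < 0"
    proof
      assume "n x $ 1 < 0"
      then obtain z where "x \<le> z" "z \<le> y" "n z $ 1 = 0"
        using IVT'[of "\<lambda>x. n x $ 1" x 0 y] y n1c by (auto simp: less_imp_le)
      then show False using n1z[of z] greater by simp
    qed
    then show ?thesis using n1'[of x] S_sign(1)[OF greater] by auto
  next
    case less
    have "eventually (\<lambda>y. n y $ 1 < 0) at_bot" using order_tendstoD(2)[OF lim(2), of 0] by simp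
    then have "eventually (\<lambda>y. n y $ 1 < 0 \<and> y \<le> x) at_bot" using eventually_le_at_bot[of x] by eventually_elim simp
    then obtain y where y: "n y $ 1 < 0" "y \<le> x" by (auto simp: eventually_at_bot_linorder)
    have "\<not> n x $ 1 > 0"
    proof
      assume "n x $ 1 > 0"
      then obtain z where "y \<le> z" "z \<le> x" "n z $ 1 = 0"
        using IVT'[of "\<lambda>x. n x $ 1" y 0 x] y n1c by (auto simp: less_imp_le)
      then show False using n1z[of z] less by simp
    qed
    then show ?thesis using n1'[of x] S_sign(2)[OF less] by auto
  qed
  then show ?thesis using n23 by (auto simp: vec3_eq_iff M_components fun_eq_iff)
qed

subsection \<open>The Euler-Lagrange equation\<close>

lemma \<phi>_lipschitz: "(A\<^sub>0 / a\<^sub>0)-lipschitz_on UNIV \<phi>"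
proof (rule lipschitz_onI)
  have le: "\<bar>\<phi> y - \<phi> x\<bar> \<le> A\<^sub>0 / a\<^sub>0 * (y - x)" if "x \<le> y" for x y
  proof -
    have "norm (\<phi> y - \<phi> x) \<le> A\<^sub>0 / a\<^sub>0 * measure lborel {x..y}"
    proof (rule has_integral_bound_real[OF _ finite.emptyI primitive_onD[OF \<phi>_primitive order_refl that order_refl]])
      fix t assume "t \<in> {x..y} - {}"
      have "C t * (q t / a t) \<le> 1 * (A\<^sub>0 / a\<^sub>0)" using S_C(2,3)[of t] slope[of t] by (intro mult_mono) auto
      then show "norm (C t * q t / a t) \<le> A\<^sub>0 / a\<^sub>0" using S_C(2)[of t] q_pos[of t] a_pos[of t] by simp
    qed (use A0_pos a0_pos in simp)
    then show ?thesis using that by simp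
  qed
  show "dist (\<phi> x) (\<phi> y) \<le> A\<^sub>0 / a\<^sub>0 * dist x y" for x y
    using le[of x y] le[of y x] by (cases "x \<le> y") (auto simp: dist_real_def abs_minus_commute)
qed (use A0_pos a0_pos in simp)

text \<open>The terms \<open>S C q\<^sup>2 / a\<close> of the product rule cancel, leaving the
  pendulum equation. The equation for \<open>q\<close> is a premise, so that the result serves both
  the punctured and the whole line.\<close>

lemma flux_primitive:
  assumes "primitive_on u v q (\<lambda>x. ((q x)\<^sup>2 / a x - a x) * tanh (\<tau> x))"
  shows "primitive_on u v (\<lambda>x. a x * (C x * q x / a x)) (\<lambda>x. - (a x * S x * C x))"
proof -
  have "primitive_on u v (\<lambda>x. C x * q x)
     (\<lambda>x. C x * (((q x)\<^sup>2 / a x - a x) * tanh (\<tau> x)) + - (S x * C x * q x / a x) * q x)"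
    by (rule primitive_on_bilinear[OF bounded_bilinear_mult C_primitive assms])
  moreover have "C x * (((q x)\<^sup>2 / a x - a x) * tanh (\<tau> x)) + - (S x * C x * q x / a x) * q x = - (a x * S x * C x)" for x
    unfolding S_def[symmetric] using a_pos[of x] by (simp add: field_simps power2_eq_square)
  moreover have "a x * (C x * q x / a x) = C x * q x" for x using a_pos[of x] by simp
  ultimately show ?thesis by simp
qed

lemma pendulum_punctured: "pendulum_on (UNIV - {0}) a \<phi>"
  unfolding pendulum_on_def sin_\<phi> cos_\<phi>
  using has_weak_deriv_punctured_I[OF \<phi>_primitive] has_weak_deriv_punctured_I[OF flux_primitive[OF q_primitive]] by blast

end

text \<open>Collects what evenness of \<open>a\<close> yields; the decisive item is that the
  equation for \<open>q\<close> now holds across \<open>0\<close>. Monotonicity of \<open>a\<close>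
  is kept out and enters with \<open>q_ge_a\<close>.\<close>

locale symmetric_wall = wall +
  assumes a_even: "a (- x) = a x" and \<tau>_odd: "\<tau> (- x) = - \<tau> x" and q_even: "q (- x) = q x"
    and q_primitive_all: "primitive_on u v q (\<lambda>x. ((q x)\<^sup>2 / a x - a x) * tanh (\<tau> x))"
begin

lemma \<phi>_odd: "\<phi> (- x) = - \<phi> x"
  by (simp add: \<phi>_def \<tau>_odd arctan_minus)

lemma pendulum_all: "pendulum_on UNIV a \<phi>"
  unfolding pendulum_on_def sin_\<phi> cos_\<phi>
  using has_weak_deriv_UNIV_I[OF \<phi>_primitive] has_weak_deriv_UNIV_I[OF flux_primitive[OF q_primitive_all]] by blast

lemma lagrange_multiplier_M: "AE x in lebesgue. lagrange_multiplier a M x = dens x"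
  using weak_deriv_primitive(2)[OF M_primitive]
  by eventually_elim (simp add: lagrange_multiplier_def norm_dM M_components dens_def distrib_left)

text \<open>\<open>a M'\<close> is the flux times the unit tangent. Its product-rule derivative has
  a tangential part, given by the pendulum equation, and a normal part
  \<open>- a \<phi>'\<^sup>2\<close> from the turning of the tangent, which equals
  \<open>a cos\<^sup>2 \<phi> - dens\<close>.\<close>

lemma critical: "critical_point a M"
  unfolding critical_point_def
proof (rule has_weak_deriv_cong_AE)
  show "has_weak_deriv UNIV (\<lambda>x. a x *\<^sub>R dM x) (\<lambda>x. (a x * C x) *\<^sub>R e2 - dens x *\<^sub>R M x)"
  proof (rule has_weak_deriv_UNIV_I)
    fix u v
    have V: "primitive_on u v (\<lambda>x. C x *\<^sub>R e1 - S x *\<^sub>R e2)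
       (\<lambda>x. (- (S x * C x * q x / a x)) *\<^sub>R e1 - ((C x)\<^sup>2 * q x / a x) *\<^sub>R e2)"
      by (intro primitive_on_diff primitive_on_linear[OF S_primitive] primitive_on_linear[OF C_primitive]
          bounded_linear_scaleR_left)
    have "primitive_on u v (\<lambda>x. (a x * (C x * q x / a x)) *\<^sub>R (C x *\<^sub>R e1 - S x *\<^sub>R e2))
      (\<lambda>x. (a x * (C x * q x / a x)) *\<^sub>R ((- (S x * C x * q x / a x)) *\<^sub>R e1 - ((C x)\<^sup>2 * q x / a x) *\<^sub>R e2)
        + (- (a x * S x * C x)) *\<^sub>R (C x *\<^sub>R e1 - S x *\<^sub>R e2))"
      by (rule primitive_on_bilinear[OF bounded_bilinear_scaleR flux_primitive[OF q_primitive_all] V])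
    then show "primitive_on u v (\<lambda>x. a x *\<^sub>R dM x) (\<lambda>x. (a x * C x) *\<^sub>R e2 - dens x *\<^sub>R M x)"
    proof (rule primitive_on_cong)
      fix x
      show "(a x * (C x * q x / a x)) *\<^sub>R (C x *\<^sub>R e1 - S x *\<^sub>R e2) = a x *\<^sub>R dM x"
        by (simp add: dM_def)
    next
      show "AE x in lebesgue. u \<le> x \<and> x \<le> v \<longrightarrow>
        (a x * (C x * q x / a x)) *\<^sub>R ((- (S x * C x * q x / a x)) *\<^sub>R e1 - ((C x)\<^sup>2 * q x / a x) *\<^sub>R e2)
        + (- (a x * S x * C x)) *\<^sub>R (C x *\<^sub>R e1 - S x *\<^sub>R e2) = (a x * C x) *\<^sub>R e2 - dens x *\<^sub>R M x"
      proof (intro AE_I2 impI)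
        fix x
        define k where "k = (q x)\<^sup>2 / a x"
        have a: "a x * (C x * q x / a x) = C x * q x" using a_pos[of x] by simp
        have d: "dens x = (C x)\<^sup>2 * k + a x * (C x)\<^sup>2"
          unfolding dens_def k_def using a_pos[of x]
          by (simp add: power_divide power_mult_distrib distrib_left power2_eq_square)
        have q1: "C x * q x * - (S x * C x * q x / a x) = - (S x * (C x)\<^sup>2 * k)"
          by (simp add: k_def power2_eq_square)
        have q2: "C x * q x * ((C x)\<^sup>2 * q x / a x) = (C x) ^ 3 * k"
          by (simp add: k_def power2_eq_square power3_eq_cube)
        have S2: "(S x)\<^sup>2 = 1 - (C x)\<^sup>2" using S_C(1)[of x] by simp
        \<comment> \<open>First and second coordinate of the identity; the second consumes
          \<open>S\<^sup>2 + C\<^sup>2 = 1\<close>.\<close>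
        have p1: "- (S x * (C x)\<^sup>2 * k) + - (a x * S x * C x) * C x = - (((C x)\<^sup>2 * k + a x * (C x)\<^sup>2) * S x)"
          by (simp add: algebra_simps power2_eq_square)
        have "a x * S x * C x * S x = a x * C x * (S x)\<^sup>2" by (simp add: power2_eq_square)
        then have p2: "- ((C x) ^ 3 * k) + a x * S x * C x * S x = a x * C x - ((C x)\<^sup>2 * k + a x * (C x)\<^sup>2) * C x"
          unfolding S2 by (simp only:) (simp add: algebra_simps power2_eq_square power3_eq_cube)
        show "(a x * (C x * q x / a x)) *\<^sub>R ((- (S x * C x * q x / a x)) *\<^sub>R e1 - ((C x)\<^sup>2 * q x / a x) *\<^sub>R e2)
          + (- (a x * S x * C x)) *\<^sub>R (C x *\<^sub>R e1 - S x *\<^sub>R e2) = (a x * C x) *\<^sub>R e2 - dens x *\<^sub>R M x"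
          unfolding a d vec3_eq_iff
          using p1 p2 q1 q2 by (simp add: M_components power2_eq_square mult.assoc)
      qed
    qed
  qed
  show "AE x in lebesgue. a x *\<^sub>R dM x = a x *\<^sub>R weak_deriv M x"
    using weak_deriv_primitive(2)[OF M_primitive] by eventually_elim simp
  show "AE x in lebesgue. (a x * C x) *\<^sub>R e2 - dens x *\<^sub>R M x
      = (a x * M x $ 2) *\<^sub>R e2 - lagrange_multiplier a M x *\<^sub>R M x"
    using lagrange_multiplier_M by eventually_elim (simp add: M_components)
qed

end

subsection \<open>Stability\<close>

lemma integrable_bounded_mult:
  fixes f g :: "real \<Rightarrow> real"
  assumes f: "f \<in> borel_measurable lebesgue" "\<And>x. \<bar>f x\<bar> \<le> B" and g: "integrable lebesgue g"
  shows "integrable lebesgue (\<lambda>x. f x * g x)"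
proof (rule Bochner_Integration.integrable_bound[OF integrable_mult_right[OF g, of B]])
  show "(\<lambda>x. f x * g x) \<in> borel_measurable lebesgue"
    by (intro borel_measurable_times f borel_measurable_integrable[OF g])
  show "AE x in lebesgue. norm (f x * g x) \<le> norm (B * g x)"
    using f(2) by (intro AE_I2) (auto simp: abs_mult intro!: mult_right_mono order_trans[OF f(2) abs_ge_self])
qed

text \<open>An integrable non-negative function cannot stay above \<open>\<epsilon>\<close> on an
  interval longer than its integral divided by \<open>\<epsilon>\<close>. It provides points along
  which boundary terms vanish, in place of pointwise decay at infinity.\<close>

lemma integrable_small_values:
  fixes f :: "real \<Rightarrow> real"
  assumes f: "integrable lebesgue f" and nn: "\<And>x. 0 \<le> f x" and \<epsilon>: "0 < \<epsilon>"
  shows "\<exists>x\<ge>k. f x < \<epsilon>" "\<exists>x\<le>k. f x < \<epsilon>"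
proof -
  define I where "I = integral UNIV f"
  have fi: "f integrable_on UNIV" by (rule integrable_on_lebesgue[OF f])
  obtain n :: nat where n: "I / \<epsilon> < real n" using reals_Archimedean2 by blast
  have small: "\<exists>x\<in>{s..s + real n}. f x < \<epsilon>" for s
  proof (rule ccontr)
    assume "\<not> ?thesis"
    then have ge: "\<And>x. x \<in> {s..s + real n} \<Longrightarrow> \<epsilon> \<le> f x" by (auto simp: not_less)
    have fs: "f integrable_on {s..s + real n}" by (rule integrable_on_subinterval[OF fi]) simp
    have "\<epsilon> * real n = integral {s..s + real n} (\<lambda>x. \<epsilon>)" by (simp add: mult.commute)
    also have "\<dots> \<le> integral {s..s + real n} f"
      by (rule integral_le[OF _ fs]) (use ge in auto)
    also have "\<dots> \<le> I" unfolding I_def by (rule integral_subset_le[OF _ fs fi]) (use nn in auto)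
    finally show False using n \<epsilon> by (simp add: field_simps)
  qed
  show "\<exists>x\<ge>k. f x < \<epsilon>" using small[of k] by auto
  show "\<exists>x\<le>k. f x < \<epsilon>" using small[of "k - real n"] by auto
qed

lemma H1_properties:
  assumes "v \<in> H1"
  shows "continuous_on UNIV v" "integrable lebesgue (\<lambda>x. (norm (v x))\<^sup>2)"
    "primitive_on s t v (weak_deriv v)" "weak_deriv v \<in> borel_measurable lebesgue"
    "integrable lebesgue (\<lambda>x. (norm (weak_deriv v x))\<^sup>2)"
proof -
  show c: "continuous_on UNIV v" and "integrable lebesgue (\<lambda>x. (norm (v x))\<^sup>2)"
    using assms unfolding H1_def L2_def by auto
  obtain g where g: "g \<in> L2" "has_weak_deriv UNIV v g" using assms unfolding H1_def by blast
  note p = has_weak_deriv_primitive[OF g(2) c]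
  show "primitive_on s t v (weak_deriv v)" by (rule weak_deriv_primitive(1)[OF p])
  have ae: "AE x in lebesgue. g x = weak_deriv v x"
    using weak_deriv_primitive(2)[OF p] by eventually_elim simp
  have gm: "g \<in> borel_measurable lebesgue" "integrable lebesgue (\<lambda>x. (norm (g x))\<^sup>2)"
    using g(1) unfolding L2_def by auto
  show m: "weak_deriv v \<in> borel_measurable lebesgue" by (rule borel_measurable_AE[OF gm(1) ae])
  show "integrable lebesgue (\<lambda>x. (norm (weak_deriv v x))\<^sup>2)"
  proof (rule integrable_cong_AE_imp[OF gm(2)])
    show "(\<lambda>x. (norm (weak_deriv v x))\<^sup>2) \<in> borel_measurable lebesgue" using m by measurable
    show "AE x in lebesgue. (norm (g x))\<^sup>2 = (norm (weak_deriv v x))\<^sup>2" using ae by eventually_elim simp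
  qed
qed

lemma inner_le_squares: "\<bar>2 * (x \<bullet> y)\<bar> \<le> (norm x)\<^sup>2 + (norm y)\<^sup>2"
proof -
  have "\<bar>x \<bullet> y\<bar> \<le> norm x * norm y" by (rule Cauchy_Schwarz_ineq2)
  moreover have "2 * (norm x * norm y) \<le> (norm x)\<^sup>2 + (norm y)\<^sup>2"
    using zero_le_power2[of "norm x - norm y"] by (simp add: power2_diff)
  ultimately show ?thesis by linarith
qed

lemma norm_square_primitive:
  assumes "primitive_on s t v v'"
  shows "primitive_on s t (\<lambda>x. (norm (v x))\<^sup>2) (\<lambda>x. 2 * (v x \<bullet> v' x))"
  using primitive_on_bilinear[OF bounded_bilinear_inner assms assms]
  by (simp add: power2_norm_eq_inner inner_commute)

text \<open>The derivative \<open>2 v \<bullet> v'\<close> of \<open>\<bar>v\<bar>\<^sup>2\<close>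
  is dominated by \<open>\<bar>v\<bar>\<^sup>2 + \<bar>v'\<bar>\<^sup>2\<close>, and
  \<open>\<bar>v\<bar>\<^sup>2\<close> drops below \<open>1\<close> somewhere to the right of every
  point; this is the origin of the summand \<open>1\<close> in the bound.\<close>

lemma H1_bounded:
  assumes "v \<in> H1"
  obtains B where "0 \<le> B" "\<And>x. (norm (v x))\<^sup>2 \<le> B"
proof
  note v = H1_properties[OF assms]
  define h where "h x = (norm (v x))\<^sup>2 + (norm (weak_deriv v x))\<^sup>2" for x
  have hi: "h integrable_on UNIV"
    unfolding h_def by (intro integrable_on_lebesgue Bochner_Integration.integrable_add v)
  show "0 \<le> 1 + integral UNIV h" using Henstock_Kurzweil_Integration.integral_nonneg[OF hi] by (simp add: h_def)
  fix x
  obtain y where y: "y \<ge> x" "(norm (v y))\<^sup>2 < 1"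
    using integrable_small_values(1)[OF v(2), of 1 x] by auto
  have i: "((\<lambda>x. 2 * (v x \<bullet> weak_deriv v x)) has_integral (norm (v y))\<^sup>2 - (norm (v x))\<^sup>2) {x..y}"
    by (rule primitive_onD[OF norm_square_primitive[OF v(3)] order_refl y(1) order_refl])
  have hxy: "h integrable_on {x..y}" by (rule integrable_on_subinterval[OF hi]) simp
  have "norm (integral {x..y} (\<lambda>x. 2 * (v x \<bullet> weak_deriv v x))) \<le> integral {x..y} h"
    by (rule integral_norm_bound_integral[OF has_integral_integrable[OF i] hxy])
      (simp only: h_def real_norm_def inner_le_squares)
  also have "\<dots> \<le> integral UNIV h" by (rule integral_subset_le[OF _ hxy hi]) (auto simp: h_def)
  finally show "(norm (v x))\<^sup>2 \<le> 1 + integral UNIV h"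
    unfolding integral_unique[OF i] using y(2) by simp
qed

text \<open>
  The case \<open>s = sin \<phi>\<close>, \<open>c = cos \<phi>\<close>, \<open>k = q/a\<close>, \<open>d = v'\<close>: the difference of the two sides is
  \<open>a (\<bar>d + k s v\<bar>\<^sup>2 - v\<^sub>1\<^sup>2)\<close>, and the component of \<open>d + k s v\<close> along \<open>(s, c, 0)\<close> equals \<open>- k v\<^sub>1\<close>.
\<close>

lemma stability_inequality:
  fixes a k s c v1 v2 v3 d1 d2 d3 :: real
  assumes a: "0 < a" and k: "1 \<le> k" and sc: "s\<^sup>2 + c\<^sup>2 = 1" and orth: "s * v1 + c * v2 = 0"
    and dorth: "s * d1 + c * d2 + c * k * (c * v1 - s * v2) = 0"
  shows "(- (k * a * s)) * (2 * (v1 * d1 + v2 * d2 + v3 * d3)) + a * (s\<^sup>2 - k\<^sup>2) * (v1\<^sup>2 + v2\<^sup>2 + v3\<^sup>2)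
    \<le> a * (d1\<^sup>2 + d2\<^sup>2 + d3\<^sup>2) + a * (v2\<^sup>2 + v3\<^sup>2) - a * ((c * k)\<^sup>2 + c\<^sup>2) * (v1\<^sup>2 + v2\<^sup>2 + v3\<^sup>2)"
proof -
  define w1 where "w1 = d1 + k * s * v1"
  define w2 where "w2 = d2 + k * s * v2"
  define w3 where "w3 = d3 + k * s * v3"
  \<comment> \<open>Orthogonality makes \<open>(v\<^sub>1, v\<^sub>2)\<close> a multiple of the
    tangent \<open>(c, - s)\<close>, with factor \<open>c v\<^sub>1 - s v\<^sub>2\<close>; this is
    its first coordinate.\<close>
  have v1: "c * (c * v1 - s * v2) = v1"
  proof -
    have "c * (c * v1 - s * v2) = (s\<^sup>2 + c\<^sup>2) * v1 - s * (s * v1 + c * v2)" by algebra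
    then show ?thesis unfolding sc orth by simp
  qed
  have "w1 * s + w2 * c = (s * d1 + c * d2 + c * k * (c * v1 - s * v2)) + k * s * (s * v1 + c * v2) - k * (c * (c * v1 - s * v2))"
    unfolding w1_def w2_def by algebra
  then have ws: "w1 * s + w2 * c = - k * v1" unfolding dorth orth v1 by simp
  \<comment> \<open>The planar part of \<open>w\<close> is split into components along
    \<open>(s, c)\<close> and \<open>(c, - s)\<close>; the square of the second is
    discarded.\<close>
  have "w1\<^sup>2 + w2\<^sup>2 = (w1\<^sup>2 + w2\<^sup>2) * (s\<^sup>2 + c\<^sup>2)" unfolding sc by simp
  also have "\<dots> = (w1 * s + w2 * c)\<^sup>2 + (w1 * c - w2 * s)\<^sup>2" by algebra
  also have "\<dots> \<ge> k\<^sup>2 * v1\<^sup>2" unfolding ws by (simp add: power_mult_distrib)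
  finally have "k\<^sup>2 * v1\<^sup>2 \<le> w1\<^sup>2 + w2\<^sup>2" .
  moreover have "1 * v1\<^sup>2 \<le> k\<^sup>2 * v1\<^sup>2" using k by (intro mult_right_mono) (auto simp: one_le_power)
  ultimately have "0 \<le> w1\<^sup>2 + w2\<^sup>2 + w3\<^sup>2 - v1\<^sup>2" using zero_le_power2[of w3] by linarith
  then have "0 \<le> a * (w1\<^sup>2 + w2\<^sup>2 + w3\<^sup>2 - v1\<^sup>2)" using a by simp
  \<comment> \<open>The last summand vanishes by \<open>s\<^sup>2 + c\<^sup>2 = 1\<close>; including
    it makes this a polynomial identity.\<close>
  also have "a * (w1\<^sup>2 + w2\<^sup>2 + w3\<^sup>2 - v1\<^sup>2) =
    (a * (d1\<^sup>2 + d2\<^sup>2 + d3\<^sup>2) + a * (v2\<^sup>2 + v3\<^sup>2) - a * ((c * k)\<^sup>2 + c\<^sup>2) * (v1\<^sup>2 + v2\<^sup>2 + v3\<^sup>2))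
    - ((- (k * a * s)) * (2 * (v1 * d1 + v2 * d2 + v3 * d3)) + a * (s\<^sup>2 - k\<^sup>2) * (v1\<^sup>2 + v2\<^sup>2 + v3\<^sup>2))
    + a * (s\<^sup>2 + c\<^sup>2 - 1) * (1 + k\<^sup>2) * (v1\<^sup>2 + v2\<^sup>2 + v3\<^sup>2)"
    unfolding w1_def w2_def w3_def by algebra
  finally show ?thesis unfolding sc by simp
qed

section \<open>Non-negativity of the quadratic form\<close>

context symmetric_wall
begin

text \<open>The functional is quadratic, so this is at once its density at \<open>v\<close> and the
  coefficient of \<open>t\<^sup>2\<close> in the density of \<open>M + t v\<close> before
  normalisation.\<close>

definition hessian :: "(real \<Rightarrow> real^3) \<Rightarrow> real \<Rightarrow> real" where
  "hessian v x = a x * (norm (weak_deriv v x))\<^sup>2 + a x * ((v x $ 2)\<^sup>2 + (v x $ 3)\<^sup>2)"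

lemma second_variation_integrand_AE:
  "AE x in lebesgue. second_variation_integrand a M v x = hessian v x - dens x * (norm (v x))\<^sup>2"
  using lagrange_multiplier_M by eventually_elim (simp add: second_variation_integrand_def hessian_def)

lemma abs_a_le: "\<bar>a x\<bar> \<le> A\<^sub>0" using a_pos[of x] a_le[of x] by simp

lemma dens_le: "\<bar>dens x\<bar> \<le> A\<^sub>0 * ((A\<^sub>0 / a\<^sub>0)\<^sup>2 + 1)"
proof -
  have "A\<^sub>0 * ((A\<^sub>0 / a\<^sub>0)\<^sup>2 + 1) * (C x)\<^sup>2 \<le> A\<^sub>0 * ((A\<^sub>0 / a\<^sub>0)\<^sup>2 + 1) * 1"
    using S_C(2,3)[of x] A0_pos by (intro mult_left_mono power_le_one) auto
  then show ?thesis using dens_bounds[of x] by simp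
qed

lemma integrable_hessian:
  assumes "v \<in> H1"
  shows "integrable lebesgue (hessian v)"
proof -
  note v = H1_properties[OF assms]
  have "integrable lebesgue (\<lambda>x. (v x $ 2)\<^sup>2 + (v x $ 3)\<^sup>2)"
  proof (rule Bochner_Integration.integrable_bound[OF v(2)])
    show "(\<lambda>x. (v x $ 2)\<^sup>2 + (v x $ 3)\<^sup>2) \<in> borel_measurable lebesgue"
      by (intro continuous_measurable_lebesgue continuous_intros continuous_on_component v(1))
    show "AE x in lebesgue. norm ((v x $ 2)\<^sup>2 + (v x $ 3)\<^sup>2) \<le> norm ((norm (v x))\<^sup>2)"
      by (intro AE_I2) (simp add: norm_vec3)
  qed
  note vi = this
  show ?thesis unfolding hessian_def[abs_def]
    by (rule Bochner_Integration.integrable_add[OF integrable_bounded_mult[OF a_measurable abs_a_le v(5)]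
          integrable_bounded_mult[OF a_measurable abs_a_le vi]])
qed

lemma integrable_dens_norm:
  assumes "v \<in> H1"
  shows "integrable lebesgue (\<lambda>x. dens x * (norm (v x))\<^sup>2)"
  by (rule integrable_bounded_mult[OF dens_measurable dens_le H1_properties(2)[OF assms]])

lemma tangent_AE:
  assumes "v \<in> H1" and "\<And>x. v x \<bullet> M x = 0"
  shows "AE x in lebesgue. v x \<bullet> dM x + weak_deriv v x \<bullet> M x = 0"
proof -
  have "AE x in lebesgue. \<forall>n::nat. - real n \<le> x \<and> x \<le> real n \<longrightarrow> v x \<bullet> dM x + weak_deriv v x \<bullet> M x = 0"
    unfolding AE_all_countable
    using primitive_on_orthogonal_AE[OF H1_properties(3)[OF assms(1)] M_primitive] assms(2) by blast
  then show ?thesis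
  proof eventually_elim
    fix x assume *: "\<forall>n::nat. - real n \<le> x \<and> x \<le> real n \<longrightarrow> v x \<bullet> dM x + weak_deriv v x \<bullet> M x = 0"
    obtain n :: nat where "\<bar>x\<bar> \<le> real n" using real_arch_simple by blast
    then show "v x \<bullet> dM x + weak_deriv v x \<bullet> M x = 0" using *[rule_format, of n] by linarith
  qed
qed

text \<open>The exact derivative split off from the integrand is that of
  \<open>- q S \<bar>v\<bar>\<^sup>2\<close>, where \<open>q S = a \<phi>' tan \<phi>\<close> is
  bounded by \<open>A\<^sub>0\<close>. Integration runs over \<open>[l n, r n]\<close> with
  endpoints at which \<open>\<bar>v\<bar>\<^sup>2\<close> is small.\<close>

lemma second_variation_nonneg:
  assumes vH: "v \<in> H1" and orth: "\<And>x. v x \<bullet> M x = 0" and qa: "\<And>x. x \<noteq> 0 \<Longrightarrow> a x \<le> q x"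
  shows "0 \<le> (LINT x|lebesgue. hessian v x - dens x * (norm (v x))\<^sup>2)"
proof -
  note v = H1_properties[OF vH]
  define Q where "Q x = hessian v x - dens x * (norm (v x))\<^sup>2" for x
  define \<rho> where "\<rho> x = (norm (v x))\<^sup>2" for x
  have Qi: "integrable lebesgue Q"
    unfolding Q_def by (intro Bochner_Integration.integrable_diff integrable_hessian integrable_dens_norm vH)
  have Qs: "Q absolutely_integrable_on {l..r}" for l r
    unfolding set_integrable_def by (rule integrable_mult_indicator[OF _ Qi]) simp
  have G: "primitive_on l r (\<lambda>x. - (q x * S x)) (\<lambda>x. - (q x * ((C x)\<^sup>2 * q x / a x) + ((q x)\<^sup>2 / a x - a x) * tanh (\<tau> x) * S x))" for l r
    by (intro primitive_on_minus primitive_on_bilinear[OF bounded_bilinear_mult q_primitive_all S_primitive])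
  define H' where "H' x = - (q x * S x) * (2 * (v x \<bullet> weak_deriv v x)) +
     - (q x * ((C x)\<^sup>2 * q x / a x) + ((q x)\<^sup>2 / a x - a x) * tanh (\<tau> x) * S x) * (norm (v x))\<^sup>2" for x
  have H: "primitive_on l r (\<lambda>x. - (q x * S x) * (norm (v x))\<^sup>2) H'" for l r
    unfolding H'_def by (rule primitive_on_bilinear[OF bounded_bilinear_mult G norm_square_primitive[OF v(3)]])
  have le: "AE x in lebesgue. H' x \<le> Q x"
    using tangent_AE[OF vH orth] AE_lebesgue_nonzero
  proof eventually_elim
    case (elim x)
    define k where "k = q x / a x"
    have k: "1 \<le> k" "q x = k * a x" using qa[OF elim(2)] a_pos[of x] by (auto simp: k_def)
    have o1: "S x * v x $ 1 + C x * v x $ 2 = 0"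
      using orth[of x] by (simp add: inner_vec3 M_components mult.commute)
    have o2: "S x * weak_deriv v x $ 1 + C x * weak_deriv v x $ 2 + C x * k * (C x * v x $ 1 - S x * v x $ 2) = 0"
      using elim(1) by (simp add: inner_vec3 M_components dM_def k_def algebra_simps)
    have qk: "(q x)\<^sup>2 / a x = k\<^sup>2 * a x" using k(2) a_pos[of x] by (simp add: power2_eq_square)
    \<comment> \<open>\<open>(q S)' = a (k\<^sup>2 - S\<^sup>2)\<close>: the equations for
      \<open>q\<close> and \<open>S\<close> combine through
      \<open>S\<^sup>2 + C\<^sup>2 = 1\<close>.\<close>
    have g: "- (q x * ((C x)\<^sup>2 * q x / a x) + ((q x)\<^sup>2 / a x - a x) * tanh (\<tau> x) * S x) = a x * ((S x)\<^sup>2 - k\<^sup>2)"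
    proof -
      have "q x * ((C x)\<^sup>2 * q x / a x) = (C x)\<^sup>2 * ((q x)\<^sup>2 / a x)" by (simp add: power2_eq_square)
      then have "- (q x * ((C x)\<^sup>2 * q x / a x) + ((q x)\<^sup>2 / a x - a x) * tanh (\<tau> x) * S x)
        = - ((C x)\<^sup>2 * (k\<^sup>2 * a x) + (k\<^sup>2 * a x - a x) * (S x)\<^sup>2)"
        unfolding qk S_def[symmetric] by (simp add: power2_eq_square)
      also have "\<dots> = a x * (S x)\<^sup>2 - k\<^sup>2 * a x * ((S x)\<^sup>2 + (C x)\<^sup>2)" by algebra
      finally show ?thesis unfolding S_C(1) by (simp add: algebra_simps)
    qed
    have d: "dens x = a x * ((C x * k)\<^sup>2 + (C x)\<^sup>2)" by (simp add: dens_def k_def)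
    show ?case
      unfolding H'_def Q_def g unfolding d hessian_def norm_vec3 inner_vec3 k(2)
      using stability_inequality[OF a_pos k(1) S_C(1) o1 o2] by simp
  qed
  have bound: "- (A\<^sub>0 * (\<rho> r + \<rho> l)) \<le> (LINT x|lebesgue. indicator {l..r} x *\<^sub>R Q x)" if lr: "l \<le> r" for l r
  proof -
    have qS: "\<bar>q x * S x\<bar> * \<rho> x \<le> A\<^sub>0 * \<rho> x" for x
    proof (rule mult_right_mono)
      have "\<bar>q x\<bar> * \<bar>S x\<bar> \<le> A\<^sub>0 * 1" using q_pos[of x] q_le[of x] abs_S_le[of x] by (intro mult_mono) auto
      then show "\<bar>q x * S x\<bar> \<le> A\<^sub>0" by (simp add: abs_mult)
    qed (simp add: \<rho>_def)
    have "\<bar>- (q x * S x) * (norm (v x))\<^sup>2\<bar> \<le> A\<^sub>0 * \<rho> x" for x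
      using qS[of x] by (simp add: \<rho>_def abs_mult)
    from this[of r] this[of l]
    have "- (A\<^sub>0 * (\<rho> r + \<rho> l)) \<le> - (q r * S r) * (norm (v r))\<^sup>2 - - (q l * S l) * (norm (v l))\<^sup>2"
      by (simp add: distrib_left)
    also have "\<dots> = (LINT x:{l..r}|lebesgue. H' x)"
      using set_lebesgue_integral_eq_integral(2)[OF primitive_on_abs_integrable[OF H]]
        primitive_on_integral[OF H order_refl lr order_refl] by simp
    also have "\<dots> \<le> (LINT x:{l..r}|lebesgue. Q x)"
      by (rule set_integral_mono_AE[OF primitive_on_abs_integrable[OF H] Qs]) (use le in eventually_elim, simp)
    finally show ?thesis by (simp add: set_lebesgue_integral_def)
  qed
  have "\<exists>r\<ge>real n. \<rho> r < 1 / real (Suc n)" "\<exists>l\<le>- real n. \<rho> l < 1 / real (Suc n)" for n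
    unfolding \<rho>_def by (intro integrable_small_values v(2); simp)+
  then obtain r l where rl: "\<And>n. real n \<le> r n \<and> \<rho> (r n) < 1 / real (Suc n)" "\<And>n. l n \<le> - real n \<and> \<rho> (l n) < 1 / real (Suc n)"
    by metis
  have lim: "(\<lambda>n. LINT x|lebesgue. indicator {l n..r n} x *\<^sub>R Q x) \<longlonglongrightarrow> (LINT x|lebesgue. Q x)"
  proof (rule integral_dominated_convergence[where w = "\<lambda>x. norm (Q x)"])
    show "Q \<in> borel_measurable lebesgue" by (rule borel_measurable_integrable[OF Qi])
    show "(\<lambda>x. indicator {l n..r n} x *\<^sub>R Q x) \<in> borel_measurable lebesgue" for n
      using Qs[of "l n" "r n"] unfolding set_integrable_def by (rule borel_measurable_integrable)
    show "integrable lebesgue (\<lambda>x. norm (Q x))" by (rule integrable_norm[OF Qi])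
    show "AE x in lebesgue. (\<lambda>n. indicator {l n..r n} x *\<^sub>R Q x) \<longlonglongrightarrow> Q x"
    proof (rule AE_I2)
      fix x
      obtain N :: nat where N: "\<bar>x\<bar> \<le> real N" using real_arch_simple by blast
      have "eventually (\<lambda>n. indicator {l n..r n} x *\<^sub>R Q x = Q x) sequentially"
      proof (rule eventually_sequentiallyI[of N])
        fix n assume "N \<le> n"
        then have "\<bar>x\<bar> \<le> real n" using N by linarith
        then have "x \<in> {l n..r n}" using rl(1)[of n] rl(2)[of n] by auto
        then show "indicator {l n..r n} x *\<^sub>R Q x = Q x" by simp
      qed
      then show "(\<lambda>n. indicator {l n..r n} x *\<^sub>R Q x) \<longlonglongrightarrow> Q x" by (rule tendsto_eventually)
    qed
    show "AE x in lebesgue. norm (indicator {l n..r n} x *\<^sub>R Q x) \<le> norm (Q x)" for n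
      by (rule AE_I2) (simp add: indicator_def)
  qed
  have "(\<lambda>n. - (A\<^sub>0 * (2 * (1 / real (Suc n))))) \<longlonglongrightarrow> - (A\<^sub>0 * (2 * 0))"
    using LIMSEQ_inverse_real_of_nat by (intro tendsto_intros) (simp add: inverse_eq_divide)
  then have lim0: "(\<lambda>n. - (A\<^sub>0 * (2 * (1 / real (Suc n))))) \<longlonglongrightarrow> 0" by simp
  have "0 \<le> (LINT x|lebesgue. Q x)"
  proof (rule LIMSEQ_le[OF lim0 lim], intro exI[of _ 0] allI impI)
    fix n
    have lr: "l n \<le> r n" using rl(1)[of n] rl(2)[of n] by linarith
    have "\<rho> (r n) + \<rho> (l n) \<le> 2 * (1 / real (Suc n))" using rl(1)[of n] rl(2)[of n] by linarith
    then have "A\<^sub>0 * (\<rho> (r n) + \<rho> (l n)) \<le> A\<^sub>0 * (2 * (1 / real (Suc n)))"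
      using A0_pos by (intro mult_left_mono) auto
    then show "- (A\<^sub>0 * (2 * (1 / real (Suc n)))) \<le> (LINT x|lebesgue. indicator {l n..r n} x *\<^sub>R Q x)"
      using bound[OF lr] by linarith
  qed
  then show ?thesis unfolding Q_def .
qed

text \<open>
  For \<open>c = a(x)\<close>, the function \<open>(q\<^sup>2 - c\<^sup>2) cos\<^sup>2 \<phi>\<close> decreases to \<open>0\<close> on \<open>[x, \<infinity>)\<close>.
\<close>

lemma q_ge_a:
  assumes mono: "mono_on {0<..} a" and x: "x \<noteq> 0"
  shows "a x \<le> q x"
proof -
  have pos: "a x \<le> q x" if x: "0 < x" for x
  proof -
    define c where "c = a x"
    have c: "c > 0" unfolding c_def by (rule a_pos)
    \<comment> \<open>\<open>W = (a \<phi>')\<^sup>2 - c\<^sup>2 cos\<^sup>2 \<phi>\<close>, up to a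
      factor the first integral of the pendulum with constant weight \<open>c\<close>. For the
      variable weight it is monotone because \<open>c \<le> a y\<close> beyond
      \<open>x\<close>.\<close>
    define W where "W y = ((q y)\<^sup>2 - c\<^sup>2) * (C y)\<^sup>2" for y
    have q2: "primitive_on l r (\<lambda>y. q y * q y - c\<^sup>2)
       (\<lambda>y. q y * (((q y)\<^sup>2 / a y - a y) * tanh (\<tau> y)) + (((q y)\<^sup>2 / a y - a y) * tanh (\<tau> y)) * q y - 0)" for l r
      by (intro primitive_on_diff primitive_on_const primitive_on_bilinear[OF bounded_bilinear_mult q_primitive_all q_primitive_all])
    have C2: "primitive_on l r (\<lambda>y. C y * C y) (\<lambda>y. C y * - (S y * C y * q y / a y) + - (S y * C y * q y / a y) * C y)" for l r
      by (rule primitive_on_bilinear[OF bounded_bilinear_mult C_primitive C_primitive])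
    define W' where "W' y = (q y * q y - c\<^sup>2) * (C y * - (S y * C y * q y / a y) + - (S y * C y * q y / a y) * C y) +
       (q y * (((q y)\<^sup>2 / a y - a y) * tanh (\<tau> y)) + (((q y)\<^sup>2 / a y - a y) * tanh (\<tau> y)) * q y - 0) * (C y * C y)" for y
    have W: "primitive_on l r (\<lambda>y. (q y * q y - c\<^sup>2) * (C y * C y)) W'" for l r
      unfolding W'_def by (rule primitive_on_bilinear[OF bounded_bilinear_mult q2 C2])
    have W'le: "W' y \<le> 0" if y: "x \<le> y" for y
    proof -
      have "c \<le> a y" unfolding c_def using mono x y by (auto simp: mono_on_def)
      then have ca: "c\<^sup>2 \<le> (a y)\<^sup>2" using c by (intro power_mono) auto
      have "W' y = (2 * (q y / a y) * (S y) * (C y)\<^sup>2) * (c\<^sup>2 - (a y)\<^sup>2)"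
      proof -
        define k where "k = q y / a y"
        have k: "q y = k * a y" using a_pos[of y] by (simp add: k_def)
        have e1: "(q y)\<^sup>2 / a y = k * q y" by (simp add: k_def power2_eq_square)
        have e2: "S y * C y * q y / a y = S y * C y * k" by (simp add: k_def)
        show ?thesis unfolding W'_def S_def[symmetric] e1 e2 k_def[symmetric] unfolding k by algebra
      qed
      moreover have "0 \<le> 2 * (q y / a y) * (S y) * (C y)\<^sup>2"
        using slope(3)[of y] S_sign(1)[of y] x y by (intro mult_nonneg_nonneg) auto
      moreover have "c\<^sup>2 - (a y)\<^sup>2 \<le> 0" using ca by simp
      ultimately show ?thesis by (simp only: mult_nonneg_nonpos)
    qed
    have Wle: "W r \<le> W x" if r: "x \<le> r" for r
    proof -
      have "(W' has_integral ((q r * q r - c\<^sup>2) * (C r * C r) - (q x * q x - c\<^sup>2) * (C x * C x))) {x..r}"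
        by (rule primitive_onD[OF W order_refl r order_refl])
      then have "(q r * q r - c\<^sup>2) * (C r * C r) - (q x * q x - c\<^sup>2) * (C x * C x) \<le> 0"
        by (rule has_integral_le[OF _ has_integral_0]) (use W'le in auto)
      then show ?thesis by (simp add: W_def power2_eq_square)
    qed
    \<comment> \<open>\<open>- c\<^sup>2 C\<^sup>2\<close> is a lower bound of \<open>W\<close>
      tending to \<open>0\<close>; as \<open>W\<close> is non-increasing,
      \<open>W x \<ge> 0\<close>.\<close>
    have lim: "((\<lambda>r. - (c\<^sup>2) * (C r)\<^sup>2) \<longlongrightarrow> - (c\<^sup>2) * 0\<^sup>2) at_top"
      by (intro tendsto_intros C_limits)
    have "eventually (\<lambda>r. - (c\<^sup>2) * (C r)\<^sup>2 \<le> W x) at_top"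
      using eventually_ge_at_top[of x]
    proof eventually_elim
      fix r assume "x \<le> r"
      have "- (c\<^sup>2) * (C r)\<^sup>2 \<le> W r" unfolding W_def by (intro mult_right_mono) auto
      then show "- (c\<^sup>2) * (C r)\<^sup>2 \<le> W x" using Wle[OF \<open>x \<le> r\<close>] by linarith
    qed
    then have "- (c\<^sup>2) * 0\<^sup>2 \<le> W x" by (intro tendsto_upperbound[OF lim]) auto
    then have "c\<^sup>2 \<le> (q x)\<^sup>2" using S_C(2)[of x] by (simp add: W_def zero_le_mult_iff)
    then show ?thesis using q_pos[of x] by (auto simp: c_def intro: power2_le_imp_le)
  qed
  show ?thesis
    using pos[of x] pos[of "- x"] x a_even[of x] q_even[of x] by (cases "x > 0") auto
qed

end

subsection \<open>The second variation\<close>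

text \<open>Difference quotients along an arbitrary sequence are dominated by \<open>K\<close>
  through the mean value theorem. Measurability of the limit \<open>F' t0\<close> comes from that of
  the quotients.\<close>

lemma has_derivative_under_integral:
  fixes F F' :: "real \<Rightarrow> real \<Rightarrow> real"
  assumes d: "0 < d"
    and int: "\<And>t. \<bar>t - t0\<bar> < d \<Longrightarrow> integrable lebesgue (F t)"
    and der: "\<And>t x. \<bar>t - t0\<bar> < d \<Longrightarrow> ((\<lambda>t. F t x) has_real_derivative F' t x) (at t)"
    and bd: "\<And>t x. \<bar>t - t0\<bar> < d \<Longrightarrow> \<bar>F' t x\<bar> \<le> K x" and K: "integrable lebesgue K"
  shows "((\<lambda>t. LINT x|lebesgue. F t x) has_real_derivative (LINT x|lebesgue. F' t0 x)) (at t0)"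
  unfolding DERIV_def tendsto_at_iff_sequentially
proof (intro allI impI)
  fix X :: "nat \<Rightarrow> real" assume X0: "\<forall>i. X i \<in> UNIV - {0}" and X: "X \<longlonglongrightarrow> 0"
  \<comment> \<open>The value \<open>0\<close> for the finitely many large \<open>X n\<close> keeps
    the domination valid for every \<open>n\<close>.\<close>
  define s where "s n x = (if \<bar>X n\<bar> < d then (F (t0 + X n) x - F t0 x) / X n else 0)" for n x
  have ev: "eventually (\<lambda>n. \<bar>X n\<bar> < d) sequentially"
    using order_tendstoD(2)[OF tendsto_rabs_zero[OF X] d] .
  have int0: "integrable lebesgue (F t0)" by (rule int) (use d in simp)
  have sint: "integrable lebesgue (s n)" for n
  proof (cases "\<bar>X n\<bar> < d")
    case True
    then have "integrable lebesgue (\<lambda>x. (F (t0 + X n) x - F t0 x) / X n)"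
      by (intro integrable_divide Bochner_Integration.integrable_diff int int0) simp
    then show ?thesis using True by (simp add: s_def[abs_def])
  qed (simp add: s_def[abs_def])
  have slim: "(\<lambda>n. s n x) \<longlonglongrightarrow> F' t0 x" for x
  proof -
    have "((\<lambda>h. (F (t0 + h) x - F t0 x) / h) \<longlongrightarrow> F' t0 x) (at 0)"
      using der[of t0 x] d unfolding DERIV_def by simp
    then have "((\<lambda>h. (F (t0 + h) x - F t0 x) / h) \<circ> X) \<longlonglongrightarrow> F' t0 x"
      unfolding tendsto_at_iff_sequentially using X0 X by blast
    then show ?thesis
    proof (rule Lim_transform_eventually)
      show "eventually (\<lambda>n. ((\<lambda>h. (F (t0 + h) x - F t0 x) / h) \<circ> X) n = s n x) sequentially"
        using ev by eventually_elim (simp add: s_def)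
    qed
  qed
  have sb: "norm (s n x) \<le> K x" for n x
  proof (cases "\<bar>X n\<bar> < d")
    case True
    have "norm (F (t0 + X n) x - F t0 x) \<le> K x * norm (t0 + X n - t0)"
    proof (rule field_differentiable_bound[where S = "ball t0 d" and f' = "\<lambda>t. F' t x"])
      show "((\<lambda>t. F t x) has_field_derivative F' z x) (at z within ball t0 d)" if "z \<in> ball t0 d" for z
        using der[of z x] that by (auto simp: dist_real_def abs_minus_commute intro: has_field_derivative_at_within)
      show "norm (F' z x) \<le> K x" if "z \<in> ball t0 d" for z
        using bd[of z x] that by (simp add: dist_real_def abs_minus_commute)
    qed (use True d in \<open>auto simp: dist_real_def\<close>)
    then show ?thesis using True X0 by (simp add: s_def abs_divide divide_le_eq)
  next
    case False
    have "0 \<le> K x" using bd[of t0 x] d by (simp add: order_trans[OF abs_ge_zero])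
    then show ?thesis using False by (simp add: s_def)
  qed
  have "(\<lambda>n. LINT x|lebesgue. s n x) \<longlonglongrightarrow> (LINT x|lebesgue. F' t0 x)"
  proof (rule integral_dominated_convergence[where w = K])
    show "F' t0 \<in> borel_measurable lebesgue"
      by (rule borel_measurable_LIMSEQ_real[where u = s]) (use slim sint in \<open>auto intro: borel_measurable_integrable\<close>)
    show "s n \<in> borel_measurable lebesgue" for n by (rule borel_measurable_integrable[OF sint])
  qed (use K slim sb in auto)
  then show "((\<lambda>h. ((LINT x|lebesgue. F (t0 + h) x) - (LINT x|lebesgue. F t0 x)) / h) \<circ> X) \<longlonglongrightarrow> (LINT x|lebesgue. F' t0 x)"
  proof (rule Lim_transform_eventually)
    show "eventually (\<lambda>n. (LINT x|lebesgue. s n x) =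
       ((\<lambda>h. ((LINT x|lebesgue. F (t0 + h) x) - (LINT x|lebesgue. F t0 x)) / h) \<circ> X) n) sequentially"
      using ev
    proof eventually_elim
      case (elim n)
      have "(LINT x|lebesgue. s n x) = (LINT x|lebesgue. (F (t0 + X n) x - F t0 x) / X n)"
        using elim by (simp add: s_def)
      also have "\<dots> = ((LINT x|lebesgue. F (t0 + X n) x) - (LINT x|lebesgue. F t0 x)) / X n"
        using Bochner_Integration.integral_diff[OF int[of "t0 + X n"] int0] elim by simp
      finally show ?case by simp
    qed
  qed
qed

text \<open>
  Since \<open>\<bar>m + t v\<bar>\<^sup>2 = 1 + t\<^sup>2\<bar>v\<bar>\<^sup>2\<close>, the perturbed energy density is a combination of these functions of
  \<open>t\<close> and \<open>y = \<bar>v\<bar>\<^sup>2\<close>, and they are closed under \<open>d/dt\<close>.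
\<close>

definition rat_monom :: "nat \<Rightarrow> nat \<Rightarrow> nat \<Rightarrow> real \<Rightarrow> real \<Rightarrow> real" where
  "rat_monom k j i t y = y ^ i * (t ^ k * inverse (1 + t\<^sup>2 * y) ^ j)"

text \<open>For \<open>k = 0\<close> the truncated exponent \<open>k - 1\<close> is harmless, as its
  term carries the factor \<open>real k = 0\<close>. Differentiating the \<open>j\<close>-th power
  raises all three indices by one.\<close>

lemma rat_monom_derivative:
  assumes "0 \<le> y"
  shows "((\<lambda>t. rat_monom k j i t y) has_real_derivative
    real k * rat_monom (k - 1) j i t y - 2 * real j * rat_monom (k + 1) (j + 1) (i + 1) t y) (at t)"
proof -
  have s: "1 + t\<^sup>2 * y > 0" using assms by (simp add: add_pos_nonneg)
  define r where "r = inverse (1 + t\<^sup>2 * y)"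
  have d0: "((\<lambda>t. 1 + t\<^sup>2 * y) has_real_derivative 2 * t * y) (at t)"
    by (auto intro!: derivative_eq_intros)
  have d1: "((\<lambda>t. inverse (1 + t\<^sup>2 * y)) has_real_derivative - (r * (2 * t * y) * r)) (at t)"
    unfolding r_def using DERIV_inverse'[OF d0] s by simp
  have d2: "((\<lambda>t. inverse (1 + t\<^sup>2 * y) ^ j) has_real_derivative real j * (- (r * (2 * t * y) * r) * r ^ (j - 1))) (at t)"
    using DERIV_power[OF d1, of j] by (simp add: r_def)
  have d3: "((\<lambda>t. t ^ k) has_real_derivative real k * t ^ (k - 1)) (at t)"
    using DERIV_pow[of k t] by simp
  have A: "((\<lambda>t. rat_monom k j i t y) has_real_derivative
     y ^ i * (real k * t ^ (k - 1) * r ^ j + real j * (- (r * (2 * t * y) * r) * r ^ (j - 1)) * t ^ k)) (at t)"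
    unfolding rat_monom_def using DERIV_cmult[OF DERIV_mult[OF d3 d2], of "y ^ i"] by (simp add: r_def)
  have e: "real j * (- (r * (2 * t * y) * r) * r ^ (j - 1)) = - 2 * real j * (t * y) * r ^ (j + 1)"
    by (cases j) (simp_all add: algebra_simps)
  have "((\<lambda>t. rat_monom k j i t y) has_real_derivative
     y ^ i * (real k * t ^ (k - 1) * r ^ j + - 2 * real j * (t * y) * r ^ (j + 1) * t ^ k)) (at t)"
    using A unfolding e .
  moreover have "y ^ i * (real k * t ^ (k - 1) * r ^ j + - 2 * real j * (t * y) * r ^ (j + 1) * t ^ k)
     = real k * rat_monom (k - 1) j i t y - 2 * real j * rat_monom (k + 1) (j + 1) (i + 1) t y"
    by (simp add: rat_monom_def r_def algebra_simps)
  ultimately show ?thesis by simp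
qed

lemma rat_monom_bound:
  assumes "0 \<le> y" "y \<le> B" "\<bar>t\<bar> \<le> 1"
  shows "\<bar>rat_monom k j i t y\<bar> \<le> B ^ i"
proof -
  have s: "0 < inverse (1 + t\<^sup>2 * y)" "inverse (1 + t\<^sup>2 * y) \<le> 1"
    using assms by (auto simp: add_pos_nonneg inverse_le_1_iff)
  have "\<bar>t ^ k * inverse (1 + t\<^sup>2 * y) ^ j\<bar> \<le> 1 * 1"
    unfolding abs_mult power_abs using s assms(3) by (intro mult_mono power_le_one) auto
  then have "\<bar>y ^ i\<bar> * \<bar>t ^ k * inverse (1 + t\<^sup>2 * y) ^ j\<bar> \<le> B ^ i * 1"
    using assms by (intro mult_mono) (auto simp: power_mono)
  then show ?thesis unfolding rat_monom_def abs_mult by simp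
qed

lemma rat_monom_measurable:
  "\<rho> \<in> borel_measurable M \<Longrightarrow> (\<lambda>x. rat_monom k j i t (\<rho> x)) \<in> borel_measurable M"
  unfolding rat_monom_def
  by (intro borel_measurable_times borel_measurable_power borel_measurable_inverse borel_measurable_add borel_measurable_const)

definition rat_integral :: "(real \<Rightarrow> real) \<Rightarrow> (real \<Rightarrow> real) \<Rightarrow> nat \<Rightarrow> nat \<Rightarrow> nat \<Rightarrow> real \<Rightarrow> real" where
  "rat_integral f \<rho> k j i t = (LINT x|lebesgue. f x * rat_monom k j i t (\<rho> x))"

context
  fixes f \<rho> :: "real \<Rightarrow> real" and B :: real
  assumes f: "integrable lebesgue f" and \<rho>: "\<rho> \<in> borel_measurable lebesgue"
    and B: "\<And>x. 0 \<le> \<rho> x" "\<And>x. \<rho> x \<le> B"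
begin

lemma integrable_rat: "\<bar>t\<bar> \<le> 1 \<Longrightarrow> integrable lebesgue (\<lambda>x. f x * rat_monom k j i t (\<rho> x))"
  using integrable_bounded_mult[OF rat_monom_measurable[OF \<rho>] rat_monom_bound[OF B] f, of t k j i]
  by (simp add: mult.commute)

lemma rat_integral_derivative:
  assumes t: "\<bar>t\<bar> < 1"
  shows "((\<lambda>t. rat_integral f \<rho> k j i t) has_real_derivative
    real k * rat_integral f \<rho> (k - 1) j i t - 2 * real j * rat_integral f \<rho> (k + 1) (j + 1) (i + 1) t) (at t)"
proof -
  define F' where "F' s x = f x * (real k * rat_monom (k - 1) j i s (\<rho> x) - 2 * real j * rat_monom (k + 1) (j + 1) (i + 1) s (\<rho> x))" for s x
  \<comment> \<open>The radius \<open>1 - \<bar>t\<bar>\<close> keeps \<open>s\<close> inside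
    \<open>[-1, 1]\<close>, where the monomials have bounds uniform in \<open>x\<close>.\<close>
  have near: "\<bar>s\<bar> \<le> 1" if "\<bar>s - t\<bar> < 1 - \<bar>t\<bar>" for s using that by linarith
  have "((\<lambda>s. LINT x|lebesgue. f x * rat_monom k j i s (\<rho> x)) has_real_derivative (LINT x|lebesgue. F' t x)) (at t)"
  proof (rule has_derivative_under_integral[where d = "1 - \<bar>t\<bar>" and K = "\<lambda>x. (real k * B ^ i + 2 * real j * B ^ (i + 1)) * \<bar>f x\<bar>"])
    show "0 < 1 - \<bar>t\<bar>" using t by simp
    show "integrable lebesgue (\<lambda>x. f x * rat_monom k j i s (\<rho> x))" if "\<bar>s - t\<bar> < 1 - \<bar>t\<bar>" for s
      by (rule integrable_rat[OF near[OF that]])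
    show "((\<lambda>s. f x * rat_monom k j i s (\<rho> x)) has_real_derivative F' s x) (at s)" for s x
      unfolding F'_def by (rule DERIV_cmult[OF rat_monom_derivative[OF B(1)]])
    show "integrable lebesgue (\<lambda>x. (real k * B ^ i + 2 * real j * B ^ (i + 1)) * \<bar>f x\<bar>)"
      using f by (intro integrable_mult_right) auto
    show "\<bar>F' s x\<bar> \<le> (real k * B ^ i + 2 * real j * B ^ (i + 1)) * \<bar>f x\<bar>" if s: "\<bar>s - t\<bar> < 1 - \<bar>t\<bar>" for s x
    proof -
      have "\<bar>real k * rat_monom (k - 1) j i s (\<rho> x) - 2 * real j * rat_monom (k + 1) (j + 1) (i + 1) s (\<rho> x)\<bar>
        \<le> real k * \<bar>rat_monom (k - 1) j i s (\<rho> x)\<bar> + 2 * real j * \<bar>rat_monom (k + 1) (j + 1) (i + 1) s (\<rho> x)\<bar>"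
        by (rule order_trans[OF abs_triangle_ineq4]) (simp add: abs_mult)
      also have "\<dots> \<le> real k * B ^ i + 2 * real j * B ^ (i + 1)"
        by (intro add_mono mult_left_mono rat_monom_bound B near s) auto
      finally have "\<bar>f x\<bar> * \<bar>real k * rat_monom (k - 1) j i s (\<rho> x) - 2 * real j * rat_monom (k + 1) (j + 1) (i + 1) s (\<rho> x)\<bar>
        \<le> \<bar>f x\<bar> * (real k * B ^ i + 2 * real j * B ^ (i + 1))" by (rule mult_left_mono) simp
      then show ?thesis unfolding F'_def abs_mult by (simp only: mult.commute)
    qed
  qed
  moreover have "(LINT x|lebesgue. F' t x) =
     real k * rat_integral f \<rho> (k - 1) j i t - 2 * real j * rat_integral f \<rho> (k + 1) (j + 1) (i + 1) t"
  proof -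
    have "\<bar>t\<bar> \<le> 1" using t by simp
    note i1 = integrable_mult_right[OF integrable_rat[OF this, of "k - 1" j i], of "real k"]
      and i2 = integrable_mult_right[OF integrable_rat[OF this, of "k + 1" "j + 1" "i + 1"], of "2 * real j"]
    have "F' t x = real k * (f x * rat_monom (k - 1) j i t (\<rho> x)) - 2 * real j * (f x * rat_monom (k + 1) (j + 1) (i + 1) t (\<rho> x))" for x
      unfolding F'_def by (simp only: right_diff_distrib mult.left_commute)
    then have "(LINT x|lebesgue. F' t x) = (LINT x|lebesgue. real k * (f x * rat_monom (k - 1) j i t (\<rho> x)))
      - (LINT x|lebesgue. 2 * real j * (f x * rat_monom (k + 1) (j + 1) (i + 1) t (\<rho> x)))"
      using Bochner_Integration.integral_diff[OF i1 i2] by simp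
    then show ?thesis unfolding rat_integral_def integral_mult_right_zero .
  qed
  ultimately show ?thesis unfolding rat_integral_def by simp
qed

text \<open>The derivative rule applied twice; with unreduced indices one statement covers all
  monomials.\<close>

lemma rat_integral_second_deriv:
  "has_second_deriv (\<lambda>t. rat_integral f \<rho> k j i t)
     (real k * (real (k - 1) * rat_integral f \<rho> (k - 1 - 1) j i 0 - 2 * real j * rat_integral f \<rho> (k - 1 + 1) (j + 1) (i + 1) 0)
      - 2 * real j * (real (k + 1) * rat_integral f \<rho> (k + 1 - 1) (j + 1) (i + 1) 0
          - 2 * real (j + 1) * rat_integral f \<rho> (k + 1 + 1) (j + 1 + 1) (i + 1 + 1) 0)) 0"
  unfolding has_second_deriv_def
proof (intro exI conjI)
  have "eventually (\<lambda>t. t \<in> {- 1<..<1}) (nhds (0::real))" by (rule eventually_nhds_in_open) auto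
  then show "\<forall>\<^sub>F t in nhds 0. ((\<lambda>t. rat_integral f \<rho> k j i t) has_real_derivative
     real k * rat_integral f \<rho> (k - 1) j i t - 2 * real j * rat_integral f \<rho> (k + 1) (j + 1) (i + 1) t) (at t)"
    by eventually_elim (rule rat_integral_derivative, auto)
qed (intro DERIV_diff DERIV_cmult rat_integral_derivative; simp)

end

lemma has_second_deriv_add:
  assumes "has_second_deriv F D t" "has_second_deriv G E t"
  shows "has_second_deriv (\<lambda>t. F t + G t) (D + E) t"
proof -
  obtain F' G' where
    "\<forall>\<^sub>F s in nhds t. (F has_real_derivative F' s) (at s)" "(F' has_real_derivative D) (at t)"
    "\<forall>\<^sub>F s in nhds t. (G has_real_derivative G' s) (at s)" "(G' has_real_derivative E) (at t)"
    using assms unfolding has_second_deriv_def by blast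
  then have *: "\<forall>\<^sub>F s in nhds t. ((\<lambda>s. F s + G s) has_real_derivative F' s + G' s) (at s)"
    "((\<lambda>s. F' s + G' s) has_real_derivative D + E) (at t)"
    by (auto elim: eventually_elim2 intro: DERIV_add)
  show ?thesis unfolding has_second_deriv_def by (rule exI[of _ "\<lambda>s. F' s + G' s"], rule conjI, rule *, rule *)
qed

lemma has_second_deriv_cmult:
  assumes "has_second_deriv F D t"
  shows "has_second_deriv (\<lambda>t. c * F t) (c * D) t"
proof -
  obtain F' where
    "\<forall>\<^sub>F s in nhds t. (F has_real_derivative F' s) (at s)" "(F' has_real_derivative D) (at t)"
    using assms unfolding has_second_deriv_def by blast
  then have *: "\<forall>\<^sub>F s in nhds t. ((\<lambda>s. c * F s) has_real_derivative c * F' s) (at s)"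
    "((\<lambda>s. c * F' s) has_real_derivative c * D) (at t)"
    by (auto elim: eventually_mono intro: DERIV_cmult)
  show ?thesis unfolding has_second_deriv_def by (rule exI[of _ "\<lambda>s. c * F' s"], rule conjI, rule *, rule *)
qed

lemma has_second_deriv_cong:
  assumes "has_second_deriv F D t" "\<forall>\<^sub>F s in nhds t. G s = F s"
  shows "has_second_deriv G D t"
proof -
  obtain F' where F': "\<forall>\<^sub>F s in nhds t. (F has_real_derivative F' s) (at s)" "(F' has_real_derivative D) (at t)"
    using assms(1) unfolding has_second_deriv_def by blast
  have "\<forall>\<^sub>F s in nhds t. \<forall>\<^sub>F r in nhds s. G r = F r"
    using assms(2) by (simp add: eventually_eventually)
  with F'(1) have "\<forall>\<^sub>F s in nhds t. (G has_real_derivative F' s) (at s)"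
    by eventually_elim (simp add: DERIV_cong_ev[OF refl _ refl])
  then show ?thesis using F'(2) unfolding has_second_deriv_def by blast
qed

lemma norm_square_combination:
  fixes x y :: "'a::real_inner"
  shows "(norm (h *\<^sub>R x + k *\<^sub>R y))\<^sup>2 = h\<^sup>2 * (norm x)\<^sup>2 + 2 * h * k * (x \<bullet> y) + k\<^sup>2 * (norm y)\<^sup>2"
  unfolding power2_norm_eq_inner
  by (simp add: inner_add_left inner_add_right inner_commute power2_eq_square algebra_simps)

section \<open>Expansion of the perturbed energy in the parameter \<open>t\<close>\<close>

context symmetric_wall
begin

lemma perturbation_eq:
  assumes orth: "\<And>x. v x \<bullet> M x = 0"
  shows "(norm (M x + t *\<^sub>R v x))\<^sup>2 = 1 + t\<^sup>2 * (norm (v x))\<^sup>2"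
    "perturbation M v t x = (1 / sqrt (1 + t\<^sup>2 * (norm (v x))\<^sup>2)) *\<^sub>R (M x + t *\<^sub>R v x)"
proof -
  show 1: "(norm (M x + t *\<^sub>R v x))\<^sup>2 = 1 + t\<^sup>2 * (norm (v x))\<^sup>2"
    using norm_square_combination[of 1 "M x" t "v x"] orth[of x] norm_M[of x] by (simp add: inner_commute)
  show "perturbation M v t x = (1 / sqrt (1 + t\<^sup>2 * (norm (v x))\<^sup>2)) *\<^sub>R (M x + t *\<^sub>R v x)"
    unfolding perturbation_def 1[symmetric] by simp
qed

text \<open>Half the coefficient of \<open>t\<close> before normalisation, the density of the first
  variation. Its factor \<open>t / (1 + t\<^sup>2 y)\<close> is odd in \<open>t\<close> and
  contributes nothing to the second derivative at \<open>0\<close>.\<close>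

definition first_coeff :: "(real \<Rightarrow> real^3) \<Rightarrow> real \<Rightarrow> real" where
  "first_coeff v x = a x * (dM x \<bullet> weak_deriv v x) + a x * (C x * v x $ 2)"

text \<open>Produced by differentiating the normalising factor; it comes with
  \<open>t\<^sup>4\<close> and so drops out of the second variation.\<close>

definition quartic_coeff :: "(real \<Rightarrow> real^3) \<Rightarrow> real \<Rightarrow> real" where
  "quartic_coeff v x = a x * (v x \<bullet> weak_deriv v x)\<^sup>2"

definition perturbed_density :: "(real \<Rightarrow> real^3) \<Rightarrow> real \<Rightarrow> real \<Rightarrow> real" where
  "perturbed_density v t x = dens x * rat_monom 0 1 0 t ((norm (v x))\<^sup>2)
     + 2 * (first_coeff v x * rat_monom 1 1 0 t ((norm (v x))\<^sup>2))
     + hessian v x * rat_monom 2 1 0 t ((norm (v x))\<^sup>2)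
     + - 1 * (quartic_coeff v x * rat_monom 4 2 0 t ((norm (v x))\<^sup>2))"

text \<open>With \<open>s = \<bar>M + t v\<bar>\<^sup>2\<close> and
  \<open>w = v \<bullet> v'\<close>, tangency gives
  \<open>(M + t v)' \<bullet> (M + t v) = t\<^sup>2 w\<close>, so normalisation turns the squared
  derivative into \<open>\<bar>(M + t v)'\<bar>\<^sup>2 / s - t\<^sup>4 w\<^sup>2 /
  s\<^sup>2\<close>.\<close>

lemma energy_perturbation:
  assumes vH: "v \<in> H1" and orth: "\<And>x. v x \<bullet> M x = 0"
  shows "energy a (perturbation M v t) = (\<integral>\<^sup>+x. ennreal (perturbed_density v t x) \<partial>lebesgue)"
    and "AE x in lebesgue. 0 \<le> perturbed_density v t x"
proof -
  define v' where "v' = weak_deriv v"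
  define s where "s x = 1 + t\<^sup>2 * (norm (v x))\<^sup>2" for x
  define h where "h x = 1 / sqrt (s x)" for x
  define k where "k x = - (t\<^sup>2 / 2) / (s x * sqrt (s x)) * (2 * (v x \<bullet> v' x))" for x
  define P' where "P' x = h x *\<^sub>R (dM x + t *\<^sub>R v' x) + k x *\<^sub>R (M x + t *\<^sub>R v x)" for x
  have s: "s x > 0" for x by (simp add: s_def add_pos_nonneg)
  have pv: "primitive_on l r v v'" for l r unfolding v'_def by (rule H1_properties(3)[OF vH])
  have ph: "primitive_on l r h k" for l r
  proof -
    have "primitive_on l r (\<lambda>x. 1 / sqrt (1 + t\<^sup>2 * (norm (v x))\<^sup>2)) (\<lambda>x. - (t\<^sup>2 / 2) / ((1 + t\<^sup>2 * (norm (v x))\<^sup>2) * sqrt (1 + t\<^sup>2 * (norm (v x))\<^sup>2)) * (2 * (v x \<bullet> v' x)))"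
    proof (rule primitive_on_chain[OF norm_square_primitive[OF pv], where H = "\<lambda>y. 1 / sqrt (1 + t\<^sup>2 * y)"
          and H' = "\<lambda>y. - (t\<^sup>2 / 2) / ((1 + t\<^sup>2 * y) * sqrt (1 + t\<^sup>2 * y))"])
      fix x
      have p: "1 + t\<^sup>2 * (norm (v x))\<^sup>2 > 0" using s[of x] by (simp add: s_def)
      define y where "y = (norm (v x))\<^sup>2"
      have p': "1 + t\<^sup>2 * y > 0" using p by (simp add: y_def)
      have D: "((\<lambda>y. sqrt (1 + t\<^sup>2 * y)) has_real_derivative inverse (sqrt (1 + t\<^sup>2 * y)) / 2 * t\<^sup>2) (at y)"
        by (rule DERIV_chain2[where f = sqrt and g = "\<lambda>y. 1 + t\<^sup>2 * y", OF DERIV_real_sqrt[OF p']]) (auto intro!: derivative_eq_intros)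
      have A: "((\<lambda>y. inverse (sqrt (1 + t\<^sup>2 * y))) has_real_derivative
          - (inverse (sqrt (1 + t\<^sup>2 * y)) * (inverse (sqrt (1 + t\<^sup>2 * y)) / 2 * t\<^sup>2) * inverse (sqrt (1 + t\<^sup>2 * y)))) (at y)"
        by (rule DERIV_inverse'[OF D]) (use p' in simp)
      have e: "- (inverse (sqrt (1 + t\<^sup>2 * y)) * (inverse (sqrt (1 + t\<^sup>2 * y)) / 2 * t\<^sup>2) * inverse (sqrt (1 + t\<^sup>2 * y)))
         = - (t\<^sup>2 / 2) / ((1 + t\<^sup>2 * y) * sqrt (1 + t\<^sup>2 * y))"
      proof -
        define z where "z = sqrt (1 + t\<^sup>2 * y)"
        have z: "1 + t\<^sup>2 * y = z * z" using p' by (simp add: z_def)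
        show ?thesis unfolding z_def[symmetric] unfolding z by (simp add: inverse_eq_divide)
      qed
      show "((\<lambda>y. 1 / sqrt (1 + t\<^sup>2 * y)) has_real_derivative
          - (t\<^sup>2 / 2) / ((1 + t\<^sup>2 * (norm (v x))\<^sup>2) * sqrt (1 + t\<^sup>2 * (norm (v x))\<^sup>2))) (at ((norm (v x))\<^sup>2))"
        using A unfolding e unfolding inverse_eq_divide y_def .
    next
      have "1 + t\<^sup>2 * y > 0" if "y \<in> (\<lambda>x. (norm (v x))\<^sup>2) ` {l..r}" for y
        using that by (auto simp: add_pos_nonneg)
      then show "continuous_on ((\<lambda>x. (norm (v x))\<^sup>2) ` {l..r}) (\<lambda>y. - (t\<^sup>2 / 2) / ((1 + t\<^sup>2 * y) * sqrt (1 + t\<^sup>2 * y)))"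
        by (intro continuous_intros) fastforce
    qed
    then show ?thesis unfolding h_def k_def s_def .
  qed
  have pP: "primitive_on l r (perturbation M v t) P'" for l r
  proof -
    have "primitive_on l r (\<lambda>x. M x + t *\<^sub>R v x) (\<lambda>x. dM x + t *\<^sub>R v' x)"
      by (intro primitive_on_add M_primitive primitive_on_linear[OF pv] bounded_linear_scaleR_right)
    from primitive_on_bilinear[OF bounded_bilinear_scaleR ph this]
    show ?thesis unfolding P'_def[abs_def] perturbation_eq(2)[OF orth, abs_def] h_def s_def .
  qed
  have dens: "AE x in lebesgue. a x * (norm (P' x))\<^sup>2 + a x * ((perturbation M v t x $ 2)\<^sup>2 + (perturbation M v t x $ 3)\<^sup>2)
      = perturbed_density v t x"
    using tangent_AE[OF vH orth]
  proof eventually_elim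
    case (elim x)
    define w where "w = v x \<bullet> v' x"
    define r where "r = inverse (s x)"
    have sq: "sqrt (s x) * sqrt (s x) = s x" using s[of x] by simp
    have rs: "r * s x = 1" using s[of x] by (simp add: r_def)
    have h2: "(h x)\<^sup>2 = r" unfolding h_def r_def using s[of x] by (simp add: power_divide inverse_eq_divide)
    \<comment> \<open>The normalising factor satisfies \<open>h' = - t\<^sup>2 w h / s\<close>, so
      every term of the squared derivative carries \<open>h\<^sup>2 = 1 / s\<close>.\<close>
    have kh: "k x = - (t\<^sup>2 * w * r) * h x"
      unfolding k_def h_def r_def w_def by (simp add: inverse_eq_divide)
    have MdM: "dM x \<bullet> M x = 0"
      by (simp add: inner_vec3 dM_def M_components algebra_simps)
    have AB: "(dM x + t *\<^sub>R v' x) \<bullet> (M x + t *\<^sub>R v x) = t\<^sup>2 * w"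
    proof -
      have "(dM x + t *\<^sub>R v' x) \<bullet> (M x + t *\<^sub>R v x) = dM x \<bullet> M x + t * (v x \<bullet> dM x + v' x \<bullet> M x) + t\<^sup>2 * (v x \<bullet> v' x)"
        by (simp add: inner_add_left inner_add_right inner_commute power2_eq_square algebra_simps)
      then show ?thesis using elim MdM by (simp add: w_def v'_def)
    qed
    have BB: "(norm (M x + t *\<^sub>R v x))\<^sup>2 = s x" unfolding s_def by (rule perturbation_eq(1)[OF orth])
    have AA: "(norm (dM x + t *\<^sub>R v' x))\<^sup>2 = (norm (dM x))\<^sup>2 + 2 * t * (dM x \<bullet> v' x) + t\<^sup>2 * (norm (v' x))\<^sup>2"
      using norm_square_combination[of 1 "dM x" t "v' x"] by simp
    have nP: "(norm (P' x))\<^sup>2 = r * (norm (dM x + t *\<^sub>R v' x))\<^sup>2 - t ^ 4 * w\<^sup>2 * r\<^sup>2"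
    proof -
      have "(norm (P' x))\<^sup>2 = (h x)\<^sup>2 * (norm (dM x + t *\<^sub>R v' x))\<^sup>2 + 2 * h x * k x * (t\<^sup>2 * w) + (k x)\<^sup>2 * s x"
        unfolding P'_def norm_square_combination AB BB ..
      also have "\<dots> = (h x)\<^sup>2 * (norm (dM x + t *\<^sub>R v' x))\<^sup>2 - 2 * (h x)\<^sup>2 * r * t ^ 4 * w\<^sup>2 + (h x)\<^sup>2 * (r * s x) * r * t ^ 4 * w\<^sup>2"
        unfolding kh by algebra
      also have "\<dots> = r * (norm (dM x + t *\<^sub>R v' x))\<^sup>2 - t ^ 4 * w\<^sup>2 * r\<^sup>2"
        unfolding h2 rs by algebra
      finally show ?thesis .
    qed
    have P2: "perturbation M v t x $ 2 = h x * (C x + t * v x $ 2)" "perturbation M v t x $ 3 = h x * (t * v x $ 3)"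
      unfolding perturbation_eq(2)[OF orth] h_def s_def by (simp_all add: M_components)
    have dn: "dens x = a x * (norm (dM x))\<^sup>2 + a x * (C x)\<^sup>2" by (simp add: dens_def norm_dM distrib_left)
    have mon: "rat_monom 0 1 0 t ((norm (v x))\<^sup>2) = r" "rat_monom 1 1 0 t ((norm (v x))\<^sup>2) = t * r"
      "rat_monom 2 1 0 t ((norm (v x))\<^sup>2) = t\<^sup>2 * r" "rat_monom 4 2 0 t ((norm (v x))\<^sup>2) = t ^ 4 * r\<^sup>2"
      by (simp_all add: rat_monom_def r_def s_def)
    have "a x * (norm (P' x))\<^sup>2 + a x * ((perturbation M v t x $ 2)\<^sup>2 + (perturbation M v t x $ 3)\<^sup>2)
      = a x * (r * ((norm (dM x))\<^sup>2 + 2 * t * (dM x \<bullet> v' x) + t\<^sup>2 * (norm (v' x))\<^sup>2) - t ^ 4 * w\<^sup>2 * r\<^sup>2)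
        + a x * ((h x)\<^sup>2 * (C x + t * v x $ 2)\<^sup>2 + (h x)\<^sup>2 * (t * v x $ 3)\<^sup>2)"
      unfolding nP AA P2 power_mult_distrib ..
    also have "\<dots> = perturbed_density v t x"
      unfolding perturbed_density_def mon dn first_coeff_def hessian_def quartic_coeff_def h2 v'_def[symmetric] w_def[symmetric]
      by algebra
    finally show ?case .
  qed
  show "energy a (perturbation M v t) = (\<integral>\<^sup>+x. ennreal (perturbed_density v t x) \<partial>lebesgue)"
    unfolding energy_primitive[OF pP]
    by (rule nn_integral_cong_AE) (use dens in eventually_elim, simp)
  show "AE x in lebesgue. 0 \<le> perturbed_density v t x"
    using dens
  proof eventually_elim
    case (elim x)
    show ?case unfolding elim[symmetric] using a_pos[of x] by (intro add_nonneg_nonneg mult_nonneg_nonneg) auto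
  qed
qed

text \<open>\<open>\<bar>M'\<bar>\<close> and \<open>C\<close> are square integrable, so the first
  coefficient pairs square integrable functions; for the quartic one, boundedness of
  \<open>v\<close> is used.\<close>

lemma integrable_coefficients:
  assumes vH: "v \<in> H1"
  shows "integrable lebesgue (first_coeff v)" "integrable lebesgue (quartic_coeff v)"
proof -
  note v = H1_properties[OF vH]
  have vm: "v \<in> borel_measurable lebesgue" by (rule continuous_measurable_lebesgue[OF v(1)])
  note [measurable] = vm v(4)
  have dM2: "integrable lebesgue (\<lambda>x. (norm (dM x))\<^sup>2)"
  proof (rule Bochner_Integration.integrable_bound[OF integrable_mult_right[OF integrable_C2, of "(A\<^sub>0 / a\<^sub>0)\<^sup>2"]])
    show "AE x in lebesgue. norm ((norm (dM x))\<^sup>2) \<le> norm ((A\<^sub>0 / a\<^sub>0)\<^sup>2 * (C x)\<^sup>2)"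
    proof (rule AE_I2)
      fix x
      have "(q x / a x)\<^sup>2 \<le> (A\<^sub>0 / a\<^sub>0)\<^sup>2" using slope[of x] by (intro power_mono) auto
      then have "(q x / a x)\<^sup>2 * (C x)\<^sup>2 \<le> (A\<^sub>0 / a\<^sub>0)\<^sup>2 * (C x)\<^sup>2" by (rule mult_right_mono) simp
      moreover have "(norm (dM x))\<^sup>2 = (q x / a x)\<^sup>2 * (C x)\<^sup>2"
        unfolding norm_dM by (simp add: power_divide power_mult_distrib)
      ultimately show "norm ((norm (dM x))\<^sup>2) \<le> norm ((A\<^sub>0 / a\<^sub>0)\<^sup>2 * (C x)\<^sup>2)" by simp
    qed
  qed measurable
  have i1: "integrable lebesgue (\<lambda>x. dM x \<bullet> weak_deriv v x)"
  proof (rule Bochner_Integration.integrable_bound[OF Bochner_Integration.integrable_add[OF dM2 v(5)]])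
    show "AE x in lebesgue. norm (dM x \<bullet> weak_deriv v x) \<le> norm ((norm (dM x))\<^sup>2 + (norm (weak_deriv v x))\<^sup>2)"
    proof (rule AE_I2)
      fix x show "norm (dM x \<bullet> weak_deriv v x) \<le> norm ((norm (dM x))\<^sup>2 + (norm (weak_deriv v x))\<^sup>2)"
        using inner_le_squares[of "dM x" "weak_deriv v x"] by simp
    qed
  qed measurable
  have i2: "integrable lebesgue (\<lambda>x. C x * v x $ 2)"
  proof (rule Bochner_Integration.integrable_bound[OF Bochner_Integration.integrable_add[OF integrable_C2 v(2)]])
    show "AE x in lebesgue. norm (C x * v x $ 2) \<le> norm ((C x)\<^sup>2 + (norm (v x))\<^sup>2)"
    proof (rule AE_I2)
      fix x
      have "\<bar>2 * (C x * v x $ 2)\<bar> \<le> (C x)\<^sup>2 + (v x $ 2)\<^sup>2" using inner_le_squares[of "C x" "v x $ 2"] by simp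
      moreover have "(v x $ 2)\<^sup>2 \<le> (norm (v x))\<^sup>2" by (simp add: norm_vec3)
      ultimately show "norm (C x * v x $ 2) \<le> norm ((C x)\<^sup>2 + (norm (v x))\<^sup>2)" by simp
    qed
    have "(\<lambda>x. v x $ 2) \<in> borel_measurable lebesgue"
      by (intro continuous_measurable_lebesgue continuous_on_component v(1))
    then show "(\<lambda>x. C x * v x $ 2) \<in> borel_measurable lebesgue" by measurable
  qed
  show "integrable lebesgue (first_coeff v)" unfolding first_coeff_def[abs_def]
    by (rule Bochner_Integration.integrable_add[OF integrable_bounded_mult[OF a_measurable abs_a_le i1]
          integrable_bounded_mult[OF a_measurable abs_a_le i2]])
  obtain B where B: "0 \<le> B" "\<And>x. (norm (v x))\<^sup>2 \<le> B" using H1_bounded[OF vH] by blast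
  have "integrable lebesgue (\<lambda>x. (v x \<bullet> weak_deriv v x)\<^sup>2)"
  proof (rule Bochner_Integration.integrable_bound[OF integrable_mult_right[OF v(5), of B]])
    show "AE x in lebesgue. norm ((v x \<bullet> weak_deriv v x)\<^sup>2) \<le> norm (B * (norm (weak_deriv v x))\<^sup>2)"
    proof (rule AE_I2)
      fix x
      have "(v x \<bullet> weak_deriv v x)\<^sup>2 \<le> (norm (v x) * norm (weak_deriv v x))\<^sup>2"
        using Cauchy_Schwarz_ineq2[of "v x" "weak_deriv v x"] by (metis abs_ge_zero power2_abs power_mono)
      also have "\<dots> \<le> B * (norm (weak_deriv v x))\<^sup>2"
        unfolding power_mult_distrib using B(2) by (intro mult_right_mono) auto
      finally show "norm ((v x \<bullet> weak_deriv v x)\<^sup>2) \<le> norm (B * (norm (weak_deriv v x))\<^sup>2)"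
        using B(1) by simp
    qed
  qed measurable
  then show "integrable lebesgue (quartic_coeff v)" unfolding quartic_coeff_def[abs_def]
    by (rule integrable_bounded_mult[OF a_measurable abs_a_le])
qed

text \<open>At \<open>t = 0\<close> the functions \<open>1/(1 + t\<^sup>2 y)\<close>,
  \<open>t/(1 + t\<^sup>2 y)\<close>, \<open>t\<^sup>2/(1 + t\<^sup>2 y)\<close> and
  \<open>t\<^sup>4/(1 + t\<^sup>2 y)\<^sup>2\<close> have second derivatives \<open>- 2 y\<close>,
  \<open>0\<close>, \<open>2\<close> and \<open>0\<close>; what survives is twice the integral of
  \<open>hessian v - dens \<bar>v\<bar>\<^sup>2\<close>.\<close>

lemma second_variation:
  assumes vH: "v \<in> H1" and orth: "\<And>x. v x \<bullet> M x = 0"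
  shows "has_second_variation a M v (LINT x|lebesgue. hessian v x - dens x * (norm (v x))\<^sup>2)"
proof -
  define \<rho> where "\<rho> x = (norm (v x))\<^sup>2" for x
  have \<rho>m: "\<rho> \<in> borel_measurable lebesgue" unfolding \<rho>_def
    by (intro continuous_measurable_lebesgue continuous_intros H1_properties(1)[OF vH])
  have \<rho>0: "0 \<le> \<rho> x" for x by (simp add: \<rho>_def)
  obtain B where B: "\<And>x. \<rho> x \<le> B" unfolding \<rho>_def using H1_bounded[OF vH] by blast
  note ci = integrable_dens integrable_coefficients(1)[OF vH] integrable_hessian[OF vH] integrable_coefficients(2)[OF vH]
  define G where "G t = rat_integral dens \<rho> 0 1 0 t + 2 * rat_integral (first_coeff v) \<rho> 1 1 0 t
     + rat_integral (hessian v) \<rho> 2 1 0 t + - 1 * rat_integral (quartic_coeff v) \<rho> 4 2 0 t" for t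
  have en: "energy a (perturbation M v t) = ennreal (G t) \<and> 0 \<le> G t" if t: "\<bar>t\<bar> \<le> 1" for t
  proof -
    note i = integrable_rat[OF ci(1) \<rho>m \<rho>0 B t, of 0 1 0]
      integrable_mult_right[OF integrable_rat[OF ci(2) \<rho>m \<rho>0 B t, of 1 1 0], of 2]
      integrable_rat[OF ci(3) \<rho>m \<rho>0 B t, of 2 1 0]
      integrable_mult_right[OF integrable_rat[OF ci(4) \<rho>m \<rho>0 B t, of 4 2 0], of "- 1"]
    note i12 = Bochner_Integration.integrable_add[OF i(1,2)]
    note i123 = Bochner_Integration.integrable_add[OF i12 i(3)]
    have int: "integrable lebesgue (perturbed_density v t)"
      unfolding perturbed_density_def[abs_def] \<rho>_def[symmetric]
      by (rule Bochner_Integration.integrable_add[OF i123 i(4)])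
    have "(LINT x|lebesgue. perturbed_density v t x) = G t"
      unfolding perturbed_density_def \<rho>_def[symmetric] G_def rat_integral_def
        Bochner_Integration.integral_add[OF i123 i(4)] Bochner_Integration.integral_add[OF i12 i(3)]
        Bochner_Integration.integral_add[OF i(1,2)] integral_mult_right_zero ..
    then show ?thesis
      unfolding energy_perturbation(1)[OF vH orth]
      using nn_integral_eq_integral[OF int energy_perturbation(2)[OF vH orth]]
        integral_nonneg_AE[OF energy_perturbation(2)[OF vH orth, where t = t]] by simp
  qed
  have near: "\<forall>\<^sub>F t in nhds 0. \<bar>t\<bar> \<le> (1::real)"
  proof -
    have "eventually (\<lambda>t. t \<in> {- 1<..<1}) (nhds (0::real))" by (rule eventually_nhds_in_open) auto
    then show ?thesis by eventually_elim auto
  qed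
  note sd = rat_integral_second_deriv[OF ci(1) \<rho>m \<rho>0 B, of 0 1 0] rat_integral_second_deriv[OF ci(2) \<rho>m \<rho>0 B, of 1 1 0]
    rat_integral_second_deriv[OF ci(3) \<rho>m \<rho>0 B, of 2 1 0] rat_integral_second_deriv[OF ci(4) \<rho>m \<rho>0 B, of 4 2 0]
  define T where "T = (LINT x|lebesgue. hessian v x - dens x * (norm (v x))\<^sup>2)"
  have T: "T = (LINT x|lebesgue. hessian v x) - (LINT x|lebesgue. dens x * \<rho> x)"
    unfolding T_def \<rho>_def by (rule Bochner_Integration.integral_diff[OF integrable_hessian[OF vH] integrable_dens_norm[OF vH]])
  have at0: "rat_integral f \<rho> 0 j i 0 = (LINT x|lebesgue. f x * \<rho> x ^ i)" "rat_integral f \<rho> (Suc k) j i 0 = 0" for f j i k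
    by (simp_all add: rat_integral_def rat_monom_def)
  have at1: "rat_integral f \<rho> (numeral n) j i 0 = 0" for f j i n
    by (simp add: rat_integral_def rat_monom_def)
  have "has_second_deriv G (2 * T) 0"
  proof -
    note D = has_second_deriv_add[OF has_second_deriv_add[OF has_second_deriv_add[OF sd(1)
            has_second_deriv_cmult[OF sd(2), of 2]] sd(3)] has_second_deriv_cmult[OF sd(4), of "- 1"]]
    then show ?thesis unfolding G_def[abs_def] by (rule back_subst) (simp add: at0 at1 T algebra_simps)
  qed
  then have "has_second_deriv (\<lambda>t. enn2real (energy a (perturbation M v t))) (2 * T) 0"
    by (rule has_second_deriv_cong) (use near in eventually_elim, simp add: en)
  moreover have "\<forall>\<^sub>F t in nhds 0. energy a (perturbation M v t) < \<infinity>"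
    using near by eventually_elim (simp add: en)
  ultimately show ?thesis unfolding has_second_variation_def T_def[symmetric] by (intro conjI exI[of _ "2 * T"]) auto
qed

end

subsection \<open>The theorem for bounded weights and its transfer\<close>

text \<open>The bounds are assumed at every point because the profile is constructed with pointwise
  values of \<open>a\<close>. The stability statement is moved from \<open>dens\<close> to the
  Lagrange multiplier, with which it agrees almost everywhere.\<close>

lemma wall_of_bounded_weight:
  fixes a :: "real \<Rightarrow> real"
  assumes am: "a \<in> borel_measurable lebesgue" and a0: "0 < a\<^sub>0"
    and ab: "\<And>x. a\<^sub>0 \<le> a x" "\<And>x. a x \<le> A\<^sub>0"
  shows "\<exists>\<phi> m. (\<forall>n. minimizer a n \<longleftrightarrow> n = m) \<and>
         m = (\<lambda>x. vector [sin (\<phi> x), cos (\<phi> x), 0]) \<and>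
         strict_mono \<phi> \<and> (\<exists>L. L-lipschitz_on UNIV \<phi>) \<and> \<phi> 0 = 0 \<and>
         (\<phi> \<longlongrightarrow> pi / 2) at_top \<and> (\<phi> \<longlongrightarrow> - (pi / 2)) at_bot \<and>
         pendulum_on (UNIV - {0}) a \<phi> \<and>
         ((\<forall>x. a (- x) = a x) \<and> mono_on {0<..} a \<longrightarrow>
            (\<forall>x. \<phi> (- x) = - \<phi> x) \<and>
            pendulum_on UNIV a \<phi> \<and>
            critical_point a m \<and>
            (\<forall>v\<in>H1. (\<forall>x. v x \<bullet> m x = 0) \<longrightarrow>
               integrable lebesgue (second_variation_integrand a m v) \<and>
               has_second_variation a m v
                 (LINT x|lebesgue. second_variation_integrand a m v x) \<and>
               (LINT x|lebesgue. second_variation_integrand a m v x) \<ge> 0))"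
proof -
  obtain \<tau> q where w: "wall a \<tau> q a\<^sub>0 A\<^sub>0" and even: "(\<forall>x. a (- x) = a x) \<Longrightarrow>
     (\<forall>x. \<tau> (- x) = - \<tau> x) \<and> (\<forall>x. q (- x) = q x) \<and>
     (\<forall>u v. primitive_on u v q (\<lambda>x. ((q x)\<^sup>2 / a x - a x) * tanh (\<tau> x)))"
    using wall_exists[OF am a0 ab] by blast
  interpret wall a \<tau> q a\<^sub>0 A\<^sub>0 by (rule w)
  show ?thesis
  proof (rule exI[of _ \<phi>], rule exI[of _ M], intro conjI allI impI)
    show "minimizer a n \<longleftrightarrow> n = M" for n using M_minimizer minimizer_unique by blast
    show "\<exists>L. L-lipschitz_on UNIV \<phi>" using \<phi>_lipschitz by blast
    assume sym: "(\<forall>x. a (- x) = a x) \<and> mono_on {0<..} a"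
    interpret symmetric_wall a \<tau> q a\<^sub>0 A\<^sub>0
      by unfold_locales (use sym even in blast)+
    show "\<phi> (- x) = - \<phi> x" for x by (rule \<phi>_odd)
    show "pendulum_on UNIV a \<phi>" by (rule pendulum_all)
    show "critical_point a M" by (rule critical)
    show "\<forall>v\<in>H1. (\<forall>x. v x \<bullet> M x = 0) \<longrightarrow>
               integrable lebesgue (second_variation_integrand a M v) \<and>
               has_second_variation a M v
                 (LINT x|lebesgue. second_variation_integrand a M v x) \<and>
               (LINT x|lebesgue. second_variation_integrand a M v x) \<ge> 0"
    proof (rule ballI, rule impI)
      fix v assume vH: "v \<in> H1" and "\<forall>x. v x \<bullet> M x = 0"
      then have orth: "v x \<bullet> M x = 0" for x by blast
      define Q where "Q x = hessian v x - dens x * (norm (v x))\<^sup>2" for x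
      have Qi: "integrable lebesgue Q"
        unfolding Q_def by (intro Bochner_Integration.integrable_diff integrable_hessian integrable_dens_norm vH)
      have ae: "AE x in lebesgue. Q x = second_variation_integrand a M v x"
        using second_variation_integrand_AE[of v] by eventually_elim (simp add: Q_def)
      have eq: "(LINT x|lebesgue. second_variation_integrand a M v x) = (LINT x|lebesgue. Q x)"
        by (rule lebesgue_integral_cong_AE[OF ae, symmetric])
      have "integrable lebesgue (second_variation_integrand a M v)"
        by (rule integrable_cong_AE_imp[OF Qi borel_measurable_AE[OF borel_measurable_integrable[OF Qi] ae] ae])
      then show "integrable lebesgue (second_variation_integrand a M v) \<and>
               has_second_variation a M v
                 (LINT x|lebesgue. second_variation_integrand a M v x) \<and>
               (LINT x|lebesgue. second_variation_integrand a M v x) \<ge> 0"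
        unfolding eq unfolding Q_def
        using second_variation[OF vH orth] second_variation_nonneg[OF vH orth q_ge_a] sym by blast
    qed
  qed (rule M_eq \<phi>_strict_mono \<phi>_0 \<phi>_limits pendulum_punctured)+
qed

lemma energy_cong_AE:
  assumes "AE x in lebesgue. a x = b x"
  shows "energy a = energy b"
  unfolding energy_def[abs_def]
  by (rule ext, rule nn_integral_cong_AE) (use assms in eventually_elim, simp)

lemma pendulum_on_cong_AE:
  assumes "pendulum_on U b \<phi>" and ab: "AE x in lebesgue. b x = a x"
  shows "pendulum_on U a \<phi>"
proof -
  obtain \<psi> where \<psi>: "has_weak_deriv U \<phi> \<psi>"
    "has_weak_deriv U (\<lambda>x. b x * \<psi> x) (\<lambda>x. - (b x * sin (\<phi> x) * cos (\<phi> x)))"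
    using assms(1) unfolding pendulum_on_def by blast
  have "has_weak_deriv U (\<lambda>x. a x * \<psi> x) (\<lambda>x. - (a x * sin (\<phi> x) * cos (\<phi> x)))"
    by (rule has_weak_deriv_cong_AE[OF \<psi>(2)]) (use ab in eventually_elim, simp)+
  then show ?thesis unfolding pendulum_on_def using \<psi>(1) by blast
qed

lemma critical_point_cong_AE:
  assumes "critical_point b m" and ab: "AE x in lebesgue. b x = a x"
  shows "critical_point a m"
  using assms(1) unfolding critical_point_def
  by (rule has_weak_deriv_cong_AE) (use ab in eventually_elim, simp add: lagrange_multiplier_def)+

theorem theorem1:
  fixes a :: "real \<Rightarrow> real" and a\<^sub>0 A\<^sub>0 :: real
  assumes "a \<in> borel_measurable lebesgue"
    and "0 < a\<^sub>0" and "a\<^sub>0 \<le> A\<^sub>0"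
    and "AE x in lebesgue. a\<^sub>0 \<le> a x \<and> a x \<le> A\<^sub>0"
  shows "(\<exists>!m. minimizer a m) \<and>
    (\<forall>m. minimizer a m \<longrightarrow>
      (\<exists>\<phi>::real \<Rightarrow> real.
         m = (\<lambda>x. vector [sin (\<phi> x), cos (\<phi> x), 0]) \<and>
         strict_mono \<phi> \<and> (\<exists>L. L-lipschitz_on UNIV \<phi>) \<and> \<phi> 0 = 0 \<and>
         (\<phi> \<longlongrightarrow> pi / 2) at_top \<and> (\<phi> \<longlongrightarrow> - (pi / 2)) at_bot \<and>
         pendulum_on (UNIV - {0}) a \<phi> \<and>
         ((\<forall>x. a (- x) = a x) \<and> mono_on {0<..} a \<longrightarrow>
            (\<forall>x. \<phi> (- x) = - \<phi> x) \<and>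
            pendulum_on UNIV a \<phi> \<and>
            critical_point a m \<and>
            (\<forall>v\<in>H1. (\<forall>x. v x \<bullet> m x = 0) \<longrightarrow>
               integrable lebesgue (second_variation_integrand a m v) \<and>
               has_second_variation a m v
                 (LINT x|lebesgue. second_variation_integrand a m v x) \<and>
               (LINT x|lebesgue. second_variation_integrand a m v x) \<ge> 0))))"
proof -
  \<comment> \<open>Clamping changes \<open>a\<close> only on a null set and makes the bounds hold
    everywhere. Being a fixed non-decreasing function of the value \<open>a x\<close>, it preserves
    evenness and monotonicity exactly.\<close>
  define b where "b x = max a\<^sub>0 (min A\<^sub>0 (a x))" for x
  have ba: "AE x in lebesgue. b x = a x"
    using assms(4) by eventually_elim (simp add: b_def)
  have bm: "b \<in> borel_measurable lebesgue"
    unfolding b_def[abs_def] using assms(1) by (intro borel_measurable_max borel_measurable_min borel_measurable_const)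
  have bb: "a\<^sub>0 \<le> b x" "b x \<le> A\<^sub>0" for x using assms(3) by (auto simp: b_def)
  have energy: "energy b = energy a" by (rule energy_cong_AE[OF ba])
  then have min: "minimizer b = minimizer a" by (intro ext) (simp add: minimizer_def)
  obtain \<phi> m where uniq: "\<And>n. minimizer a n \<longleftrightarrow> n = m"
    and m: "m = (\<lambda>x. vector [sin (\<phi> x), cos (\<phi> x), 0])"
    and prof: "strict_mono \<phi>" "\<exists>L. L-lipschitz_on UNIV \<phi>" "\<phi> 0 = 0"
      "(\<phi> \<longlongrightarrow> pi / 2) at_top" "(\<phi> \<longlongrightarrow> - (pi / 2)) at_bot" "pendulum_on (UNIV - {0}) b \<phi>"
    and sym: "(\<forall>x. b (- x) = b x) \<and> mono_on {0<..} b \<longrightarrow>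
            (\<forall>x. \<phi> (- x) = - \<phi> x) \<and>
            pendulum_on UNIV b \<phi> \<and>
            critical_point b m \<and>
            (\<forall>v\<in>H1. (\<forall>x. v x \<bullet> m x = 0) \<longrightarrow>
               integrable lebesgue (second_variation_integrand b m v) \<and>
               has_second_variation b m v
                 (LINT x|lebesgue. second_variation_integrand b m v x) \<and>
               (LINT x|lebesgue. second_variation_integrand b m v x) \<ge> 0)"
    using wall_of_bounded_weight[OF bm assms(2) bb] unfolding min by blast
  have symmetric: "(\<forall>x. \<phi> (- x) = - \<phi> x) \<and>
            pendulum_on UNIV a \<phi> \<and>
            critical_point a m \<and>
            (\<forall>v\<in>H1. (\<forall>x. v x \<bullet> m x = 0) \<longrightarrow>
               integrable lebesgue (second_variation_integrand a m v) \<and>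
               has_second_variation a m v
                 (LINT x|lebesgue. second_variation_integrand a m v x) \<and>
               (LINT x|lebesgue. second_variation_integrand a m v x) \<ge> 0)"
    if a: "(\<forall>x. a (- x) = a x) \<and> mono_on {0<..} a"
  proof -
    have "\<forall>x. b (- x) = b x" using a by (simp add: b_def)
    moreover have "mono_on {0<..} b"
    proof (rule mono_onI)
      fix x y :: real assume "x \<in> {0<..}" "y \<in> {0<..}" "x \<le> y"
      then have "a x \<le> a y" using a by (simp add: mono_on_def)
      then show "b x \<le> b y" unfolding b_def by (intro max.mono min.mono) auto
    qed
    ultimately have odd: "\<forall>x. \<phi> (- x) = - \<phi> x" and pend: "pendulum_on UNIV b \<phi>" and crit: "critical_point b m"
      and stab: "\<And>v. v \<in> H1 \<Longrightarrow> \<forall>x. v x \<bullet> m x = 0 \<Longrightarrow>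
               integrable lebesgue (second_variation_integrand b m v) \<and>
               has_second_variation b m v
                 (LINT x|lebesgue. second_variation_integrand b m v x) \<and>
               (LINT x|lebesgue. second_variation_integrand b m v x) \<ge> 0"
      using sym by blast+
    have ae: "AE x in lebesgue. second_variation_integrand b m v x = second_variation_integrand a m v x" for v
      using ba by eventually_elim (simp add: second_variation_integrand_def lagrange_multiplier_def)
    have eq: "(LINT x|lebesgue. second_variation_integrand b m v x) = (LINT x|lebesgue. second_variation_integrand a m v x)" for v
      by (rule lebesgue_integral_cong_AE[OF ae])
    have int: "integrable lebesgue (second_variation_integrand a m v)"
      if i: "integrable lebesgue (second_variation_integrand b m v)" for v
      by (rule integrable_cong_AE_imp[OF i borel_measurable_AE[OF borel_measurable_integrable[OF i] ae] ae])
    have "integrable lebesgue (second_variation_integrand a m v) \<and>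
               has_second_variation a m v
                 (LINT x|lebesgue. second_variation_integrand a m v x) \<and>
               (LINT x|lebesgue. second_variation_integrand a m v x) \<ge> 0"
      if "v \<in> H1" "\<forall>x. v x \<bullet> m x = 0" for v
      using stab[OF that] int[of v] unfolding has_second_variation_def energy eq by blast
    then show ?thesis
      using odd pendulum_on_cong_AE[OF pend ba] critical_point_cong_AE[OF crit ba] by blast
  qed
  show ?thesis
  proof (rule conjI)
    show "\<exists>!m. minimizer a m" by (rule ex1I[of _ m]) (simp_all add: uniq)
    show "\<forall>m. minimizer a m \<longrightarrow>
      (\<exists>\<phi>::real \<Rightarrow> real.
         m = (\<lambda>x. vector [sin (\<phi> x), cos (\<phi> x), 0]) \<and>
         strict_mono \<phi> \<and> (\<exists>L. L-lipschitz_on UNIV \<phi>) \<and> \<phi> 0 = 0 \<and>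
         (\<phi> \<longlongrightarrow> pi / 2) at_top \<and> (\<phi> \<longlongrightarrow> - (pi / 2)) at_bot \<and>
         pendulum_on (UNIV - {0}) a \<phi> \<and>
         ((\<forall>x. a (- x) = a x) \<and> mono_on {0<..} a \<longrightarrow>
            (\<forall>x. \<phi> (- x) = - \<phi> x) \<and>
            pendulum_on UNIV a \<phi> \<and>
            critical_point a m \<and>
            (\<forall>v\<in>H1. (\<forall>x. v x \<bullet> m x = 0) \<longrightarrow>
               integrable lebesgue (second_variation_integrand a m v) \<and>
               has_second_variation a m v
                 (LINT x|lebesgue. second_variation_integrand a m v x) \<and>
               (LINT x|lebesgue. second_variation_integrand a m v x) \<ge> 0)))"
    proof (rule allI, rule impI)
      fix n assume "minimizer a n"
      then have n: "n = m" by (simp only: uniq)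
      show "\<exists>\<phi>. n = (\<lambda>x. vector [sin (\<phi> x), cos (\<phi> x), 0]) \<and>
         strict_mono \<phi> \<and> (\<exists>L. L-lipschitz_on UNIV \<phi>) \<and> \<phi> 0 = 0 \<and>
         (\<phi> \<longlongrightarrow> pi / 2) at_top \<and> (\<phi> \<longlongrightarrow> - (pi / 2)) at_bot \<and>
         pendulum_on (UNIV - {0}) a \<phi> \<and>
         ((\<forall>x. a (- x) = a x) \<and> mono_on {0<..} a \<longrightarrow>
            (\<forall>x. \<phi> (- x) = - \<phi> x) \<and>
            pendulum_on UNIV a \<phi> \<and>
            critical_point a n \<and>
            (\<forall>v\<in>H1. (\<forall>x. v x \<bullet> n x = 0) \<longrightarrow>
               integrable lebesgue (second_variation_integrand a n v) \<and>
               has_second_variation a n v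
                 (LINT x|lebesgue. second_variation_integrand a n v x) \<and>
               (LINT x|lebesgue. second_variation_integrand a n v x) \<ge> 0))"
        unfolding n
        by (rule exI[of _ \<phi>], intro conjI m prof(1-5) pendulum_on_cong_AE[OF prof(6) ba], rule impI, rule symmetric)
    qed
  qed
qed

end
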